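(* Let $\kappa>0$, $\varphi\in BC^2(\mathbb{R}^2)$, $v_0\in W^{1,2}(\mathbb{R}^2)$, and $F\in L^2(0,\infty;L^2(\mathbb{R}^2))\cap C^\eta_{loc}((0,\infty);L^2(\mathbb{R}^2))$ for some $0<\eta<1$. Let $C_\star=C_\star(\kappa)>0$ be the maximal regularity constant of $-\kappa\Delta_X$ described in the context. Assume that $$\Vert\nabla_X\varphi\Vert_{L^\infty(\mathbb{R}^2)}\le\frac14\quad\text{and}\quad\Vert\nabla_X\varphi\Vert_{L^\infty(\mathbb{R}^2)}\le\frac{1}{4\sqrt{C_\star}}.$$ Let $v$ be the unique strong solution in $C([0,\infty);L^2(\mathbb{R}^2))\cap C((0,\infty);W^{2,2}(\mathbb{R}^2))\cap C^1((0,\infty);L^2(\mathbb{R}^2))$ of $$\frac{dv}{dt}+Lv=F\ \text{ on }(0,\infty),\qquad v|_{t=0}=v_0.$$ Then the following four assertions hold. (i) There is $C_1=C_1(\kappa,\Vert\nabla_X^2\varphi\Vert_{L^\infty(\mathbb{R}^2)})>0$ such that for each $T>0$ $$\Vert G^{1/4}dv/dt\Vert_{L^2(0,T;L^2(\mathbb{R}^2))}+\Vert G^{1/4}Lv\Vert_{L^2(0,T;L^2(\mathbb{R}^2))}\le C_1\Vert v_0\Vert_{\mathscr{W}^{1,2}(\Gamma)}+C_1(1+\sqrt{T})\Vert G^{1/4}F\Vert_{L^2(0,T;L^2(\mathbb{R}^2))}.$$ (ii) Assume in addition that there is $Q={}^t(Q_1,Q_2,Q_3)\in L^2(0,\infty;W^{1,2}(\mathbb{R}^2))$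 such that $$F=g^{\alpha\beta}g_\beta\cdot\frac{\partial Q}{\partial X_\alpha}\ \text{ on }(0,\infty)\qquad\text{and}\qquad Q\cdot(g_1\times g_2)=0\ \text{ on }(0,\infty).$$ Then there is $C_2=C_2(\kappa,\Vert\nabla_X^2\varphi\Vert_{L^\infty(\mathbb{R}^2)})>0$ such that $$\Vert G^{1/4}dv/dt\Vert_{L^2(0,\infty;L^2(\mathbb{R}^2))}+\Vert G^{1/4}Lv\Vert_{L^2(0,\infty;L^2(\mathbb{R}^2))}\le C_2\big(\Vert v_0\Vert_{\mathscr{W}^{1,2}(\Gamma)}+\Vert G^{1/4}F\Vert_{L^2(0,\infty;L^2(\mathbb{R}^2))}+\Vert G^{1/4}Q\Vert_{L^2(0,\infty;L^2(\mathbb{R}^2))}\big).$$ (iii) Assume in addition that $F\equiv0$. Then, with $C_2$ the constant of (ii), $$\Vert G^{1/4}dv/dt\Vert_{L^2(0,\infty;L^2(\mathbb{R}^2))}+\Vert G^{1/4}Lv\Vert_{L^2(0,\infty;L^2(\mathbb{R}^2))}\le C_2\Vert v_0\Vert_{\mathscr{W}^{1,2}(\Gamma)}.$$ (iv) Assume in addition that $F\in L^2(\mathbb{R}^2\times(0,\infty))$. Then $v\in L^2(\mathbb{R}^2\times(0,T))$ for each fixed $T\in(0,\infty)$. The constants $C_1,C_2$ depend only on the indicated quantities (in particular not on $v_0,F,Q,T$).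
   Context: All functions are real-valued. $BC^2(\mathbb{R}^2)$ is the space of $C^2$ functions which are bounded together with their derivatives up to order 2. $\nabla_X={}^t(\partial_{X_1},\partial_{X_2})$, $\Delta_X=\partial_{X_1}^2+\partial_{X_2}^2$; $\Vert\nabla_X\varphi\Vert_{L^\infty(\mathbb{R}^2)}$ and $\Vert\nabla_X^2\varphi\Vert_{L^\infty(\mathbb{R}^2)}$ are the suprema of the Euclidean norms of the gradient and of the Hessian matrix. Set $g_1={}^t(1,0,\partial_{X_1}\varphi)$, $g_2={}^t(0,1,\partial_{X_2}\varphi)$, $g_{\alpha\beta}=g_\alpha\cdot g_\beta$, $G=\det(g_{\alpha\beta})=1+(\partial_{X_1}\varphi)^2+(\partial_{X_2}\varphi)^2$, $(g^{\alpha\beta})=(g_{\alpha\beta})^{-1}$; repeated Greek indices are summed over $\{1,2\}$. The operator $L$ on $L^2(\mathbb{R}^2)$ is $$Lf=-\frac{\kappa}{\sqrt{G}}\frac{\partial}{\partial X_\alpha}\Big(\sqrt{G}g^{\alpha\beta}\frac{\partial f}{\partial X_\beta}\Big),\qquad D(L)=W^{2,2}(\mathbb{R}^2).$$ For $f\in W^{1,2}(\mathbb{R}^2)$, $$\Vert f\Vert_{\mathscr{W}^{1,2}(\Gamma)}=\Big(\Vert G^{1/4}f\Vert_{L^2(\mathbb{R}^2)}^2+\int_{\mathbb{R}^2}g^{\alpha\beta}\frac{\partial f}{\partial X_\alpha}\frac{\partial f}{\partial X_\beta}\sqrt{G}\,dX\Big)^{1/2}.$$ Constant $C_\star$: it is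 a fixed constant depending only on $\kappa$ such that for every $V_0\in W^{1,2}(\mathbb{R}^2)$ and $F\in L^2(0,\infty;L^2(\mathbb{R}^2))$ the unique solution $V$ of $dV/dt-\kappa\Delta_XV=F$ on $(0,\infty)$, $V|_{t=0}=V_0$, satisfies $$\Vert dV/dt\Vert_{L^2(0,\infty;L^2(\mathbb{R}^2))}+\Vert\kappa\Delta_XV\Vert_{L^2(0,\infty;L^2(\mathbb{R}^2))}\le C_\star\big(\Vert V_0\Vert_{W^{1,2}(\mathbb{R}^2)}+\Vert F\Vert_{L^2(0,\infty;L^2(\mathbb{R}^2))}\big).$$ $C^\eta_{loc}((0,\infty);Y)$ is the space of functions which are $\eta$-Hölder continuous with values in $Y$ on each compact subinterval of $(0,\infty)$. A strong solution is a function in the stated class satisfying the equation in $L^2(\mathbb{R}^2)$ for each $t>0$ and the initial condition; existence and uniqueness of $v$ is established separately in the paper under the first smallness condition. Spaces of vector-valued $Q$ are understood componentwise. *)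

theory Defs
  imports "HOL-Analysis.Analysis"
begin

section \<open>The Hilbert space of real square-integrable functions on the plane\<close>

definition square_integrable :: "(real^2 \<Rightarrow> real) \<Rightarrow> bool" where
  "square_integrable f \<longleftrightarrow>
     f \<in> borel_measurable lborel \<and> integrable lborel (\<lambda>x. (f x)\<^sup>2)"

definition L2_eq :: "(real^2 \<Rightarrow> real) \<Rightarrow> (real^2 \<Rightarrow> real) \<Rightarrow> bool" where
  "L2_eq f g \<longleftrightarrow>
     square_integrable f \<and> square_integrable g \<and> (AE x in lborel. f x = g x)"

lemma square_integrable_zero: "square_integrable (\<lambda>_. 0)"
  by (simp add: square_integrable_def)

lemma square_integrable_mult:
  assumes "square_integrable f" "square_integrable g"
  shows "integrable lborel (\<lambda>x. f x * g x)"
proof (rule Bochner_Integration.integrable_bound)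
  show "integrable lborel (\<lambda>x. (f x)\<^sup>2 + (g x)\<^sup>2)"
    using assms by (auto simp: square_integrable_def)
  show "(\<lambda>x. f x * g x) \<in> borel_measurable lborel"
    using assms unfolding square_integrable_def by (intro borel_measurable_times) auto
  show "AE x in lborel. norm (f x * g x) \<le> norm ((f x)\<^sup>2 + (g x)\<^sup>2)"
  proof (intro always_eventually allI)
    fix x
    have "0 \<le> (\<bar>f x\<bar> - \<bar>g x\<bar>)\<^sup>2" by simp
    also have "\<dots> = (f x)\<^sup>2 + (g x)\<^sup>2 - 2 * \<bar>f x * g x\<bar>"
      by (simp add: power2_diff abs_mult)
    finally have "2 * \<bar>f x * g x\<bar> \<le> (f x)\<^sup>2 + (g x)\<^sup>2" by simp
    then show "norm (f x * g x) \<le> norm ((f x)\<^sup>2 + (g x)\<^sup>2)"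
      by (simp add: abs_if split: if_splits)
  qed
qed

lemma square_integrable_add:
  assumes "square_integrable f" "square_integrable g"
  shows "square_integrable (\<lambda>x. f x + g x)"
proof -
  have "integrable lborel (\<lambda>x. (f x)\<^sup>2 + (g x)\<^sup>2 + 2 * (f x * g x))"
    using assms square_integrable_mult[OF assms]
    by (intro Bochner_Integration.integrable_add integrable_mult_right)
      (auto simp: square_integrable_def)
  moreover have "(\<lambda>x. (f x)\<^sup>2 + (g x)\<^sup>2 + 2 * (f x * g x)) = (\<lambda>x. (f x + g x)\<^sup>2)"
    by (auto simp: power2_sum)
  ultimately show ?thesis
    using assms by (auto simp: square_integrable_def)
qed

lemma square_integrable_scale:
  "square_integrable f \<Longrightarrow> square_integrable (\<lambda>x. c * f x)"
  by (auto simp: square_integrable_def power_mult_distrib)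

lemma square_integrable_bounded_mult:
  assumes a: "a \<in> borel_measurable borel" "bounded (range a)" and f: "square_integrable f"
  shows "square_integrable (\<lambda>x. a x * f x)"
proof -
  obtain B where B: "\<And>x. \<bar>a x\<bar> \<le> B"
    using a(2) unfolding bounded_iff by auto
  have meas: "(\<lambda>x. a x * f x) \<in> borel_measurable lborel"
    using a(1) f unfolding square_integrable_def by (auto intro!: borel_measurable_times)
  have "integrable lborel (\<lambda>x. (a x * f x)\<^sup>2)"
  proof (rule Bochner_Integration.integrable_bound)
    show "integrable lborel (\<lambda>x. B\<^sup>2 * (f x)\<^sup>2)"
      using f by (auto simp: square_integrable_def)
    show "(\<lambda>x. (a x * f x)\<^sup>2) \<in> borel_measurable lborel"
      using meas by measurable
    show "AE x in lborel. norm ((a x * f x)\<^sup>2) \<le> norm (B\<^sup>2 * (f x)\<^sup>2)"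
    proof (intro always_eventually allI)
      fix x
      have "(a x)\<^sup>2 \<le> B\<^sup>2" using B[of x] by (simp add: abs_le_square_iff[symmetric])
      then show "norm ((a x * f x)\<^sup>2) \<le> norm (B\<^sup>2 * (f x)\<^sup>2)"
        by (simp add: power_mult_distrib mult_right_mono)
    qed
  qed
  with meas show ?thesis by (simp add: square_integrable_def)
qed

quotient_type L2 = "real^2 \<Rightarrow> real" / partial: L2_eq
proof (rule part_equivpI)
  show "\<exists>f. L2_eq f f"
    by (rule exI[of _ "\<lambda>_. 0"]) (simp add: L2_eq_def square_integrable_zero)
  show "symp L2_eq"
    by (auto simp: symp_def L2_eq_def)
  show "transp L2_eq"
    unfolding transp_def L2_eq_def by (auto elim: eventually_elim2)
qed

instantiation L2 :: real_vector
begin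

lift_definition zero_L2 :: L2 is "\<lambda>_. 0"
  by (simp add: L2_eq_def square_integrable_zero)

lift_definition plus_L2 :: "L2 \<Rightarrow> L2 \<Rightarrow> L2" is "\<lambda>f g x. f x + g x"
  by (auto simp: L2_eq_def intro: square_integrable_add elim: eventually_elim2)

lift_definition uminus_L2 :: "L2 \<Rightarrow> L2" is "\<lambda>f x. - f x"
  using square_integrable_scale[of _ "-1"] by (auto simp: L2_eq_def)

lift_definition minus_L2 :: "L2 \<Rightarrow> L2 \<Rightarrow> L2" is "\<lambda>f g x. f x - g x"
  using square_integrable_add[OF _ square_integrable_scale[of _ "-1"]]
  by (auto simp: L2_eq_def elim: eventually_elim2)

lift_definition scaleR_L2 :: "real \<Rightarrow> L2 \<Rightarrow> L2" is "\<lambda>c f x. c * f x"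
  by (auto simp: L2_eq_def intro: square_integrable_scale)

instance
proof
  fix f g h :: L2 and a b :: real
  show "f + g + h = f + (g + h)"
    by transfer (auto simp: L2_eq_def add.assoc intro: square_integrable_add)
  show "f + g = g + f"
    by transfer (auto simp: L2_eq_def add.commute intro: square_integrable_add)
  show "0 + f = f"
    by transfer (auto simp: L2_eq_def)
  show "- f + f = 0"
    by transfer (auto simp: L2_eq_def square_integrable_zero)
  show "f - g = f + - g"
    by transfer (use square_integrable_add[OF _ square_integrable_scale[of _ "-1"]]
      in \<open>auto simp: L2_eq_def\<close>)
  show "a *\<^sub>R (f + g) = a *\<^sub>R f + a *\<^sub>R g"
    by transfer (auto simp: L2_eq_def distrib_left[symmetric]
      intro!: square_integrable_add square_integrable_scale)
  show "(a + b) *\<^sub>R f = a *\<^sub>R f + b *\<^sub>R f"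
    by transfer (auto simp: L2_eq_def distrib_right[symmetric]
      intro!: square_integrable_add square_integrable_scale)
  show "a *\<^sub>R b *\<^sub>R f = (a * b) *\<^sub>R f"
    by transfer (auto simp: L2_eq_def mult.assoc[symmetric] intro!: square_integrable_scale)
  show "1 *\<^sub>R f = f"
    by transfer (auto simp: L2_eq_def)
qed

end

instantiation L2 :: real_inner
begin

lift_definition inner_L2 :: "L2 \<Rightarrow> L2 \<Rightarrow> real" is "\<lambda>f g. LINT x|lborel. f x * g x"
  by (rule integral_cong_AE)
    (auto simp: L2_eq_def square_integrable_def elim: eventually_elim2)

definition norm_L2 :: "L2 \<Rightarrow> real" where
  "norm_L2 f = sqrt (f \<bullet> f)"

definition dist_L2 :: "L2 \<Rightarrow> L2 \<Rightarrow> real" where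
  "dist_L2 f g = norm (f - g)"

definition sgn_L2 :: "L2 \<Rightarrow> L2" where
  "sgn_L2 f = f /\<^sub>R norm f"

definition uniformity_L2 :: "(L2 \<times> L2) filter" where
  "uniformity_L2 = (INF e\<in>{0<..}. principal {(f, g). dist f g < e})"

definition open_L2 :: "L2 set \<Rightarrow> bool" where
  "open_L2 U \<longleftrightarrow> (\<forall>f\<in>U. eventually (\<lambda>(f', g). f' = f \<longrightarrow> g \<in> U) uniformity)"

instance
proof
  fix f g h :: L2 and a :: real
  show "dist f g = norm (f - g)"
    by (rule dist_L2_def)
  show "sgn f = f /\<^sub>R norm f"
    by (rule sgn_L2_def)
  show "(uniformity :: (L2 \<times> L2) filter) = (INF e\<in>{0<..}. principal {(f, g). dist f g < e})"
    by (rule uniformity_L2_def)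
  show "open U \<longleftrightarrow> (\<forall>f\<in>U. eventually (\<lambda>(f', g). f' = f \<longrightarrow> g \<in> U) uniformity)"
    for U :: "L2 set"
    by (rule open_L2_def)
  show "f \<bullet> g = g \<bullet> f"
    by transfer (simp add: mult.commute)
  show "(f + g) \<bullet> h = f \<bullet> h + g \<bullet> h"
    by transfer (auto simp: L2_eq_def distrib_right square_integrable_mult)
  show "(a *\<^sub>R f) \<bullet> g = a * (f \<bullet> g)"
    by transfer (simp add: mult.assoc)
  show "0 \<le> f \<bullet> f"
    by transfer (simp add: integral_nonneg_AE)
  show "f \<bullet> f = 0 \<longleftrightarrow> f = 0"
  proof transfer
    fix f assume f: "L2_eq f f"
    then have "integrable lborel (\<lambda>x. f x * f x)"
      by (auto simp: L2_eq_def intro: square_integrable_mult)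
    then have "(LINT x|lborel. f x * f x) = 0 \<longleftrightarrow> (AE x in lborel. f x * f x = 0)"
      by (intro integral_nonneg_eq_0_iff_AE) auto
    with f show "(LINT x|lborel. f x * f x) = 0 \<longleftrightarrow> L2_eq f (\<lambda>_. 0)"
      by (simp add: L2_eq_def square_integrable_zero)
  qed
  show "norm f = sqrt (f \<bullet> f)"
    by (rule norm_L2_def)
qed

end

text \<open>
  Multiplication by a bounded Borel function. Every coefficient below is bounded and
  continuous when \<open>\<phi>\<close> is in \<open>BC2\<close>, so that the default value 0 is never used.
\<close>

lift_definition mult_L2 :: "(real^2 \<Rightarrow> real) \<Rightarrow> L2 \<Rightarrow> L2" is
  "\<lambda>a f x. if a \<in> borel_measurable borel \<and> bounded (range a) then a x * f x else 0"
  subgoal for a f g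
    by (cases "a \<in> borel_measurable borel \<and> bounded (range a)")
      (auto simp: L2_eq_def square_integrable_zero intro: square_integrable_bounded_mult
        elim: eventually_mono)
  done


section \<open>Classical derivatives\<close>

definition partial :: "2 \<Rightarrow> (real^2 \<Rightarrow> real) \<Rightarrow> real^2 \<Rightarrow> real" where
  "partial i f x = frechet_derivative f (at x) (axis i 1)"

fun Ck :: "nat \<Rightarrow> (real^2 \<Rightarrow> real) \<Rightarrow> bool" where
  "Ck 0 f \<longleftrightarrow> continuous_on UNIV f"
| "Ck (Suc k) f \<longleftrightarrow> (\<forall>x. f differentiable (at x)) \<and> (\<forall>i. Ck k (partial i f))"

definition BC2 :: "(real^2 \<Rightarrow> real) \<Rightarrow> bool" where
  "BC2 f \<longleftrightarrow> Ck 2 f \<and> bounded (range f) \<and> (\<forall>i. bounded (range (partial i f))) \<and>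
     (\<forall>i j. bounded (range (partial i (partial j f))))"

definition gradient :: "(real^2 \<Rightarrow> real) \<Rightarrow> real^2 \<Rightarrow> real^2" where
  "gradient f x = (\<chi> i. partial i f x)"

definition hessian :: "(real^2 \<Rightarrow> real) \<Rightarrow> real^2 \<Rightarrow> real^2^2" where
  "hessian f x = (\<chi> i j. partial i (partial j f) x)"

text \<open>The norm of \<^typ>\<open>real^2^2\<close> is the Euclidean (Frobenius) norm of the matrix.\<close>

definition gradient_sup_norm :: "(real^2 \<Rightarrow> real) \<Rightarrow> real" where
  "gradient_sup_norm f = (SUP x. norm (gradient f x))"

definition hessian_sup_norm :: "(real^2 \<Rightarrow> real) \<Rightarrow> real" where
  "hessian_sup_norm f = (SUP x. norm (hessian f x))"


section \<open>Weak derivatives and Sobolev spaces\<close>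

definition test_function :: "(real^2 \<Rightarrow> real) \<Rightarrow> bool" where
  "test_function \<psi> \<longleftrightarrow> (\<forall>k. Ck k \<psi>) \<and> compact (closure {x. \<psi> x \<noteq> 0})"

definition has_weak_partial :: "2 \<Rightarrow> L2 \<Rightarrow> L2 \<Rightarrow> bool" where
  "has_weak_partial i f g \<longleftrightarrow> (\<forall>\<psi>. test_function \<psi> \<longrightarrow>
     (LINT x|lborel. rep_L2 f x * partial i \<psi> x) = - (LINT x|lborel. rep_L2 g x * \<psi> x))"

definition weak_partial :: "2 \<Rightarrow> L2 \<Rightarrow> L2" where
  "weak_partial i f = (THE g. has_weak_partial i f g)"

definition W12 :: "L2 set" where
  "W12 = {f. \<forall>i. \<exists>g. has_weak_partial i f g}"

definition W22 :: "L2 set" where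
  "W22 = {f \<in> W12. \<forall>i. weak_partial i f \<in> W12}"

definition W12_norm :: "L2 \<Rightarrow> real" where
  "W12_norm f = sqrt ((norm f)\<^sup>2 + (\<Sum>i\<in>UNIV. (norm (weak_partial i f))\<^sup>2))"

definition W22_norm :: "L2 \<Rightarrow> real" where
  "W22_norm f = sqrt ((norm f)\<^sup>2 + (\<Sum>i\<in>UNIV. (norm (weak_partial i f))\<^sup>2) +
     (\<Sum>i\<in>UNIV. \<Sum>j\<in>UNIV. (norm (weak_partial i (weak_partial j f)))\<^sup>2))"

definition laplacian :: "L2 \<Rightarrow> L2" where
  "laplacian f = (\<Sum>i\<in>UNIV. weak_partial i (weak_partial i f))"


section \<open>Functions of time\<close>

text \<open>
  The spaces \<^typ>\<open>L2\<close> and \<open>L2 ^ 3\<close> are separable, so that Borel measurability of a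
  function with values in them is the same as strong (Bochner) measurability.
\<close>

definition L2_time :: "real set \<Rightarrow> (real \<Rightarrow> 'a::real_normed_vector) \<Rightarrow> bool" where
  "L2_time S f \<longleftrightarrow> f \<in> borel_measurable (lebesgue_on S) \<and>
     integrable (lebesgue_on S) (\<lambda>t. (norm (f t))\<^sup>2)"

definition L2_time_norm :: "real set \<Rightarrow> (real \<Rightarrow> 'a::real_normed_vector) \<Rightarrow> real" where
  "L2_time_norm S f = sqrt (LINT t|lebesgue_on S. (norm (f t))\<^sup>2)"

text \<open>
  The map sending \<open>f\<close> to \<open>f\<close> and its weak gradient embeds \<open>W12\<close> isometrically into a
  product of copies of \<^typ>\<open>L2\<close>; hence \<open>L\<^sup>2(S; W12)\<close> may be described componentwise.
\<close>

definition L2_time_W12 :: "real set \<Rightarrow> (real \<Rightarrow> L2) \<Rightarrow> bool" where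
  "L2_time_W12 S f \<longleftrightarrow> (AE t in lebesgue_on S. f t \<in> W12) \<and> L2_time S f \<and>
     (\<forall>i. L2_time S (\<lambda>t. weak_partial i (f t)))"

definition Holder_loc :: "real \<Rightarrow> (real \<Rightarrow> L2) \<Rightarrow> bool" where
  "Holder_loc \<eta> F \<longleftrightarrow> (\<forall>a b. 0 < a \<and> a \<le> b \<longrightarrow>
     (\<exists>C. \<forall>s\<in>{a..b}. \<forall>t\<in>{a..b}. norm (F s - F t) \<le> C * \<bar>s - t\<bar> powr \<eta>))"

text \<open>
  \<open>f\<close>, defined on the time set \<open>S\<close>, is represented by a square-integrable function of
  \<open>(x, t)\<close> on the product of the plane and \<open>S\<close>.
\<close>

definition L2_space_time :: "real set \<Rightarrow> (real \<Rightarrow> L2) \<Rightarrow> bool" where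
  "L2_space_time S f \<longleftrightarrow> (\<exists>u :: (real^2) \<times> real \<Rightarrow> real.
     u \<in> borel_measurable borel \<and>
     set_integrable lborel (UNIV \<times> S) (\<lambda>z. (u z)\<^sup>2) \<and>
     (AE t in lebesgue_on S. AE x in lborel. rep_L2 (f t) x = u (x, t)))"


section \<open>Maximal regularity for the heat equation\<close>

text \<open>
  \<open>V\<close> solves \<open>dV/dt - \<kappa> \<Delta> V = F\<close> on the positive half-line with \<open>V(0) = V0\<close>, in the
  maximal regularity class, and \<open>V'\<close> is its time derivative: \<open>V\<close> is the primitive of \<open>V'\<close>,
  and since \<open>V'\<close> is locally Bochner integrable the gauge integral is the Bochner integral.
\<close>

definition heat_solution ::
    "real \<Rightarrow> L2 \<Rightarrow> (real \<Rightarrow> L2) \<Rightarrow> (real \<Rightarrow> L2) \<Rightarrow> (real \<Rightarrow> L2) \<Rightarrow> bool" where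
  "heat_solution \<kappa> V0 F V V' \<longleftrightarrow>
     V 0 = V0 \<and> L2_time {0<..} V' \<and>
     (\<forall>t\<ge>0. (V' has_integral (V t - V 0)) {0..t}) \<and>
     (AE t in lebesgue_on {0<..}. V t \<in> W22 \<and> V' t - \<kappa> *\<^sub>R laplacian (V t) = F t)"

text \<open>Uniqueness of the solution on \<open>[0, \<infinity>)\<close> follows from the estimate by linearity.\<close>

definition maximal_regularity_constant :: "real \<Rightarrow> real \<Rightarrow> bool" where
  "maximal_regularity_constant \<kappa> C \<longleftrightarrow>
     (\<forall>V0 F. V0 \<in> W12 \<and> L2_time {0<..} F \<longrightarrow>
       (\<exists>V V'. heat_solution \<kappa> V0 F V V') \<and>
       (\<forall>V V'. heat_solution \<kappa> V0 F V V' \<longrightarrow>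
         L2_time_norm {0<..} V' + L2_time_norm {0<..} (\<lambda>t. \<kappa> *\<^sub>R laplacian (V t))
           \<le> C * (W12_norm V0 + L2_time_norm {0<..} F)))"


section \<open>Geometry of the graph of \<open>\<phi>\<close> and the operator \<open>L\<close>\<close>

definition tangent :: "(real^2 \<Rightarrow> real) \<Rightarrow> 2 \<Rightarrow> real^2 \<Rightarrow> real^3" where
  "tangent \<phi> \<alpha> x =
     vector [if \<alpha> = 1 then 1 else 0, if \<alpha> = 2 then 1 else 0, partial \<alpha> \<phi> x]"

definition metric :: "(real^2 \<Rightarrow> real) \<Rightarrow> real^2 \<Rightarrow> real^2^2" where
  "metric \<phi> x = (\<chi> \<alpha> \<beta>. tangent \<phi> \<alpha> x \<bullet> tangent \<phi> \<beta> x)"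

definition metric_det :: "(real^2 \<Rightarrow> real) \<Rightarrow> real^2 \<Rightarrow> real" where
  "metric_det \<phi> x = det (metric \<phi> x)"

definition inv_metric :: "(real^2 \<Rightarrow> real) \<Rightarrow> 2 \<Rightarrow> 2 \<Rightarrow> real^2 \<Rightarrow> real" where
  "inv_metric \<phi> \<alpha> \<beta> x = matrix_inv (metric \<phi> x) $ \<alpha> $ \<beta>"

text \<open>Only meaningful on \<^const>\<open>W22\<close>, the domain of the operator.\<close>

definition L_op :: "real \<Rightarrow> (real^2 \<Rightarrow> real) \<Rightarrow> L2 \<Rightarrow> L2" where
  "L_op \<kappa> \<phi> f =
     mult_L2 (\<lambda>x. - (\<kappa> / sqrt (metric_det \<phi> x)))
       (\<Sum>\<alpha>\<in>UNIV. weak_partial \<alpha>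
         (\<Sum>\<beta>\<in>UNIV. mult_L2 (\<lambda>x. sqrt (metric_det \<phi> x) * inv_metric \<phi> \<alpha> \<beta> x)
           (weak_partial \<beta> f)))"

definition G_quarter :: "(real^2 \<Rightarrow> real) \<Rightarrow> L2 \<Rightarrow> L2" where
  "G_quarter \<phi> f = mult_L2 (\<lambda>x. metric_det \<phi> x powr (1/4)) f"

definition W12_Gamma_norm :: "(real^2 \<Rightarrow> real) \<Rightarrow> L2 \<Rightarrow> real" where
  "W12_Gamma_norm \<phi> f = sqrt ((norm (G_quarter \<phi> f))\<^sup>2 +
     (LINT x|lborel. (\<Sum>\<alpha>\<in>UNIV. \<Sum>\<beta>\<in>UNIV. inv_metric \<phi> \<alpha> \<beta> x *
        rep_L2 (weak_partial \<alpha> f) x * rep_L2 (weak_partial \<beta> f) x) * sqrt (metric_det \<phi> x)))"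

definition dot_L2 :: "(real^2 \<Rightarrow> real^3) \<Rightarrow> L2^3 \<Rightarrow> L2" where
  "dot_L2 a q = (\<Sum>i\<in>UNIV. mult_L2 (\<lambda>x. a x $ i) (q $ i))"

definition surface_div :: "(real^2 \<Rightarrow> real) \<Rightarrow> L2^3 \<Rightarrow> L2" where
  "surface_div \<phi> q = (\<Sum>\<alpha>\<in>UNIV. \<Sum>\<beta>\<in>UNIV. mult_L2 (inv_metric \<phi> \<alpha> \<beta>)
     (dot_L2 (tangent \<phi> \<beta>) (\<chi> i. weak_partial \<alpha> (q $ i))))"

definition strong_solution ::
    "real \<Rightarrow> (real^2 \<Rightarrow> real) \<Rightarrow> L2 \<Rightarrow> (real \<Rightarrow> L2) \<Rightarrow> (real \<Rightarrow> L2) \<Rightarrow> bool" where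
  "strong_solution \<kappa> \<phi> v0 F v \<longleftrightarrow>
     continuous_on {0..} v \<and>
     (\<forall>t>0. v t \<in> W22) \<and>
     (\<forall>t>0. ((\<lambda>s. W22_norm (v s - v t)) \<longlongrightarrow> 0) (at t)) \<and>
     (\<forall>t>0. v differentiable (at t)) \<and>
     continuous_on {0<..} (\<lambda>t. vector_derivative v (at t)) \<and>
     (\<forall>t>0. vector_derivative v (at t) + L_op \<kappa> \<phi> (v t) = F t) \<and>
     v 0 = v0"

end

theory Submission
  imports Defs "HOL-Computational_Algebra.Polynomial"
begin

text \<open>
  On \<open>L\<^sup>2(\<surd>G dX)\<close>, that is, after multiplication by \<open>G\<^sup>1\<^sup>/\<^sup>4\<close>, the operator \<open>L\<close> is symmetric, with the
  nonnegative form \<open>a(f, g) = \<kappa> \<integral> \<surd>G g\<^sup>\<alpha>\<^sup>\<beta> \<partial>\<^sub>\<alpha>f \<partial>\<^sub>\<beta>g dX\<close>. All estimates come from the energy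
  \<open>e(t) = a(v(t), v(t))\<close>. By symmetry \<open>e(t) - e(s)\<close> is the product of \<open>Lv(t) + Lv(s)\<close> and
  \<open>v(t) - v(s)\<close>, so \<open>e' = 2 \<langle>Lv, v'\<rangle>\<close>, although \<open>v'\<close> only takes values in \<open>L\<^sup>2\<close>; squaring
  \<open>v' + Lv = F\<close> gives \<open>e' + |v'|\<^sup>2 + |Lv|\<^sup>2 = |F|\<^sup>2\<close> for positive times.

  It remains to bound \<open>e(t)\<close> as \<open>t\<close> tends to 0, where \<open>v\<close> is only known to converge in \<open>L\<^sup>2\<close>. From
  \<open>\<langle>Lv, v - v\<^sub>0\<rangle> = a(v, v - v\<^sub>0) \<ge> (e - a(v\<^sub>0, v\<^sub>0)) / 2\<close> one sees that \<open>|v - v\<^sub>0|\<^sup>2\<close>, which vanishes at time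
  0, would become negative if \<open>e\<close> were much larger than \<open>a(v\<^sub>0, v\<^sub>0)\<close> and the
  contribution of \<open>F\<close> on a time interval starting at 0
  (lemma \<open>energy_bound\<close>). Integrating the balance over compact time intervals and letting them
  grow gives the bounds on \<open>v'\<close> and \<open>Lv\<close>, both on \<open>(0, T)\<close> and on \<open>(0, \<infinity>)\<close> (lemma
  \<open>energy_estimate\<close>).

  The identity \<open>\<langle>Lf, g\<rangle> = a(f, g)\<close> for \<open>f\<close> in \<open>W\<^sup>2\<^sup>,\<^sup>2\<close> and \<open>g\<close> in \<open>W\<^sup>1\<^sup>,\<^sup>2\<close> (lemma \<open>inner_G_quarter_L_op\<close>)
  needs integration by parts in \<open>W\<^sup>1\<^sup>,\<^sup>2\<close> (lemma \<open>weak_partial_parts\<close>) and the product rule for weak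
  derivatives and \<open>C\<^sup>1\<close> coefficients. Both rest on the continuity of translations in \<open>L\<^sup>2\<close> and on
  the existence of smooth bump functions. Finally, a continuous function of time with values in
  \<open>L\<^sup>2\<close> has a jointly measurable representative (lemma \<open>L2_space_time_continuous\<close>).
\<close>

section \<open>The space of square-integrable functions\<close>

lemma L2_eq_rep: "L2_eq (rep_L2 f) (rep_L2 f)"
  using Quotient_L2 by (rule Quotient_rep_reflp)

lemma square_integrable_rep: "square_integrable (rep_L2 f)"
  using L2_eq_rep by (simp add: L2_eq_def)

lemma rep_measurable [measurable]: "rep_L2 f \<in> borel_measurable borel"
  using square_integrable_rep[of f] by (simp add: square_integrable_def)

lemma abs_rep_L2 [simp]: "abs_L2 (rep_L2 f) = f"
  using Quotient_L2 by (rule Quotient_abs_rep)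

lemma L2_eq_rep_abs: "square_integrable f \<Longrightarrow> L2_eq (rep_L2 (abs_L2 f)) f"
  by (rule Quotient_rep_abs[OF Quotient_L2]) (simp add: L2_eq_def)

lemma rep_abs_AE: "square_integrable f \<Longrightarrow> AE x in lborel. rep_L2 (abs_L2 f) x = f x"
  using L2_eq_rep_abs by (simp add: L2_eq_def)

lemma L2_eqI: "(AE x in lborel. rep_L2 f x = rep_L2 g x) \<Longrightarrow> f = g"
  using Quotient_rel_abs[OF Quotient_L2, of "rep_L2 f" "rep_L2 g"]
  by (simp add: L2_eq_def square_integrable_rep)

lemma rep_add_AE: "AE x in lborel. rep_L2 (f + g) x = rep_L2 f x + rep_L2 g x"
  using plus_L2.abs_eq[OF L2_eq_rep L2_eq_rep, of f g]
    rep_abs_AE[OF square_integrable_add[OF square_integrable_rep[of f] square_integrable_rep[of g]]]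
  by simp

lemma rep_scaleR_AE: "AE x in lborel. rep_L2 (c *\<^sub>R f) x = c * rep_L2 f x"
  using scaleR_L2.abs_eq[OF L2_eq_rep, of c f]
    rep_abs_AE[OF square_integrable_scale[OF square_integrable_rep[of f]]]
  by simp

lemma rep_diff_AE: "AE x in lborel. rep_L2 (f - g) x = rep_L2 f x - rep_L2 g x"
proof -
  have "f - g = f + (-1) *\<^sub>R g" by simp
  then show ?thesis
    using rep_add_AE[of f "(-1) *\<^sub>R g"] rep_scaleR_AE[of "-1" g] by (auto elim: eventually_elim2)
qed

lemma rep_mult_AE:
  assumes "a \<in> borel_measurable borel" "bounded (range a)"
  shows "AE x in lborel. rep_L2 (mult_L2 a f) x = a x * rep_L2 f x"
  using mult_L2.abs_eq[OF L2_eq_rep, of a f] assms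
    rep_abs_AE[OF square_integrable_bounded_mult[OF assms square_integrable_rep[of f]]]
  by simp

lemma inner_L2_rep: "f \<bullet> g = (LINT x|lborel. rep_L2 f x * rep_L2 g x)"
  by (simp add: inner_L2_def)

lemma integrable_rep_mult: "integrable lborel (\<lambda>x. rep_L2 f x * rep_L2 g x)"
  by (intro square_integrable_mult square_integrable_rep)

lemma inner_abs_L2:
  assumes "square_integrable f" "square_integrable g"
  shows "abs_L2 f \<bullet> abs_L2 g = (LINT x|lborel. f x * g x)"
  using inner_L2.abs_eq[of f g] assms by (simp add: L2_eq_def)

lemma norm_abs_L2:
  assumes "square_integrable f"
  shows "norm (abs_L2 f) = sqrt (LINT x|lborel. (f x)\<^sup>2)"
  using inner_abs_L2[OF assms assms] by (simp add: norm_L2_def power2_eq_square)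

lemma Cauchy_Schwarz_integral:
  assumes "square_integrable f" "square_integrable g"
  shows "\<bar>LINT x|lborel. f x * g x\<bar> \<le> sqrt (LINT x|lborel. (f x)\<^sup>2) * sqrt (LINT x|lborel. (g x)\<^sup>2)"
  using Cauchy_Schwarz_ineq2[of "abs_L2 f" "abs_L2 g"] assms
  by (simp add: inner_abs_L2 norm_abs_L2)

lemma square_integrable_measurable:
  "square_integrable f \<Longrightarrow> f \<in> borel_measurable borel"
  by (simp add: square_integrable_def)

lemma square_integrable_diff:
  assumes "square_integrable f" "square_integrable g"
  shows "square_integrable (\<lambda>x. f x - g x)"
  using square_integrable_add[OF assms(1) square_integrable_scale[OF assms(2), of "-1"]] by simp

section \<open>Translations\<close>

lemma lborel_reflect_shift:
  fixes t :: "'a::euclidean_space" and c :: real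
  assumes "\<bar>c\<bar> = 1"
  shows "lborel = distr lborel borel (\<lambda>x. t + c *\<^sub>R x)"
  using lborel_affine[of c t] assms by (auto simp: density_1)

lemma integral_shift:
  fixes h :: "'a::euclidean_space \<Rightarrow> real"
  assumes [measurable]: "h \<in> borel_measurable borel"
  shows "(LINT x|lborel. h (x - z)) = (LINT x|lborel. h x)"
    and "(LINT x|lborel. h (x + z)) = (LINT x|lborel. h x)"
    and "(LINT x|lborel. h (z - x)) = (LINT x|lborel. h x)"
proof -
  have *: "(LINT x|lborel. h (t + c *\<^sub>R x)) = (LINT x|lborel. h x)" if "\<bar>c\<bar> = 1" for t :: 'a and c
  proof -
    have "(LINT x|distr lborel borel (\<lambda>x. t + c *\<^sub>R x). h x) = (LINT x|lborel. h (t + c *\<^sub>R x))"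
      by (rule integral_distr) auto
    then show ?thesis by (simp only: lborel_reflect_shift[OF that, of t, symmetric])
  qed
  show "(LINT x|lborel. h (x - z)) = (LINT x|lborel. h x)" using *[of 1 "-z"] by simp
  show "(LINT x|lborel. h (x + z)) = (LINT x|lborel. h x)"
    using *[of 1 "z"] by (simp add: add.commute)
  show "(LINT x|lborel. h (z - x)) = (LINT x|lborel. h x)" using *[of "-1" "z"] by simp
qed

lemma integrable_shift:
  fixes h :: "'a::euclidean_space \<Rightarrow> real"
  assumes h: "integrable lborel h"
  shows "integrable lborel (\<lambda>x. h (x - z))" "integrable lborel (\<lambda>x. h (x + z))"
    "integrable lborel (\<lambda>x. h (z - x))"
proof -
  have m: "h \<in> borel_measurable borel" using h by auto
  have *: "integrable lborel (\<lambda>x. h (t + c *\<^sub>R x))" if "\<bar>c\<bar> = 1" for t :: 'a and c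
  proof -
    have "integrable (distr lborel borel (\<lambda>x. t + c *\<^sub>R x)) h"
      using h by (simp only: lborel_reflect_shift[OF that, of t, symmetric])
    then show ?thesis by (subst (asm) integrable_distr_eq) (use m in auto)
  qed
  show "integrable lborel (\<lambda>x. h (x - z))" using *[of 1 "-z"] by simp
  show "integrable lborel (\<lambda>x. h (x + z))"
    using *[of 1 "z"] by (simp add: add.commute)
  show "integrable lborel (\<lambda>x. h (z - x))" using *[of "-1" "z"] by simp
qed

lemma square_integrable_shift:
  assumes "square_integrable f"
  shows "square_integrable (\<lambda>x. f (x - z))" "square_integrable (\<lambda>x. f (x + z))"
proof -
  have [measurable]: "f \<in> borel_measurable borel" by (rule square_integrable_measurable[OF assms])
  have "integrable lborel (\<lambda>x. (f x)\<^sup>2)" using assms by (simp add: square_integrable_def)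
  note i = integrable_shift[OF this, of z]
  show "square_integrable (\<lambda>x. f (x - z))" using i by (simp add: square_integrable_def)
  show "square_integrable (\<lambda>x. f (x + z))" using i by (simp add: square_integrable_def)
qed

text \<open>Here and below, bounded support is expressed by a radius \<open>R\<close> beyond which the function
  vanishes.\<close>

lemma continuous_bounded_support:
  fixes h :: "'a::euclidean_space \<Rightarrow> real"
  assumes "continuous_on UNIV h" and h: "\<And>x. h x \<noteq> 0 \<Longrightarrow> norm x \<le> R"
  shows "bounded (range h)" "integrable lborel h"
proof -
  have "compact (h ` cball 0 R)"
    by (intro compact_continuous_image continuous_on_subset[OF assms(1)]) auto
  from compact_imp_bounded[OF this] obtain B where B: "\<And>x. norm x \<le> R \<Longrightarrow> \<bar>h x\<bar> \<le> B"
    unfolding bounded_iff by (metis image_eqI mem_cball_0 real_norm_def)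
  have "\<bar>h x\<bar> \<le> max B 0" for x using B[of x] h[of x] by fastforce
  then show "bounded (range h)" unfolding bounded_iff by auto
  have "integrable lborel (\<lambda>x. indicator (cball 0 R) x *\<^sub>R h x)"
    using borel_integrable_compact[of "cball 0 R" h] assms(1)
    by (auto intro: continuous_on_subset simp: set_integrable_def)
  moreover have "(\<lambda>x. indicator (cball 0 R) x *\<^sub>R h x) = h" using h by (force simp: indicator_def)
  ultimately show "integrable lborel h" by simp
qed

text \<open>Truncating in range and in space reduces the claim to bounded functions supported in a ball,
  to which the almost everywhere approximation by continuous functions applies.\<close>

lemma continuous_dense_square_integrable:
  assumes f: "square_integrable f" and e: "e > 0"
  obtains g R where "continuous_on UNIV g" "\<And>x. g x \<noteq> 0 \<Longrightarrow> norm x \<le> R" "square_integrable g"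
    "(LINT x|lborel. (f x - g x)\<^sup>2) < e"
proof -
  note [measurable] = square_integrable_measurable[OF f]
  define cut :: "nat \<Rightarrow> real^2 \<Rightarrow> real" where "cut n x = max 0 (min 1 (real n + 1 - norm x))" for n x
  have cutc: "continuous_on UNIV (cut n)" for n unfolding cut_def by (intro continuous_intros)
  have [measurable]: "cut n \<in> borel_measurable borel" for n
    using cutc by (rule borel_measurable_continuous_onI)
  have cut01: "0 \<le> cut n x" "cut n x \<le> 1" for n x by (auto simp: cut_def)
  have cuts: "norm x \<le> real n + 1" if "cut n x \<noteq> 0" for n x using that by (auto simp: cut_def)
  have cutl: "(\<lambda>n. cut n x) \<longlonglongrightarrow> 1" for x
  proof (rule tendsto_eventually)
    obtain N where "norm x \<le> real N" using real_arch_simple by blast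
    then show "\<forall>\<^sub>F n in sequentially. cut n x = 1"
      by (intro eventually_sequentiallyI[of N]) (auto simp: cut_def)
  qed
  define cl where "cl n t = max (- real n) (min (real n) t)" for n and t :: real
  have clc: "continuous_on UNIV (cl n)" for n unfolding cl_def by (intro continuous_intros)
  have clb: "\<bar>cl n t\<bar> \<le> real n" "\<bar>cl n t\<bar> \<le> \<bar>t\<bar>" for n t by (auto simp: cl_def)
  have [measurable]: "cl n \<in> borel_measurable borel" for n
    using clc by (rule borel_measurable_continuous_onI)
  have cll: "(\<lambda>n. cl n t) \<longlonglongrightarrow> t" for t
  proof (rule tendsto_eventually)
    obtain N where "\<bar>t\<bar> \<le> real N" using real_arch_simple by blast
    then show "\<forall>\<^sub>F n in sequentially. cl n t = t"
      by (intro eventually_sequentiallyI[of N]) (auto simp: cl_def)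
  qed
  define h where "h n x = cl n (f x) * cut n x" for n x
  have hle: "\<bar>h n x\<bar> \<le> \<bar>f x\<bar>" for n x
    using mult_mono[OF clb(2)[of n "f x"] cut01(2)[of n x]] cut01(1)[of n x] by (simp add: h_def abs_mult)
  have hl: "(\<lambda>n. h n x) \<longlonglongrightarrow> f x" for x
    unfolding h_def using tendsto_mult[OF cll[of "f x"] cutl[of x]] by simp
  have hm [measurable]: "h n \<in> borel_measurable borel" for n unfolding h_def by measurable
  have "(\<lambda>n. LINT x|lborel. (f x - h n x)\<^sup>2) \<longlonglongrightarrow> (LINT x|(lborel::(real^2) measure). 0)"
  proof (rule integral_dominated_convergence)
    show "integrable lborel (\<lambda>x. 4 * (f x)\<^sup>2)" using f by (simp add: square_integrable_def)
    show "AE x in lborel. (\<lambda>n. (f x - h n x)\<^sup>2) \<longlonglongrightarrow> 0"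
    proof (intro AE_I2)
      fix x
      have "(\<lambda>n. (f x - h n x)\<^sup>2) \<longlonglongrightarrow> (f x - f x)\<^sup>2" by (intro tendsto_intros hl)
      then show "(\<lambda>n. (f x - h n x)\<^sup>2) \<longlonglongrightarrow> 0" by simp
    qed
    show "AE x in lborel. norm ((f x - h n x)\<^sup>2) \<le> 4 * (f x)\<^sup>2" for n
    proof (intro AE_I2)
      fix x
      have "\<bar>f x - h n x\<bar> \<le> \<bar>2 * f x\<bar>" using hle[of n x] by linarith
      then have "(f x - h n x)\<^sup>2 \<le> (2 * f x)\<^sup>2" by (simp only: abs_le_square_iff)
      then show "norm ((f x - h n x)\<^sup>2) \<le> 4 * (f x)\<^sup>2" by (simp add: power_mult_distrib)
    qed
  qed simp_all
  then have "\<forall>\<^sub>F n in sequentially. (LINT x|lborel. (f x - h n x)\<^sup>2) < e / 4"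
    using e by (intro order_tendstoD(2)[where y=0]) simp_all
  then obtain n where n: "(LINT x|lborel. (f x - h n x)\<^sup>2) < e / 4"
    by (meson eventually_sequentially order_refl)
  have "f measurable_on UNIV"
    by (rule lebesgue_measurable_imp_measurable_on) (simp_all add: measurable_completion)
  then obtain N g where N: "negligible N" and gc: "\<And>m::nat. continuous_on UNIV (g m)"
    and gl: "\<And>x. x \<notin> N \<Longrightarrow> (\<lambda>m. g m x) \<longlonglongrightarrow> f x"
    unfolding measurable_on_def by auto
  have AEN: "AE x in lborel. x \<notin> N"
    using AE_not_in[of N lebesgue] N by (simp add: negligible_iff_null_sets AE_completion_iff)
  have [measurable]: "g m \<in> borel_measurable borel" for m
    using gc by (rule borel_measurable_continuous_onI)
  define p where "p m x = cl n (g m x) * cut n x" for m x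
  have pc: "continuous_on UNIV (p m)" for m
    unfolding p_def by (intro continuous_intros cutc continuous_on_compose2[OF clc gc]) auto
  have ps: "norm x \<le> real n + 1" if "p m x \<noteq> 0" for m x using that cuts by (auto simp: p_def)
  have [measurable]: "p m \<in> borel_measurable borel" for m
    using pc by (rule borel_measurable_continuous_onI)
  have "(\<lambda>m. LINT x|lborel. (h n x - p m x)\<^sup>2) \<longlonglongrightarrow> (LINT x|(lborel::(real^2) measure). 0)"
  proof (rule integral_dominated_convergence)
    show "integrable lborel (\<lambda>x. (2 * real n)\<^sup>2 * (cut n x)\<^sup>2)"
      by (rule continuous_bounded_support[of _ "real n + 1"])
        (use cuts in \<open>auto intro!: continuous_intros cutc\<close>)
    show "AE x in lborel. (\<lambda>m. (h n x - p m x)\<^sup>2) \<longlonglongrightarrow> 0"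
      using AEN
    proof eventually_elim
      case (elim x)
      have "(\<lambda>m. cl n (g m x)) \<longlonglongrightarrow> cl n (f x)"
        using continuous_on_tendsto_compose[OF clc gl[OF elim]] by simp
      then have "(\<lambda>m. (h n x - p m x)\<^sup>2) \<longlonglongrightarrow> (h n x - cl n (f x) * cut n x)\<^sup>2"
        unfolding p_def by (intro tendsto_intros)
      then show ?case by (simp add: h_def)
    qed
    show "AE x in lborel. norm ((h n x - p m x)\<^sup>2) \<le> (2 * real n)\<^sup>2 * (cut n x)\<^sup>2" for m
    proof (intro AE_I2)
      fix x
      have "\<bar>cl n (f x) - cl n (g m x)\<bar> \<le> \<bar>2 * real n\<bar>"
        using clb(1)[of n "f x"] clb(1)[of n "g m x"] by linarith
      then have "(cl n (f x) - cl n (g m x))\<^sup>2 \<le> (2 * real n)\<^sup>2" by (simp only: abs_le_square_iff)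
      then have "(cl n (f x) - cl n (g m x))\<^sup>2 * (cut n x)\<^sup>2 \<le> (2 * real n)\<^sup>2 * (cut n x)\<^sup>2"
        by (intro mult_right_mono) auto
      moreover have "h n x - p m x = (cl n (f x) - cl n (g m x)) * cut n x"
        by (simp add: h_def p_def algebra_simps)
      ultimately show "norm ((h n x - p m x)\<^sup>2) \<le> (2 * real n)\<^sup>2 * (cut n x)\<^sup>2"
        by (simp add: power_mult_distrib)
    qed
  qed simp_all
  then have "\<forall>\<^sub>F m in sequentially. (LINT x|lborel. (h n x - p m x)\<^sup>2) < e / 4"
    using e by (intro order_tendstoD(2)[where y=0]) simp_all
  then obtain m where m: "(LINT x|lborel. (h n x - p m x)\<^sup>2) < e / 4"
    by (meson eventually_sequentially order_refl)
  have hsq: "square_integrable (h n)"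
    unfolding square_integrable_def
  proof
    show "integrable lborel (\<lambda>x. (h n x)\<^sup>2)"
    proof (rule Bochner_Integration.integrable_bound)
      show "integrable lborel (\<lambda>x. (f x)\<^sup>2)" using f by (simp add: square_integrable_def)
      show "AE x in lborel. norm ((h n x)\<^sup>2) \<le> norm ((f x)\<^sup>2)"
        using hle by (auto simp: abs_le_square_iff[symmetric])
    qed simp
  qed simp
  have psq: "square_integrable (p m)"
    unfolding square_integrable_def
    by (intro conjI continuous_bounded_support[of "\<lambda>x. (p m x)\<^sup>2" "real n + 1"])
      (use ps in \<open>auto intro!: continuous_intros pc\<close>)
  note sq = square_integrable_diff[OF f hsq] square_integrable_diff[OF hsq psq]
  have i: "integrable lborel (\<lambda>x. (f x - h n x)\<^sup>2)" "integrable lborel (\<lambda>x. (h n x - p m x)\<^sup>2)"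
    using sq by (simp_all add: square_integrable_def)
  have "(LINT x|lborel. (f x - p m x)\<^sup>2)
      \<le> (LINT x|lborel. 2 * (f x - h n x)\<^sup>2 + 2 * (h n x - p m x)\<^sup>2)"
  proof (rule integral_mono)
    show "integrable lborel (\<lambda>x. (f x - p m x)\<^sup>2)"
      using square_integrable_diff[OF f psq] by (simp add: square_integrable_def)
    show "integrable lborel (\<lambda>x. 2 * (f x - h n x)\<^sup>2 + 2 * (h n x - p m x)\<^sup>2)" using i by simp
    fix x
    have "0 \<le> ((f x - h n x) - (h n x - p m x))\<^sup>2" by simp
    then show "(f x - p m x)\<^sup>2 \<le> 2 * (f x - h n x)\<^sup>2 + 2 * (h n x - p m x)\<^sup>2"
      by (simp add: power2_eq_square algebra_simps)
  qed
  also have "\<dots> < e" using n m i by simp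
  finally have "(LINT x|lborel. (f x - p m x)\<^sup>2) < e" .
  from pc ps psq this show ?thesis by (rule that[of "p m" "real n + 1"])
qed

text \<open>Weak continuity of translations suffices. Replacing \<open>g\<close> by a nearby continuous function with
  bounded support costs a small multiple of the norm of \<open>f\<close>, uniformly in the translation.\<close>

lemma translation_continuous:
  assumes f: "square_integrable f" and g: "square_integrable g" and z: "z \<longlonglongrightarrow> 0"
  shows "(\<lambda>n. LINT x|lborel. f x * g (x - z n)) \<longlonglongrightarrow> (LINT x|lborel. f x * g x)"
proof (rule LIMSEQ_I)
  fix r :: real assume r: "r > 0"
  define K where "K = sqrt (LINT x|lborel. (f x)\<^sup>2)"
  define d where "d = r / (3 * (K + 1))"
  have K: "K \<ge> 0" by (simp add: K_def)
  have d: "d > 0" using r K by (simp add: d_def)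
  have Kd: "K * d < r / 3"
  proof -
    have "K * d < (K + 1) * d" using d by simp
    also have "\<dots> = r / 3" using K by (simp add: d_def field_simps)
    finally show ?thesis .
  qed
  obtain h R where hc: "continuous_on UNIV h" and hs: "\<And>x. h x \<noteq> 0 \<Longrightarrow> norm x \<le> R"
    and hq: "square_integrable h" and hd: "(LINT x|lborel. (g x - h x)\<^sup>2) < d\<^sup>2"
    using continuous_dense_square_integrable[OF g zero_less_power[OF d]] by blast
  have [measurable]: "f \<in> borel_measurable borel" "g \<in> borel_measurable borel" "h \<in> borel_measurable borel"
    using f g hq by (simp_all add: square_integrable_measurable)
  obtain B where B: "\<And>x. \<bar>h x\<bar> \<le> B"
    using continuous_bounded_support(1)[OF hc hs] unfolding bounded_iff by auto
  have B0: "B \<ge> 0" using B[of 0] by linarith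
  have le: "\<bar>LINT x|lborel. f x * (g (x - w) - h (x - w))\<bar> < r / 3" for w
  proof -
    have s: "square_integrable (\<lambda>x. g x - h x)" by (rule square_integrable_diff[OF g hq])
    have "(LINT x|lborel. (g (x - w) - h (x - w))\<^sup>2) = (LINT x|lborel. (g x - h x)\<^sup>2)"
      using integral_shift(1)[of "\<lambda>x. (g x - h x)\<^sup>2" w] by simp
    then have "\<bar>LINT x|lborel. f x * (g (x - w) - h (x - w))\<bar> \<le> K * sqrt (LINT x|lborel. (g x - h x)\<^sup>2)"
      using Cauchy_Schwarz_integral[OF f square_integrable_shift(1)[OF s, of w]]
      by (simp add: K_def)
    also have "\<dots> \<le> K * d"
      using hd d K by (intro mult_left_mono real_le_lsqrt) (auto intro: real_sqrt_le_iff[THEN iffD1] less_imp_le)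
    finally show ?thesis using Kd by linarith
  qed
  obtain S where S: "\<And>n. norm (z n) \<le> S"
    using z convergent_imp_Bseq[of z] unfolding convergent_def Bseq_def by blast
  have S0: "S \<ge> 0" using S[of 0] norm_ge_zero order_trans by blast
  have "(\<lambda>n. LINT x|lborel. f x * (h (x - z n) - h x)) \<longlonglongrightarrow> (LINT x|(lborel::(real^2) measure). 0)"
  proof (rule integral_dominated_convergence)
    have "square_integrable (indicator (cball 0 (R + S)) :: real^2 \<Rightarrow> real)"
      unfolding square_integrable_def
    proof
      have "(\<lambda>x. (indicator (cball 0 (R + S)) x)\<^sup>2 :: real) = indicator (cball (0::real^2) (R + S))"
        by (auto simp: indicator_def)
      then show "integrable lborel (\<lambda>x. (indicator (cball (0::real^2) (R + S)) x)\<^sup>2 :: real)"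
        using emeasure_lborel_cball_finite by (simp add: integrable_indicator_iff)
    qed (simp add: borel_measurable_indicator)
    from square_integrable_mult[OF f this]
    show "integrable lborel (\<lambda>x. 2 * B * \<bar>f x * indicator (cball 0 (R + S)) x\<bar>)" by simp
    show "AE x in lborel. (\<lambda>n. f x * (h (x - z n) - h x)) \<longlonglongrightarrow> 0"
    proof (intro AE_I2)
      fix x
      have "(\<lambda>n. x - z n) \<longlonglongrightarrow> x - 0" by (intro tendsto_intros z)
      then have "(\<lambda>n. h (x - z n)) \<longlonglongrightarrow> h x"
        using continuous_on_tendsto_compose[OF hc, of "\<lambda>n. x - z n" x] by simp
      then have "(\<lambda>n. f x * (h (x - z n) - h x)) \<longlonglongrightarrow> f x * (h x - h x)" by (intro tendsto_intros)
      then show "(\<lambda>n. f x * (h (x - z n) - h x)) \<longlonglongrightarrow> 0" by simp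
    qed
    show "AE x in lborel. norm (f x * (h (x - z n) - h x)) \<le> 2 * B * \<bar>f x * indicator (cball 0 (R + S)) x\<bar>" for n
    proof (intro AE_I2)
      fix x
      show "norm (f x * (h (x - z n) - h x)) \<le> 2 * B * \<bar>f x * indicator (cball 0 (R + S)) x\<bar>"
      proof (cases "x \<in> cball 0 (R + S)")
        case True
        have "\<bar>h (x - z n) - h x\<bar> \<le> 2 * B" using B[of x] B[of "x - z n"] by linarith
        then have "\<bar>f x\<bar> * \<bar>h (x - z n) - h x\<bar> \<le> \<bar>f x\<bar> * (2 * B)" by (intro mult_left_mono) auto
        then show ?thesis using True by (simp add: abs_mult mult.commute mult.left_commute)
      next
        case False
        then have "\<not> norm x \<le> R" "\<not> norm (x - z n) \<le> R"
          using S[of n] S0 norm_triangle_sub[of x "z n"] norm_triangle_ineq[of "x - z n" "z n"] by auto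
        then have "h x = 0" "h (x - z n) = 0" using hs by blast+
        then show ?thesis using B0 by simp
      qed
    qed
  qed measurable
  then have "\<forall>\<^sub>F n in sequentially. \<bar>LINT x|lborel. f x * (h (x - z n) - h x)\<bar> < r / 3"
    using r by (intro order_tendstoD(2)[OF tendsto_rabs_zero]) simp_all
  then obtain N where N: "\<And>n. n \<ge> N \<Longrightarrow> \<bar>LINT x|lborel. f x * (h (x - z n) - h x)\<bar> < r / 3"
    unfolding eventually_sequentially by blast
  have "norm ((LINT x|lborel. f x * g (x - z n)) - (LINT x|lborel. f x * g x)) < r" if "n \<ge> N" for n
  proof -
    note i = square_integrable_mult[OF f square_integrable_shift(1)[OF g, of "z n"]]
      square_integrable_mult[OF f square_integrable_shift(1)[OF hq, of "z n"]]
      square_integrable_mult[OF f g] square_integrable_mult[OF f hq]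
    have "(LINT x|lborel. f x * g (x - z n)) - (LINT x|lborel. f x * g x)
      = (LINT x|lborel. f x * (g (x - z n) - h (x - z n)))
        + (LINT x|lborel. f x * (h (x - z n) - h x)) - (LINT x|lborel. f x * (g (x - 0) - h (x - 0)))"
      using i by (simp add: right_diff_distrib)
    then show ?thesis using le[of "z n"] le[of 0] N[OF that] by (simp only: real_norm_def)
  qed
  then show "\<exists>no. \<forall>n\<ge>no. norm ((LINT x|lborel. f x * g (x - z n)) - (LINT x|lborel. f x * g x)) < r"
    by blast
qed

text \<open>Correlation functions of square-integrable functions are continuous at 0. This replaces
  mollification below.\<close>

lemma isCont_correlation:
  assumes "square_integrable f" "square_integrable g"
  shows "isCont (\<lambda>z. LINT x|lborel. f x * g (x - z)) 0"
  using translation_continuous[OF assms] by (simp add: continuous_at_sequentially o_def)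

section \<open>Classical derivatives and smooth bumps\<close>

lemma partial_eqI: "(f has_derivative D) (at x) \<Longrightarrow> partial i f x = D (axis i 1)"
  by (simp add: partial_def frechet_derivative_at[symmetric])

lemma has_derivative_frechet:
  "f differentiable (at x) \<Longrightarrow> (f has_derivative frechet_derivative f (at x)) (at x)"
  by (simp add: frechet_derivative_works)

lemma partial_add:
  assumes "f differentiable (at x)" "g differentiable (at x)"
  shows "partial i (\<lambda>x. f x + g x) x = partial i f x + partial i g x"
  using partial_eqI[OF has_derivative_add[OF assms[THEN has_derivative_frechet]]]
  by (simp add: partial_def)

lemma partial_mult:
  assumes "f differentiable (at x)" "g differentiable (at x)"
  shows "partial i (\<lambda>x. f x * g x) x = partial i f x * g x + f x * partial i g x"
  using partial_eqI[OF has_derivative_mult[OF assms[THEN has_derivative_frechet]]]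
  by (simp add: partial_def)

lemma partial_cmult:
  assumes "f differentiable (at x)"
  shows "partial i (\<lambda>x. c * f x) x = c * partial i f x"
  using partial_eqI[OF has_derivative_mult_right[OF has_derivative_frechet[OF assms]]]
  by (simp add: partial_def)

lemma partial_compose_affine:
  assumes "\<And>x. f differentiable (at x)"
  shows "(\<lambda>y. f (a + c *\<^sub>R y)) differentiable (at x)"
    "partial i (\<lambda>y. f (a + c *\<^sub>R y)) x = c * partial i f (a + c *\<^sub>R x)"
proof -
  let ?D = "frechet_derivative f (at (a + c *\<^sub>R x))"
  have "((\<lambda>y. a + c *\<^sub>R y) has_derivative (\<lambda>h. c *\<^sub>R h)) (at x)"
    by (auto intro!: derivative_eq_intros)
  from has_derivative_compose[OF this has_derivative_frechet[OF assms]]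
  have d: "((\<lambda>y. f (a + c *\<^sub>R y)) has_derivative (\<lambda>h. ?D (c *\<^sub>R h))) (at x)" .
  then show "(\<lambda>y. f (a + c *\<^sub>R y)) differentiable (at x)" by (rule differentiableI)
  have "linear ?D" using assms by (rule linear_frechet_derivative)
  then show "partial i (\<lambda>y. f (a + c *\<^sub>R y)) x = c * partial i f (a + c *\<^sub>R x)"
    using partial_eqI[OF d] by (simp add: partial_def linear_scale)
qed

lemma Ck_continuous: "Ck k f \<Longrightarrow> continuous_on UNIV f"
  by (cases k) (auto simp: continuous_on_eq_continuous_at intro: differentiable_imp_continuous_within)

lemma Ck_cmult: "Ck k f \<Longrightarrow> Ck k (\<lambda>x. c * f x)"
proof (induction k arbitrary: f)
  case (Suc k)
  then have "partial i (\<lambda>x. c * f x) = (\<lambda>x. c * partial i f x)" for i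
    by (auto simp: partial_cmult)
  then show ?case using Suc by (auto intro!: differentiable_mult)
qed (auto intro: continuous_intros)

lemma Ck_compose_affine: "Ck k f \<Longrightarrow> Ck k (\<lambda>x. f (a + c *\<^sub>R x))"
proof (induction k arbitrary: f)
  case (Suc k)
  then have "partial i (\<lambda>x. f (a + c *\<^sub>R x)) = (\<lambda>x. c * partial i f (a + c *\<^sub>R x))" for i
    by (auto simp: partial_compose_affine(2))
  then show ?case using Suc by (auto intro!: partial_compose_affine(1) Ck_cmult)
next
  case 0
  then show ?case by (auto intro!: continuous_on_compose2[of UNIV f] continuous_intros)
qed

lemma partial_eq_0_outside_support:
  assumes "x \<notin> closure {x. f x \<noteq> 0}"
  shows "partial i f x = 0"
proof -
  have "((\<lambda>_. 0) has_derivative (\<lambda>_. 0)) (at x)" by simp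
  then have "(f has_derivative (\<lambda>_. 0)) (at x)"
    by (rule has_derivative_transform_within_open[where s="- closure {x. f x \<noteq> 0}"])
      (use assms closure_subset[of "{x. f x \<noteq> 0}"] in auto)
  then show ?thesis by (rule partial_eqI)
qed

lemma test_functionD:
  assumes "test_function \<psi>"
  obtains R where "\<And>x. \<psi> x \<noteq> 0 \<Longrightarrow> norm x \<le> R" "\<And>x i. partial i \<psi> x \<noteq> 0 \<Longrightarrow> norm x \<le> R"
proof -
  have "bounded (closure {x. \<psi> x \<noteq> 0})"
    using assms by (simp add: test_function_def compact_imp_bounded)
  then obtain R where R: "\<And>x. x \<in> closure {x. \<psi> x \<noteq> 0} \<Longrightarrow> norm x \<le> R"
    unfolding bounded_iff by blast
  show ?thesis
  proof (rule that[of R])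
    show "norm x \<le> R" if "\<psi> x \<noteq> 0" for x
      using that R[of x] closure_subset[of "{x. \<psi> x \<noteq> 0}"] by auto
    show "norm x \<le> R" if "partial i \<psi> x \<noteq> 0" for x i
      using that R partial_eq_0_outside_support[of x \<psi> i] by auto
  qed
qed

lemma test_function_regular:
  assumes "test_function \<psi>"
  shows "\<psi> differentiable (at x)" "continuous_on UNIV \<psi>" "continuous_on UNIV (partial i \<psi>)"
proof -
  have "Ck (Suc 0) \<psi>" using assms unfolding test_function_def by blast
  then show "\<psi> differentiable (at x)" "continuous_on UNIV \<psi>" "continuous_on UNIV (partial i \<psi>)"
    using Ck_continuous[of "Suc 0" \<psi>] by auto
qed

lemma test_functionI:
  assumes "\<And>k. Ck k \<psi>" "\<And>x. \<psi> x \<noteq> 0 \<Longrightarrow> norm x \<le> R"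
  shows "test_function \<psi>"
proof -
  have "bounded {x. \<psi> x \<noteq> 0}" using assms(2) unfolding bounded_iff by blast
  then show ?thesis using assms(1) by (simp add: test_function_def)
qed

lemma test_function_reflect_shift:
  assumes "test_function \<rho>"
  shows "test_function (\<lambda>y. \<rho> (x - y))" "partial i (\<lambda>y. \<rho> (x - y)) y = - partial i \<rho> (x - y)"
    and "test_function (\<lambda>y. \<rho> (y - x))" "partial i (\<lambda>y. \<rho> (y - x)) y = partial i \<rho> (y - x)"
proof -
  obtain R where R: "\<And>x. \<rho> x \<noteq> 0 \<Longrightarrow> norm x \<le> R" using test_functionD[OF assms] by metis
  have C: "Ck k (\<lambda>y. \<rho> (a + c *\<^sub>R y))" for k a c
    using assms by (auto simp: test_function_def intro: Ck_compose_affine)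
  note P = partial_compose_affine(2)[OF test_function_regular(1)[OF assms]]
  show "test_function (\<lambda>y. \<rho> (x - y))"
  proof (rule test_functionI)
    show "Ck k (\<lambda>y. \<rho> (x - y))" for k using C[of k x "-1"] by simp
    show "norm y \<le> R + norm x" if "\<rho> (x - y) \<noteq> 0" for y
      using R[OF that] norm_triangle_sub[of y x] by (simp add: norm_minus_commute)
  qed
  show "test_function (\<lambda>y. \<rho> (y - x))"
  proof (rule test_functionI)
    show "Ck k (\<lambda>y. \<rho> (y - x))" for k using C[of k "-x" 1] by simp
    show "norm y \<le> R + norm x" if "\<rho> (y - x) \<noteq> 0" for y
      using R[OF that] norm_triangle_sub[of y x] by simp
  qed
  show "partial i (\<lambda>y. \<rho> (x - y)) y = - partial i \<rho> (x - y)" using P[of i x "-1" y] by simp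
  show "partial i (\<lambda>y. \<rho> (y - x)) y = partial i \<rho> (y - x)" using P[of i "-x" 1 y] by simp
qed

text \<open>The function \<open>p(1/t) exp(-1/t)\<close>, extended by zero to \<open>t \<le> 0\<close>, where \<open>p\<close> is a polynomial.
  These functions form a family closed under differentiation.\<close>

definition flat :: "real poly \<Rightarrow> real \<Rightarrow> real" where
  "flat p t = (if t > 0 then poly p (1 / t) * exp (- (1 / t)) else 0)"

lemma power_poly_exp_tendsto_0:
  fixes p :: "real poly"
  shows "((\<lambda>s. s ^ k * poly p s * exp (- s)) \<longlongrightarrow> 0) at_top"
proof (induction p arbitrary: k)
  case (pCons a p)
  have "((\<lambda>s. a * (s ^ k / exp s) + s ^ Suc k * poly p s * exp (- s)) \<longlongrightarrow> a * 0 + 0) at_top"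
    by (intro tendsto_intros pCons.IH tendsto_power_div_exp_0)
  then show ?case by (simp add: algebra_simps exp_minus divide_inverse)
qed simp

lemma flat_tendsto_0: "(flat p \<longlongrightarrow> 0) (at 0)"
proof -
  have "((\<lambda>t. poly p (inverse t) * exp (- inverse t)) \<longlongrightarrow> 0) (at_right (0::real))"
    using filterlim_compose[OF power_poly_exp_tendsto_0[of 0 p] filterlim_inverse_at_top_right]
    by simp
  then have "(flat p \<longlongrightarrow> 0) (at_right 0)"
    by (rule Lim_transform_eventually)
      (auto simp: flat_def divide_inverse eventually_at_filter)
  moreover have "(flat p \<longlongrightarrow> 0) (at_left 0)"
    by (rule tendsto_eventually) (auto simp: flat_def eventually_at_filter)
  ultimately show ?thesis by (simp add: filterlim_split_at)
qed

lemma flat_has_derivative: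
  "(flat p has_real_derivative flat (monom 1 2 * (p - pderiv p)) t) (at t)"
proof -
  consider "t > 0" | "t < 0" | "t = 0" by linarith
  then show ?thesis
  proof cases
    case 1
    have "((\<lambda>t. poly p (1 / t) * exp (- (1 / t))) has_real_derivative
        poly (monom 1 2 * (p - pderiv p)) (1 / t) * exp (- (1 / t))) (at t)"
    proof -
      have "((\<lambda>t. 1 / t) has_real_derivative - (1 / t ^ 2)) (at t)"
        using 1 by (auto intro!: derivative_eq_intros simp: power2_eq_square)
      note d = DERIV_chain2[OF poly_DERIV this] DERIV_fun_exp[OF DERIV_minus[OF this]]
      show ?thesis
        by (rule DERIV_cong[OF DERIV_mult[OF d]])
          (simp add: poly_monom algebra_simps power2_eq_square)
    qed
    then show ?thesis
      by (rule has_field_derivative_transform_within_open[where S="{0<..}", THEN DERIV_cong])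
        (use 1 in \<open>auto simp: flat_def\<close>)
  next
    case 2
    have "((\<lambda>_. 0) has_real_derivative 0) (at t)" by simp
    then show ?thesis
      by (rule has_field_derivative_transform_within_open[where S="{..<0}", THEN DERIV_cong])
        (use 2 in \<open>auto simp: flat_def\<close>)
  next
    case 3
    \<comment> \<open>dividing by \<open>h\<close> multiplies the polynomial in \<open>1/h\<close> by its variable\<close>
    have "(\<lambda>h. (flat p (0 + h) - flat p 0) / h) = flat (pCons 0 p)"
      by (auto simp: flat_def)
    then have "(flat p has_real_derivative 0) (at 0)"
      unfolding DERIV_def using flat_tendsto_0[of "pCons 0 p"] by simp
    then show ?thesis using 3 by (simp add: flat_def)
  qed
qed

text \<open>The sums and products of functions \<open>flat p\<close> of affine functions of one coordinate. This class is
  closed under partial derivatives, hence consists of smooth functions.\<close>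

inductive flat_algebra :: "(real^2 \<Rightarrow> real) \<Rightarrow> bool" where
  flat: "flat_algebra (\<lambda>x. flat p (c + d * x $ j))"
| add: "flat_algebra f \<Longrightarrow> flat_algebra g \<Longrightarrow> flat_algebra (\<lambda>x. f x + g x)"
| mult: "flat_algebra f \<Longrightarrow> flat_algebra g \<Longrightarrow> flat_algebra (\<lambda>x. f x * g x)"

lemma flat_algebra_differentiable:
  assumes "flat_algebra f"
  shows "(\<forall>x. f differentiable (at x)) \<and> flat_algebra (partial i f)"
  using assms
proof induction
  case (flat p c d j)
  let ?q = "monom 1 2 * (p - pderiv p)"
  have D: "((\<lambda>x. flat p (c + d * x $ j)) has_derivative
      (\<lambda>h. (d * h $ j) * flat ?q (c + d * x $ j))) (at x)" for x :: "real^2"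
    by (rule has_derivative_compose[OF _ flat_has_derivative[unfolded has_field_derivative_def], THEN has_derivative_eq_rhs])
      (auto intro!: derivative_eq_intros bounded_linear.has_derivative[OF bounded_linear_vec_nth])
  have "partial i (\<lambda>x. flat p (c + d * x $ j))
      = (\<lambda>x. flat (smult (d * axis i 1 $ j) ?q) (c + d * x $ j))"
  proof
    fix x
    show "partial i (\<lambda>x. flat p (c + d * x $ j)) x
        = flat (smult (d * axis i 1 $ j) ?q) (c + d * x $ j)"
      unfolding partial_eqI[OF D] by (simp add: flat_def)
  qed
  then show ?case using D by (auto intro: flat_algebra.flat differentiableI)
next
  case (add f g)
  then have "partial i (\<lambda>x. f x + g x) = (\<lambda>x. partial i f x + partial i g x)"
    by (auto simp: partial_add)
  then show ?case using add by (auto intro: flat_algebra.add)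
next
  case (mult f g)
  then have "partial i (\<lambda>x. f x * g x) = (\<lambda>x. partial i f x * g x + f x * partial i g x)"
    by (auto simp: partial_mult)
  then show ?case using mult by (auto intro!: flat_algebra.add flat_algebra.mult)
qed

lemma flat_algebra_Ck: "flat_algebra f \<Longrightarrow> Ck k f"
proof (induction k arbitrary: f)
  case 0
  then show ?case
    using flat_algebra_differentiable[OF 0]
    by (auto simp: continuous_on_eq_continuous_at intro: differentiable_imp_continuous_within)
next
  case (Suc k)
  then show ?case using flat_algebra_differentiable[OF Suc.prems] by auto
qed

lemma bump_exists:
  assumes "\<delta> > 0"
  obtains \<rho> :: "real^2 \<Rightarrow> real" where "test_function \<rho>" "\<And>x. \<rho> x \<ge> 0" "\<rho> 0 > 0"
    "\<And>x. \<rho> x \<noteq> 0 \<Longrightarrow> norm x < \<delta>"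
proof -
  define d where "d = \<delta> / 2"
  have d: "d > 0" using assms by (simp add: d_def)
  define \<rho> :: "real^2 \<Rightarrow> real" where
    "\<rho> x = flat 1 (d + 1 * x $ 1) * flat 1 (d + (-1) * x $ 1) *
      (flat 1 (d + 1 * x $ 2) * flat 1 (d + (-1) * x $ 2))" for x
  have supp: "norm x < \<delta>" if "\<rho> x \<noteq> 0" for x
  proof -
    have "\<bar>x $ 1\<bar> < d" "\<bar>x $ 2\<bar> < d" using that by (auto simp: \<rho>_def flat_def split: if_splits)
    then show ?thesis using norm_le_l1_cart[of x] by (simp add: sum_2 d_def)
  qed
  show ?thesis
  proof (rule that[of \<rho>])
    show "test_function \<rho>"
    proof (rule test_functionI)
      show "Ck k \<rho>" for k
        unfolding \<rho>_def by (intro flat_algebra_Ck flat_algebra.intros)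
      show "norm x \<le> \<delta>" if "\<rho> x \<noteq> 0" for x using supp[OF that] by simp
    qed
    show "\<rho> x \<ge> 0" for x by (auto simp: \<rho>_def flat_def)
    show "\<rho> 0 > 0" using d by (auto simp: \<rho>_def flat_def)
  qed (rule supp)
qed

section \<open>Weak derivatives\<close>

text \<open>Testing the correlation function of \<open>f\<close> and \<open>g\<close> against a kernel \<open>k\<close> is pairing \<open>f\<close> with the
  convolution of \<open>k\<close> and \<open>g\<close> (Fubini).\<close>

lemma
  assumes f: "square_integrable f" and g: "square_integrable g"
    and kc: "continuous_on UNIV k" and ks: "\<And>x. k x \<noteq> 0 \<Longrightarrow> norm x \<le> R"
  shows integrable_correlation: "integrable lborel (\<lambda>z. k z * (LINT x|lborel. f x * g (x - z)))"
    and integral_correlation: "(LINT z|lborel. k z * (LINT x|lborel. f x * g (x - z)))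
      = (LINT x|lborel. f x * (LINT y|lborel. g y * k (x - y)))"
proof -
  have [measurable]: "f \<in> borel_measurable borel" "g \<in> borel_measurable borel" "k \<in> borel_measurable borel"
    using f g kc by (simp_all add: square_integrable_measurable borel_measurable_continuous_onI)
  let ?H = "\<lambda>(z, x). k z * (f x * g (x - z))"
  have ki: "integrable lborel k" using kc ks by (rule continuous_bounded_support)
  have sq: "square_integrable (\<lambda>x. \<bar>f x\<bar>)" "square_integrable (\<lambda>x. \<bar>g (x - z)\<bar>)" for z
    using f square_integrable_shift(1)[OF g, of z] by (simp_all add: square_integrable_def)
  define K where "K = sqrt (LINT x|lborel. (f x)\<^sup>2) * sqrt (LINT x|lborel. (g x)\<^sup>2)"
  have K0: "K \<ge> 0" by (simp add: K_def)
  have K: "(LINT x|lborel. \<bar>f x\<bar> * \<bar>g (x - z)\<bar>) \<le> K" for z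
    using Cauchy_Schwarz_integral[OF sq, of z] integral_shift(1)[of "\<lambda>x. (g x)\<^sup>2" z]
    by (simp add: K_def)
  have H: "integrable (lborel \<Otimes>\<^sub>M lborel) ?H"
  proof (rule lborel_pair.Fubini_integrable)
    have "(\<lambda>p. ?H p) \<in> borel_measurable (borel \<Otimes>\<^sub>M borel)" by measurable
    then show "?H \<in> borel_measurable (lborel \<Otimes>\<^sub>M lborel)" by simp
    show "integrable lborel (\<lambda>z. LINT x|lborel. norm (?H (z, x)))"
    proof (rule Bochner_Integration.integrable_bound)
      show "integrable lborel (\<lambda>z. K * k z)" using ki by simp
      show "(\<lambda>z. LINT x|lborel. norm (?H (z, x))) \<in> borel_measurable lborel" by measurable
      show "AE z in lborel. norm (LINT x|lborel. norm (?H (z, x))) \<le> norm (K * k z)"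
      proof (intro AE_I2)
        fix z
        have "(LINT x|lborel. norm (?H (z, x))) = \<bar>k z\<bar> * (LINT x|lborel. \<bar>f x\<bar> * \<bar>g (x - z)\<bar>)"
          by (simp add: abs_mult)
        moreover have "0 \<le> (LINT x|lborel. \<bar>f x\<bar> * \<bar>g (x - z)\<bar>)" by simp
        ultimately show "norm (LINT x|lborel. norm (?H (z, x))) \<le> norm (K * k z)"
          using mult_left_mono[OF K[of z], of "\<bar>k z\<bar>"] K0 by (simp add: abs_mult mult.commute)
      qed
    qed
    show "AE z in lborel. integrable lborel (\<lambda>x. ?H (z, x))"
      using square_integrable_mult[OF f square_integrable_shift(1)[OF g]] by simp
  qed
  show "integrable lborel (\<lambda>z. k z * (LINT x|lborel. f x * g (x - z)))"
    using lborel_pair.integrable_fst'[OF H] by simp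
  have "(LINT z|lborel. k z * (LINT x|lborel. f x * g (x - z)))
      = (LINT z|lborel. LINT x|lborel. k z * (f x * g (x - z)))" by simp
  also have "\<dots> = (LINT x|lborel. LINT z|lborel. k z * (f x * g (x - z)))"
    using lborel_pair.Fubini_integral[of "\<lambda>z x. k z * (f x * g (x - z))"] H by simp
  also have "\<dots> = (LINT x|lborel. f x * (LINT y|lborel. g y * k (x - y)))"
  proof (rule Bochner_Integration.integral_cong)
    fix x
    have "(LINT z|lborel. k z * (f x * g (x - z))) = f x * (LINT z|lborel. g (x - z) * k (x - (x - z)))"
      by (simp add: mult.commute mult.left_commute)
    also have "(LINT z|lborel. g (x - z) * k (x - (x - z))) = (LINT y|lborel. g y * k (x - y))"
      by (rule integral_shift(3)[of "\<lambda>y. g y * k (x - y)"]) measurable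
    finally show "(LINT z|lborel. k z * (f x * g (x - z))) = f x * (LINT y|lborel. g y * k (x - y))" .
  qed simp
  finally show "(LINT z|lborel. k z * (LINT x|lborel. f x * g (x - z)))
      = (LINT x|lborel. f x * (LINT y|lborel. g y * k (x - y)))" .
qed

text \<open>The same, with the roles of \<open>f\<close> and \<open>g\<close> exchanged on the right-hand side.\<close>

lemma integral_correlation':
  assumes f: "square_integrable f" and g: "square_integrable g"
    and kc: "continuous_on UNIV k" and ks: "\<And>x. k x \<noteq> 0 \<Longrightarrow> norm x \<le> R"
  shows "(LINT z|lborel. k z * (LINT x|lborel. f x * g (x - z)))
      = (LINT y|lborel. g y * (LINT x|lborel. f x * k (x - y)))"
proof -
  have [measurable]: "f \<in> borel_measurable borel" "g \<in> borel_measurable borel" "k \<in> borel_measurable borel"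
    using f g kc by (simp_all add: square_integrable_measurable borel_measurable_continuous_onI)
  have c: "continuous_on UNIV (\<lambda>z. k (0 - z))"
    by (intro continuous_on_compose2[OF kc] continuous_intros) auto
  have s: "k (0 - z) \<noteq> 0 \<Longrightarrow> norm z \<le> R" for z using ks[of "0 - z"] by simp
  have sh: "(LINT x|lborel. f x * g (x - z)) = (LINT y|lborel. g y * f (y + z))" for z
    using integral_shift(2)[of "\<lambda>x. f x * g (x - z)" z] by (simp add: mult.commute)
  have "(LINT z|lborel. k z * (LINT x|lborel. f x * g (x - z)))
      = (LINT z|lborel. k z * (LINT y|lborel. g y * f (y + z)))" by (simp add: sh)
  also have "\<dots> = (LINT z|lborel. k (0 - z) * (LINT y|lborel. g y * f (y + (0 - z))))"
    by (rule integral_shift(3)[symmetric]) measurable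
  also have "\<dots> = (LINT z|lborel. k (0 - z) * (LINT y|lborel. g y * f (y - z)))" by simp
  also have "\<dots> = (LINT y|lborel. g y * (LINT x|lborel. f x * k (0 - (y - x))))"
    by (rule integral_correlation[OF g f c s])
  finally show ?thesis by simp
qed

text \<open>A nonnegative bump supported where \<open>I\<close> stays close to \<open>I 0\<close> detects the sign of \<open>I 0\<close>.\<close>

lemma vanishes_at_0_if_orthogonal_to_test_functions:
  fixes I :: "real^2 \<Rightarrow> real"
  assumes c: "isCont I 0"
    and i: "\<And>\<rho>. test_function \<rho> \<Longrightarrow> integrable lborel (\<lambda>z. \<rho> z * I z)"
    and z: "\<And>\<rho>. test_function \<rho> \<Longrightarrow> (LINT z|lborel. \<rho> z * I z) = 0"
  shows "I 0 = 0"
proof (rule ccontr)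
  assume I0: "I 0 \<noteq> 0"
  obtain \<delta> where \<delta>: "\<delta> > 0" "\<And>z. norm z < \<delta> \<Longrightarrow> \<bar>I z - I 0\<bar> < \<bar>I 0\<bar> / 2"
    using c I0 unfolding continuous_at_eps_delta
    by (metis diff_zero dist_norm half_gt_zero real_norm_def zero_less_abs_iff)
  obtain \<rho> :: "real^2 \<Rightarrow> real" where \<rho>: "test_function \<rho>" "\<And>x. \<rho> x \<ge> 0" "\<rho> 0 > 0"
    "\<And>x. \<rho> x \<noteq> 0 \<Longrightarrow> norm x < \<delta>" using bump_exists[OF \<delta>(1)] by blast
  have \<rho>c: "continuous_on UNIV \<rho>" by (rule test_function_regular[OF \<rho>(1)])
  have \<rho>i: "integrable lborel \<rho>"
    using continuous_bounded_support(2)[OF \<rho>c, of \<delta>] \<rho>(4) by (simp add: less_imp_le)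
  have le: "\<rho> x * (I 0)\<^sup>2 / 2 \<le> I 0 * (\<rho> x * I x)" for x
  proof (cases "\<rho> x = 0")
    case False
    have "\<bar>I 0 * (I x - I 0)\<bar> \<le> \<bar>I 0\<bar> * (\<bar>I 0\<bar> / 2)"
      unfolding abs_mult using \<delta>(2)[OF \<rho>(4)[OF False]] by (intro mult_left_mono) auto
    also have "\<dots> = (I 0)\<^sup>2 / 2" by (simp add: power2_eq_square)
    finally have "- (I 0 * (I x - I 0)) \<le> (I 0)\<^sup>2 / 2" by (rule abs_le_D2)
    then have "(I 0)\<^sup>2 / 2 \<le> I 0 * I x" by (simp add: power2_eq_square algebra_simps)
    then show ?thesis using mult_left_mono[OF _ \<rho>(2)[of x]] by (fastforce simp: algebra_simps)
  qed simp
  have "(LINT x|lborel. \<rho> x * (I 0)\<^sup>2 / 2) \<le> (LINT x|lborel. I 0 * (\<rho> x * I x))"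
    by (rule integral_mono) (use \<rho>i i[OF \<rho>(1)] le in auto)
  then have "(LINT x|lborel. \<rho> x) * (I 0)\<^sup>2 \<le> 0" using z[OF \<rho>(1)] by simp
  then have "(LINT x|lborel. \<rho> x) \<le> 0" using I0 by (simp add: mult_le_0_iff)
  moreover have "(LINT x|lborel. \<rho> x) \<ge> 0" using \<rho>(2) by simp
  ultimately have "(LINT x|lborel. \<rho> x) = 0" by linarith
  then have "AE x in lborel. \<rho> x = 0"
    using integral_nonneg_eq_0_iff_AE[OF \<rho>i] \<rho>(2) by simp
  then have ae: "AE x in lebesgue. x \<notin> {x. \<rho> x \<noteq> 0}" by (simp add: AE_completion)
  have o: "open {x. \<rho> x \<noteq> 0}" using \<rho>c by (intro open_Collect_neq continuous_intros)
  then have "{x. \<rho> x \<noteq> 0} \<in> sets lebesgue" by simp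
  then have "negligible {x. \<rho> x \<noteq> 0}"
    using ae AE_iff_null_sets negligible_iff_null_sets by blast
  then show False using open_not_negligible[OF o] \<rho>(3) by force
qed

lemma has_weak_partialD:
  "has_weak_partial i f g \<Longrightarrow> test_function \<psi> \<Longrightarrow>
     (LINT x|lborel. rep_L2 f x * partial i \<psi> x) = - (LINT x|lborel. rep_L2 g x * \<psi> x)"
  by (simp add: has_weak_partial_def)

text \<open>Integration by parts between two weakly differentiable functions. The correlation function
  \<open>I(z) = \<integral> f(x) g'(x - z) + f'(x) g(x - z) dx\<close> is continuous at 0, and it is orthogonal to every
  test function \<open>\<rho>\<close>, because both translates \<open>y \<mapsto> \<rho>(x - y)\<close> and \<open>x \<mapsto> \<rho>(x - y)\<close> are test functions.\<close>

lemma weak_partial_parts: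
  assumes f: "has_weak_partial i f f'" and g: "has_weak_partial i g g'"
  shows "f \<bullet> g' = - (f' \<bullet> g)"
proof -
  note s = square_integrable_rep
  define I where "I z = (LINT x|lborel. rep_L2 f x * rep_L2 g' (x - z))
    + (LINT x|lborel. rep_L2 f' x * rep_L2 g (x - z))" for z
  have "I 0 = 0"
  proof (rule vanishes_at_0_if_orthogonal_to_test_functions)
    show "isCont I 0" unfolding I_def by (intro continuous_intros isCont_correlation s)
  next
    fix \<rho> :: "real^2 \<Rightarrow> real" assume \<rho>: "test_function \<rho>"
    obtain R where R: "\<And>x. \<rho> x \<noteq> 0 \<Longrightarrow> norm x \<le> R" "\<And>x. partial i \<rho> x \<noteq> 0 \<Longrightarrow> norm x \<le> R"
      using test_functionD[OF \<rho>] by metis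
    note c = test_function_regular(2)[OF \<rho>] and c' = test_function_regular(3)[OF \<rho>, of i]
    have i1: "integrable lborel (\<lambda>z. \<rho> z * (LINT x|lborel. rep_L2 f x * rep_L2 g' (x - z)))"
      and i2: "integrable lborel (\<lambda>z. \<rho> z * (LINT x|lborel. rep_L2 f' x * rep_L2 g (x - z)))"
      using integrable_correlation[OF s s c R(1)] by auto
    show "integrable lborel (\<lambda>z. \<rho> z * I z)" unfolding I_def distrib_left using i1 i2 by simp
    have "(LINT z|lborel. \<rho> z * (LINT x|lborel. rep_L2 f x * rep_L2 g' (x - z)))
        = (LINT x|lborel. rep_L2 f x * (LINT y|lborel. rep_L2 g' y * \<rho> (x - y)))"
      by (rule integral_correlation[OF s s c R(1)])
    also have "\<dots> = (LINT x|lborel. rep_L2 f x * (LINT y|lborel. rep_L2 g y * partial i \<rho> (x - y)))"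
      using has_weak_partialD[OF g test_function_reflect_shift(1)[OF \<rho>]]
        test_function_reflect_shift(2)[OF \<rho>] by simp
    also have "\<dots> = (LINT z|lborel. partial i \<rho> z * (LINT x|lborel. rep_L2 f x * rep_L2 g (x - z)))"
      by (rule integral_correlation[OF s s c' R(2), symmetric])
    finally have 1: "(LINT z|lborel. \<rho> z * (LINT x|lborel. rep_L2 f x * rep_L2 g' (x - z)))
      = (LINT z|lborel. partial i \<rho> z * (LINT x|lborel. rep_L2 f x * rep_L2 g (x - z)))" .
    have "(LINT z|lborel. \<rho> z * (LINT x|lborel. rep_L2 f' x * rep_L2 g (x - z)))
        = (LINT y|lborel. rep_L2 g y * (LINT x|lborel. rep_L2 f' x * \<rho> (x - y)))"
      by (rule integral_correlation'[OF s s c R(1)])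
    also have "\<dots> = (LINT y|lborel. rep_L2 g y * - (LINT x|lborel. rep_L2 f x * partial i \<rho> (x - y)))"
      using has_weak_partialD[OF f test_function_reflect_shift(3)[OF \<rho>]]
        test_function_reflect_shift(4)[OF \<rho>] by simp
    also have "\<dots> = - (LINT y|lborel. rep_L2 g y * (LINT x|lborel. rep_L2 f x * partial i \<rho> (x - y)))"
      by simp
    also have "(LINT y|lborel. rep_L2 g y * (LINT x|lborel. rep_L2 f x * partial i \<rho> (x - y)))
        = (LINT z|lborel. partial i \<rho> z * (LINT x|lborel. rep_L2 f x * rep_L2 g (x - z)))"
      by (rule integral_correlation'[OF s s c' R(2), symmetric])
    finally have 2: "(LINT z|lborel. \<rho> z * (LINT x|lborel. rep_L2 f' x * rep_L2 g (x - z)))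
      = - (LINT z|lborel. partial i \<rho> z * (LINT x|lborel. rep_L2 f x * rep_L2 g (x - z)))" .
    show "(LINT z|lborel. \<rho> z * I z) = 0" unfolding I_def distrib_left using i1 i2 1 2 by simp
  qed
  then show ?thesis by (simp add: I_def inner_L2_rep)
qed

text \<open>The fundamental lemma of the calculus of variations, from the correlation of \<open>g\<close> with itself.\<close>

lemma zero_if_orthogonal_to_test_functions:
  assumes "\<And>\<psi>. test_function \<psi> \<Longrightarrow> (LINT x|lborel. rep_L2 g x * \<psi> x) = 0"
  shows "g = 0"
proof -
  note s = square_integrable_rep
  define I where "I z = (LINT x|lborel. rep_L2 g x * rep_L2 g (x - z))" for z
  have "I 0 = 0"
  proof (rule vanishes_at_0_if_orthogonal_to_test_functions)
    show "isCont I 0" unfolding I_def by (intro isCont_correlation s)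
  next
    fix \<rho> :: "real^2 \<Rightarrow> real" assume \<rho>: "test_function \<rho>"
    obtain R where R: "\<And>x. \<rho> x \<noteq> 0 \<Longrightarrow> norm x \<le> R"
      using test_functionD[OF \<rho>] by metis
    note c = test_function_regular(2)[OF \<rho>]
    show "integrable lborel (\<lambda>z. \<rho> z * I z)"
      unfolding I_def by (rule integrable_correlation[OF s s c R])
    show "(LINT z|lborel. \<rho> z * I z) = 0"
      using integral_correlation[OF s s c R] assms[OF test_function_reflect_shift(1)[OF \<rho>]]
      by (simp add: I_def)
  qed
  then show ?thesis by (simp add: I_def inner_L2_rep[symmetric])
qed

lemma integrable_rep_test:
  assumes c: "continuous_on UNIV k" and s: "\<And>x. k x \<noteq> 0 \<Longrightarrow> norm x \<le> R"
  shows "integrable lborel (\<lambda>x. rep_L2 f x * k x)"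
proof (rule square_integrable_mult[OF square_integrable_rep])
  show "square_integrable k"
    unfolding square_integrable_def
    by (intro conjI continuous_bounded_support[of "\<lambda>x. (k x)\<^sup>2" R])
      (use c s in \<open>auto intro!: continuous_intros borel_measurable_continuous_onI\<close>)
qed

lemma integrable_rep_test_function:
  assumes "test_function \<psi>"
  shows "integrable lborel (\<lambda>x. rep_L2 f x * \<psi> x)" "integrable lborel (\<lambda>x. rep_L2 f x * partial i \<psi> x)"
proof -
  obtain R where R: "\<And>x. \<psi> x \<noteq> 0 \<Longrightarrow> norm x \<le> R" "\<And>x. partial i \<psi> x \<noteq> 0 \<Longrightarrow> norm x \<le> R"
    using test_functionD[OF assms] by metis
  show "integrable lborel (\<lambda>x. rep_L2 f x * \<psi> x)"
    by (rule integrable_rep_test[OF test_function_regular(2)[OF assms] R(1)])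
  show "integrable lborel (\<lambda>x. rep_L2 f x * partial i \<psi> x)"
    by (rule integrable_rep_test[OF test_function_regular(3)[OF assms] R(2)])
qed

lemma integral_rep_add:
  assumes "integrable lborel (\<lambda>x. rep_L2 f x * k x)" "integrable lborel (\<lambda>x. rep_L2 g x * k x)"
    and [measurable]: "k \<in> borel_measurable borel"
  shows "(LINT x|lborel. rep_L2 (f + c *\<^sub>R g) x * k x)
    = (LINT x|lborel. rep_L2 f x * k x) + c * (LINT x|lborel. rep_L2 g x * k x)"
proof -
  have "(LINT x|lborel. rep_L2 (f + c *\<^sub>R g) x * k x)
      = (LINT x|lborel. rep_L2 f x * k x + c * (rep_L2 g x * k x))"
    using rep_add_AE[of f "c *\<^sub>R g"] rep_scaleR_AE[of c g]
    by (intro integral_cong_AE) (auto simp: algebra_simps elim: eventually_elim2)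
  then show ?thesis using assms by simp
qed

lemma has_weak_partial_add_scaleR:
  assumes "has_weak_partial i f f'" "has_weak_partial i g g'"
  shows "has_weak_partial i (f + c *\<^sub>R g) (f' + c *\<^sub>R g')"
  unfolding has_weak_partial_def
proof (intro allI impI)
  fix \<psi> :: "real^2 \<Rightarrow> real" assume \<psi>: "test_function \<psi>"
  note m = test_function_regular(2,3)[OF \<psi>, THEN borel_measurable_continuous_onI]
  note i = integrable_rep_test_function[OF \<psi>]
  show "(LINT x|lborel. rep_L2 (f + c *\<^sub>R g) x * partial i \<psi> x)
      = - (LINT x|lborel. rep_L2 (f' + c *\<^sub>R g') x * \<psi> x)"
    using assms[THEN has_weak_partialD, OF \<psi>]
    by (simp add: integral_rep_add[OF i(1) i(1) m(1)] integral_rep_add[OF i(2) i(2) m(2)])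
qed

lemma has_weak_partial_unique:
  assumes "has_weak_partial i f g" "has_weak_partial i f h"
  shows "g = h"
proof -
  have "g + (-1) *\<^sub>R h = 0"
  proof (rule zero_if_orthogonal_to_test_functions)
    fix \<psi> :: "real^2 \<Rightarrow> real" assume \<psi>: "test_function \<psi>"
    note m = test_function_regular(2)[OF \<psi>, THEN borel_measurable_continuous_onI]
    note i = integrable_rep_test_function[OF \<psi>]
    show "(LINT x|lborel. rep_L2 (g + (-1) *\<^sub>R h) x * \<psi> x) = 0"
      unfolding integral_rep_add[OF i(1) i(1) m] using assms[THEN has_weak_partialD, OF \<psi>] by simp
  qed
  then show ?thesis by simp
qed

lemma weak_partial_eq: "has_weak_partial i f g \<Longrightarrow> weak_partial i f = g"
  unfolding weak_partial_def by (blast intro: has_weak_partial_unique)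

lemma W12_has_weak_partial: "f \<in> W12 \<Longrightarrow> has_weak_partial i f (weak_partial i f)"
  unfolding W12_def using weak_partial_eq by fastforce

lemma W12_add_scaleR: "f \<in> W12 \<Longrightarrow> g \<in> W12 \<Longrightarrow> f + c *\<^sub>R g \<in> W12"
  unfolding W12_def using has_weak_partial_add_scaleR by blast

lemma weak_partial_diff:
  assumes "f \<in> W12" "g \<in> W12"
  shows "weak_partial i (f - g) = weak_partial i f - weak_partial i g"
  using weak_partial_eq[OF has_weak_partial_add_scaleR[OF assms[THEN W12_has_weak_partial], of i "-1"]]
  by simp

lemma W12_diff: "f \<in> W12 \<Longrightarrow> g \<in> W12 \<Longrightarrow> f - g \<in> W12"
  using W12_add_scaleR[of f g "-1"] by simp

lemma W12_sum: "finite A \<Longrightarrow> A \<noteq> {} \<Longrightarrow> (\<And>a. a \<in> A \<Longrightarrow> f a \<in> W12) \<Longrightarrow> (\<Sum>a\<in>A. f a) \<in> W12"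
proof (induction rule: finite_ne_induct)
  case (insert a A)
  then show ?case using W12_add_scaleR[of "f a" "sum f A" 1] by simp
qed simp

subsection \<open>Products with continuously differentiable functions\<close>

text \<open>Translation invariance makes the integral of every difference quotient vanish.\<close>

lemma integral_partial_eq_0:
  assumes d: "\<And>x. w differentiable (at x)" and c: "continuous_on UNIV (partial i w)"
    and s: "\<And>x. w x \<noteq> 0 \<Longrightarrow> norm x \<le> R"
  shows "(LINT x|lborel. partial i w x) = 0"
proof -
  let ?e = "axis i 1 :: real^2"
  have e: "norm ?e = 1" by (simp add: norm_axis_1)
  have wc: "continuous_on UNIV w"
    using d by (simp add: continuous_on_eq_continuous_at differentiable_imp_continuous_within)
  note [measurable] = borel_measurable_continuous_onI[OF wc] borel_measurable_continuous_onI[OF c]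
  have wi: "integrable lborel w" using wc s by (rule continuous_bounded_support)
  \<comment> \<open>step widths of the difference quotients \<open>q\<close>, which the mean value theorem dominates\<close>
  define h where "h n = 1 / real (Suc n)" for n
  have h: "0 < h n" "h n \<le> 1" for n by (simp_all add: h_def)
  have hl: "h \<longlonglongrightarrow> 0" unfolding h_def by (rule LIMSEQ_Suc[OF lim_1_over_n])
  have line: "((\<lambda>t. w (x + t *\<^sub>R ?e)) has_real_derivative partial i w (x + t *\<^sub>R ?e)) (at t)" for x t
  proof -
    have "((\<lambda>t. x + t *\<^sub>R ?e) has_derivative (\<lambda>s. s *\<^sub>R ?e)) (at t)"
      by (auto intro!: derivative_eq_intros)
    from has_derivative_compose[OF this has_derivative_frechet[OF d]]
    have "((\<lambda>t. w (x + t *\<^sub>R ?e)) has_derivative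
      (\<lambda>s. frechet_derivative w (at (x + t *\<^sub>R ?e)) (s *\<^sub>R ?e))) (at t)" .
    also have "(\<lambda>s. frechet_derivative w (at (x + t *\<^sub>R ?e)) (s *\<^sub>R ?e)) = (*) (partial i w (x + t *\<^sub>R ?e))"
      by (rule ext) (simp add: linear_scale[OF linear_frechet_derivative[OF d]] partial_def mult.commute)
    finally show ?thesis unfolding has_field_derivative_def .
  qed
  have ps: "norm x \<le> R" if "partial i w x \<noteq> 0" for x
  proof -
    have "{x. w x \<noteq> 0} \<subseteq> cball 0 R" using s by auto
    then have "closure {x. w x \<noteq> 0} \<subseteq> cball 0 R" by (rule closure_minimal) simp
    moreover have "x \<in> closure {x. w x \<noteq> 0}" using that partial_eq_0_outside_support by blast
    ultimately show ?thesis by auto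
  qed
  obtain B where B: "\<And>x. \<bar>partial i w x\<bar> \<le> B"
    using continuous_bounded_support(1)[OF c ps] unfolding bounded_iff by auto
  define q where "q n x = (w (x + h n *\<^sub>R ?e) - w x) / h n" for n x
  have [measurable]: "q n \<in> borel_measurable borel" for n unfolding q_def by measurable
  have qb: "\<bar>q n x\<bar> \<le> B * indicator (cball 0 (R + 1)) x" for n x
  proof (cases "norm x \<le> R + 1")
    case True
    have "\<exists>t>0. t < h n \<and> w (x + h n *\<^sub>R ?e) - w (x + 0 *\<^sub>R ?e) = (h n - 0) * partial i w (x + t *\<^sub>R ?e)"
      by (rule MVT2) (use line h(1) in auto)
    then obtain t where "w (x + h n *\<^sub>R ?e) - w (x + 0 *\<^sub>R ?e) = (h n - 0) * partial i w (x + t *\<^sub>R ?e)"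
      by blast
    then have "q n x = partial i w (x + t *\<^sub>R ?e)" using h(1)[of n] by (simp add: q_def)
    then show ?thesis using True B by simp
  next
    case False
    have "norm (h n *\<^sub>R ?e) \<le> 1" using e h[of n] by simp
    then have "\<not> norm (x + h n *\<^sub>R ?e) \<le> R" "\<not> norm x \<le> R"
      using False norm_diff_ineq[of x "h n *\<^sub>R ?e"] by linarith+
    then have "w (x + h n *\<^sub>R ?e) = 0" "w x = 0" using s by blast+
    then show ?thesis using False by (simp add: q_def)
  qed
  have q0: "(LINT x|lborel. q n x) = 0" for n
    using integral_shift(2)[of w "h n *\<^sub>R ?e"] integrable_shift(2)[OF wi, of "h n *\<^sub>R ?e"] wi
    by (simp add: q_def)
  have "(\<lambda>n. LINT x|lborel. q n x) \<longlonglongrightarrow> (LINT x|lborel. partial i w x)"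
  proof (rule integral_dominated_convergence)
    show "integrable lborel (\<lambda>x. B * indicator (cball (0::real^2) (R + 1)) x)"
      using emeasure_lborel_cball_finite
      by (intro integrable_mult_right) (simp add: integrable_indicator_iff)
    show "AE x in lborel. norm (q n x) \<le> B * indicator (cball 0 (R + 1)) x" for n using qb by simp
    show "AE x in lborel. (\<lambda>n. q n x) \<longlonglongrightarrow> partial i w x"
    proof (intro AE_I2)
      fix x
      have "(\<lambda>t. (w (x + t *\<^sub>R ?e) - w x) / t) \<midarrow>0\<rightarrow> partial i w x"
        using line[of x 0] by (simp add: DERIV_def)
      moreover have "filterlim h (at 0) sequentially"
        using hl h(1) by (auto simp: filterlim_at less_imp_neq[symmetric])
      ultimately show "(\<lambda>n. q n x) \<longlonglongrightarrow> partial i w x"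
        unfolding q_def by (rule filterlim_compose)
    qed
  qed measurable
  then show ?thesis by (simp add: q0 LIMSEQ_const_iff)
qed

lemma C1_mult:
  assumes "Ck 1 f" "Ck 1 g"
  shows "Ck 1 (\<lambda>x. f x * g x)"
    "partial i (\<lambda>x. f x * g x) x = partial i f x * g x + f x * partial i g x"
proof -
  show *: "partial i (\<lambda>x. f x * g x) x = partial i f x * g x + f x * partial i g x" for i x
    using assms by (simp add: partial_mult)
  then have "partial i (\<lambda>x. f x * g x) = (\<lambda>x. partial i f x * g x + f x * partial i g x)" for i by auto
  then show "Ck 1 (\<lambda>x. f x * g x)"
    using assms assms[THEN Ck_continuous] by (auto intro!: continuous_intros)
qed

lemma has_weak_partial_C1:
  assumes w: "Ck 1 w" and s: "\<And>x. w x \<noteq> 0 \<Longrightarrow> norm x \<le> R"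
  shows "square_integrable w" "square_integrable (partial i w)"
    "has_weak_partial i (abs_L2 w) (abs_L2 (partial i w))"
proof -
  have c: "continuous_on UNIV w" "continuous_on UNIV (partial i w)"
    using w Ck_continuous[OF w] by auto
  note m [measurable] = c[THEN borel_measurable_continuous_onI]
  have s': "norm x \<le> R" if "partial i w x \<noteq> 0" for x
  proof -
    have "{x. w x \<noteq> 0} \<subseteq> cball 0 R" using s by auto
    then have "closure {x. w x \<noteq> 0} \<subseteq> cball 0 R" by (rule closure_minimal) simp
    moreover have "x \<in> closure {x. w x \<noteq> 0}" using that partial_eq_0_outside_support by blast
    ultimately show ?thesis by auto
  qed
  show sq: "square_integrable w" "square_integrable (partial i w)"
    unfolding square_integrable_def
    using continuous_bounded_support(2)[of "\<lambda>x. (w x)\<^sup>2" R] continuous_bounded_support(2)[of "\<lambda>x. (partial i w x)\<^sup>2" R]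
      s s' c by (auto intro!: continuous_intros)
  show "has_weak_partial i (abs_L2 w) (abs_L2 (partial i w))"
    unfolding has_weak_partial_def
  proof (intro allI impI)
    fix \<psi> :: "real^2 \<Rightarrow> real" assume \<psi>: "test_function \<psi>"
    note mp [measurable] = test_function_regular(2,3)[OF \<psi>, THEN borel_measurable_continuous_onI]
    have \<psi>1: "Ck 1 \<psi>" using \<psi> unfolding test_function_def by blast
    have "(LINT x|lborel. partial i (\<lambda>x. w x * \<psi> x) x) = 0"
      by (rule integral_partial_eq_0[of _ _ R]) (use C1_mult(1)[OF w \<psi>1] s in auto)
    then have "(LINT x|lborel. partial i w x * \<psi> x + w x * partial i \<psi> x) = 0"
      by (simp add: C1_mult(2)[OF w \<psi>1])
    moreover have "integrable lborel (\<lambda>x. partial i w x * \<psi> x)"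
      by (rule continuous_bounded_support[of _ R])
        (use c s' test_function_regular(2)[OF \<psi>] in \<open>auto intro!: continuous_intros\<close>)
    moreover have "integrable lborel (\<lambda>x. w x * partial i \<psi> x)"
      by (rule continuous_bounded_support[of _ R])
        (use c s test_function_regular(3)[OF \<psi>] in \<open>auto intro!: continuous_intros\<close>)
    moreover have "(LINT x|lborel. rep_L2 (abs_L2 w) x * partial i \<psi> x) = (LINT x|lborel. w x * partial i \<psi> x)"
      using rep_abs_AE[OF sq(1)] by (intro integral_cong_AE) auto
    moreover have "(LINT x|lborel. rep_L2 (abs_L2 (partial i w)) x * \<psi> x) = (LINT x|lborel. partial i w x * \<psi> x)"
      using rep_abs_AE[OF sq(2)] by (intro integral_cong_AE) auto
    ultimately show "(LINT x|lborel. rep_L2 (abs_L2 w) x * partial i \<psi> x)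
        = - (LINT x|lborel. rep_L2 (abs_L2 (partial i w)) x * \<psi> x)" by simp
  qed
qed

text \<open>The bounded continuously differentiable functions with bounded derivatives.\<close>

definition BC1 :: "(real^2 \<Rightarrow> real) \<Rightarrow> bool" where
  "BC1 f \<longleftrightarrow> Ck 1 f \<and> bounded (range f) \<and> (\<forall>i. bounded (range (partial i f)))"

lemma BC1_regular:
  assumes "BC1 a"
  shows "a \<in> borel_measurable borel" "bounded (range a)"
    "partial i a \<in> borel_measurable borel" "bounded (range (partial i a))"
  using assms Ck_continuous[of 1 a] unfolding BC1_def
  by (auto intro: borel_measurable_continuous_onI)

text \<open>The product rule. A test function times a \<open>C\<^sup>1\<close> function is only a \<open>C\<^sup>1\<close> function with compact
  support, to which integration by parts still applies.\<close>

lemma has_weak_partial_mult_L2: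
  assumes a: "BC1 a" and f: "has_weak_partial i f f'"
  shows "has_weak_partial i (mult_L2 a f) (mult_L2 a f' + mult_L2 (partial i a) f)"
  unfolding has_weak_partial_def
proof (intro allI impI)
  fix \<psi> :: "real^2 \<Rightarrow> real" assume \<psi>: "test_function \<psi>"
  note mp [measurable] = test_function_regular(2,3)[OF \<psi>, THEN borel_measurable_continuous_onI]
  note r = BC1_regular(1,2)[OF a] BC1_regular(3,4)[OF a, where i=i]
  note [measurable] = r(1,3)
  have \<psi>1: "Ck 1 \<psi>" using \<psi> unfolding test_function_def by blast
  have a1: "Ck 1 a" using a by (simp add: BC1_def)
  let ?w = "\<lambda>x. a x * \<psi> x"
  have p: "partial i ?w x = partial i a x * \<psi> x + a x * partial i \<psi> x" for x
    by (rule C1_mult(2)[OF a1 \<psi>1])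
  have w1: "Ck 1 ?w" by (rule C1_mult(1)[OF a1 \<psi>1])
  then have wc: "continuous_on UNIV ?w" "continuous_on UNIV (partial i ?w)"
    using Ck_continuous[OF w1] by auto
  note [measurable] = wc[THEN borel_measurable_continuous_onI]
  obtain R where R: "\<And>x. \<psi> x \<noteq> 0 \<Longrightarrow> norm x \<le> R" "\<And>x. partial i \<psi> x \<noteq> 0 \<Longrightarrow> norm x \<le> R"
    using test_functionD[OF \<psi>] by metis
  have s: "?w x \<noteq> 0 \<Longrightarrow> norm x \<le> R" for x using R by auto
  have ac: "continuous_on UNIV a" "continuous_on UNIV (partial i a)"
    using a1 Ck_continuous[OF a1] by auto
  note W = has_weak_partial_C1(1)[OF w1 s] has_weak_partial_C1(2,3)[OF w1 s, where i=i]
  have "f \<bullet> abs_L2 (partial i ?w) = - (f' \<bullet> abs_L2 ?w)"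
    by (rule weak_partial_parts[OF f W(3)])
  moreover have "f \<bullet> abs_L2 (partial i ?w) = (LINT x|lborel. rep_L2 f x * partial i ?w x)"
    unfolding inner_L2_rep using rep_abs_AE[OF W(2)] by (intro integral_cong_AE) auto
  moreover have "f' \<bullet> abs_L2 ?w = (LINT x|lborel. rep_L2 f' x * ?w x)"
    unfolding inner_L2_rep using rep_abs_AE[OF W(1)] by (intro integral_cong_AE) auto
  moreover have "(LINT x|lborel. rep_L2 f x * partial i ?w x)
      = (LINT x|lborel. rep_L2 f x * (partial i a x * \<psi> x)) + (LINT x|lborel. rep_L2 f x * (a x * partial i \<psi> x))"
    unfolding p distrib_left
    by (intro Bochner_Integration.integral_add integrable_rep_test[of _ R] continuous_intros ac test_function_regular[OF \<psi>])
      (use R in auto)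
  moreover have "(LINT x|lborel. rep_L2 (mult_L2 a f) x * partial i \<psi> x)
      = (LINT x|lborel. rep_L2 f x * (a x * partial i \<psi> x))"
    using rep_mult_AE[OF r(1,2), of f] by (intro integral_cong_AE) auto
  moreover have "(LINT x|lborel. rep_L2 (mult_L2 a f' + 1 *\<^sub>R mult_L2 (partial i a) f) x * \<psi> x)
      = (LINT x|lborel. rep_L2 (mult_L2 a f') x * \<psi> x) + 1 * (LINT x|lborel. rep_L2 (mult_L2 (partial i a) f) x * \<psi> x)"
    by (rule integral_rep_add[OF integrable_rep_test_function(1)[OF \<psi>] integrable_rep_test_function(1)[OF \<psi>] mp(1)])
  moreover have "(LINT x|lborel. rep_L2 (mult_L2 a f') x * \<psi> x) = (LINT x|lborel. rep_L2 f' x * ?w x)"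
    using rep_mult_AE[OF r(1,2), of f'] by (intro integral_cong_AE) auto
  moreover have "(LINT x|lborel. rep_L2 (mult_L2 (partial i a) f) x * \<psi> x)
      = (LINT x|lborel. rep_L2 f x * (partial i a x * \<psi> x))"
    using rep_mult_AE[OF r(3,4), of f] by (intro integral_cong_AE) auto
  ultimately show "(LINT x|lborel. rep_L2 (mult_L2 a f) x * partial i \<psi> x)
      = - (LINT x|lborel. rep_L2 (mult_L2 a f' + mult_L2 (partial i a) f) x * \<psi> x)"
    by simp
qed

lemma mult_L2_W12: "BC1 a \<Longrightarrow> f \<in> W12 \<Longrightarrow> mult_L2 a f \<in> W12"
  using has_weak_partial_mult_L2 unfolding W12_def by blast

section \<open>The metric of the graph\<close>

lemma bounded_range_mult:
  fixes f g :: "'a \<Rightarrow> real"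
  assumes "bounded (range f)" "bounded (range g)"
  shows "bounded (range (\<lambda>x. f x * g x))"
proof -
  obtain A B where "\<And>x. \<bar>f x\<bar> \<le> A" "\<And>x. \<bar>g x\<bar> \<le> B" using assms unfolding bounded_iff by auto
  then have "\<bar>f x * g x\<bar> \<le> A * B" for x
    unfolding abs_mult using abs_ge_zero order_trans by (intro mult_mono) blast+
  then show ?thesis unfolding bounded_iff by auto
qed

lemma bounded_range_add:
  fixes f g :: "'a \<Rightarrow> real"
  assumes "bounded (range f)" "bounded (range g)"
  shows "bounded (range (\<lambda>x. f x + g x))"
  using bounded_plus_comp[OF assms] .

lemma BC1_const: "BC1 (\<lambda>_. c)"
proof -
  have "partial i (\<lambda>_. c) = (\<lambda>_. 0)" for i by (auto simp: partial_def)
  then show ?thesis by (auto simp: BC1_def)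
qed

lemma BC1_add:
  assumes "BC1 f" "BC1 g"
  shows "BC1 (\<lambda>x. f x + g x)"
proof -
  have "partial i (\<lambda>x. f x + g x) = (\<lambda>x. partial i f x + partial i g x)" for i
    using assms by (auto simp: BC1_def partial_add)
  then show ?thesis
    using assms by (auto simp: BC1_def intro!: bounded_range_add continuous_intros)
qed

lemma BC1_mult:
  assumes "BC1 f" "BC1 g"
  shows "BC1 (\<lambda>x. f x * g x)"
proof -
  have c: "Ck 1 f" "Ck 1 g" using assms by (auto simp: BC1_def)
  have "partial i (\<lambda>x. f x * g x) = (\<lambda>x. partial i f x * g x + f x * partial i g x)" for i
    using C1_mult(2)[OF c] by auto
  then show ?thesis
    using assms C1_mult(1)[OF c] by (auto simp: BC1_def intro!: bounded_range_add bounded_range_mult)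
qed

lemma BC1_inverse_sqrt:
  assumes u: "BC1 u" and ge: "\<And>x. u x \<ge> 1"
  shows "BC1 (\<lambda>x. 1 / sqrt (u x))"
proof -
  have d: "u differentiable (at x)" for x using u by (auto simp: BC1_def)
  have uc: "continuous_on UNIV u" using u Ck_continuous unfolding BC1_def by blast
  have D: "((\<lambda>s. 1 / sqrt s) has_real_derivative - (1/2) * (1 / sqrt s) ^ 3) (at s)" if "s \<ge> 1" for s
    using that by (auto intro!: derivative_eq_intros simp: field_simps power3_eq_cube)
  have h: "((\<lambda>x. 1 / sqrt (u x)) has_derivative
      (\<lambda>h. (- (1/2) * (1 / sqrt (u x)) ^ 3) * frechet_derivative u (at x) h)) (at x)" for x
    using has_derivative_compose[OF has_derivative_frechet[OF d] D[OF ge, unfolded has_field_derivative_def]] .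
  have p: "partial i (\<lambda>x. 1 / sqrt (u x)) = (\<lambda>x. (- (1/2) * (1 / sqrt (u x)) ^ 3) * partial i u x)" for i
    using partial_eqI[OF h] by (auto simp: partial_def)
  have r: "\<bar>1 / sqrt (u x)\<bar> \<le> 1" for x using ge[of x] by simp
  have nz: "sqrt (u x) \<noteq> 0" for x using ge[of x] by auto
  have b: "bounded (range (\<lambda>x. - (1/2) * (1 / sqrt (u x)) ^ 3))"
  proof -
    have "\<bar>- (1/2) * (1 / sqrt (u x)) ^ 3\<bar> \<le> 1" for x
      using power_le_one[of "\<bar>1 / sqrt (u x)\<bar>" 3] r[of x] by (simp add: abs_mult power_abs)
    then show ?thesis by (intro boundedI[of _ 1]) (simp only: image_iff real_norm_def, elim bexE, simp only:)
  qed
  have "continuous_on UNIV (partial i (\<lambda>x. 1 / sqrt (u x)))" for i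
    unfolding p using u nz by (auto simp: BC1_def intro!: continuous_intros uc)
  moreover have "bounded (range (partial i (\<lambda>x. 1 / sqrt (u x))))" for i
  proof -
    have "bounded (range (partial i u))" using u by (simp add: BC1_def)
    then show ?thesis unfolding p by (rule bounded_range_mult[OF b])
  qed
  moreover have "bounded (range (\<lambda>x. 1 / sqrt (u x)))" using r unfolding bounded_iff by auto
  moreover have "(\<lambda>x. 1 / sqrt (u x)) differentiable (at x)" for x using h by (rule differentiableI)
  ultimately show ?thesis by (auto simp: BC1_def)
qed

lemma metric_entry:
  "metric \<phi> x $ \<alpha> $ \<beta> = (if \<alpha> = \<beta> then 1 else 0) + partial \<alpha> \<phi> x * partial \<beta> \<phi> x"
  using exhaust_2[of \<alpha>] exhaust_2[of \<beta>]
  by (auto simp: metric_def tangent_def inner_vec_def sum_3)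

lemma metric_det_eq: "metric_det \<phi> x = 1 + (partial 1 \<phi> x)\<^sup>2 + (partial 2 \<phi> x)\<^sup>2"
  by (simp add: metric_det_def det_2 metric_entry power2_eq_square algebra_simps)

lemma metric_det_ge_1: "metric_det \<phi> x \<ge> 1"
  by (simp add: metric_det_eq)

lemma matrix_inv_eqI:
  fixes A B :: "real^'n^'n"
  assumes "A ** B = mat 1"
  shows "matrix_inv A = B"
proof -
  have BA: "B ** A = mat 1" using assms by (simp add: matrix_left_right_inverse)
  then have "A ** matrix_inv A = mat 1"
    unfolding matrix_inv_def using assms someI[of "\<lambda>X. A ** X = mat 1 \<and> X ** A = mat 1" B] by blast
  then have "B ** (A ** matrix_inv A) = B" by simp
  then show ?thesis by (simp add: matrix_mul_assoc BA)
qed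

text \<open>The metric is the identity plus the rank-one matrix of \<open>\<nabla>\<phi>\<close>, which makes the inverse explicit.\<close>

lemma inv_metric_eq:
  "inv_metric \<phi> \<alpha> \<beta> x
    = (if \<alpha> = \<beta> then 1 else 0) - partial \<alpha> \<phi> x * partial \<beta> \<phi> x / metric_det \<phi> x"
proof -
  let ?B = "\<chi> \<alpha> \<beta>. (if \<alpha> = \<beta> then 1 else 0) - partial \<alpha> \<phi> x * partial \<beta> \<phi> x / metric_det \<phi> x :: real^2^2"
  have G: "metric_det \<phi> x \<noteq> 0" using metric_det_ge_1[of \<phi> x] by linarith
  have "(metric \<phi> x ** ?B) $ i $ j = mat 1 $ i $ j" for i j
  proof -
    have "partial i \<phi> x * metric_det \<phi> x
      = partial i \<phi> x * (1 + (partial 1 \<phi> x)\<^sup>2 + (partial 2 \<phi> x)\<^sup>2)" by (simp add: metric_det_eq)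
    then show ?thesis
      using exhaust_2[of i] exhaust_2[of j] G
      by (auto simp: matrix_matrix_mult_def sum_2 metric_entry mat_def field_simps)
        (simp_all add: metric_det_eq algebra_simps power2_eq_square)
  qed
  then have "metric \<phi> x ** ?B = mat 1" by (simp add: vec_eq_iff)
  from matrix_inv_eqI[OF this] show ?thesis by (simp add: inv_metric_def)
qed

text \<open>The coefficients \<open>\<surd>G g\<^sup>\<alpha>\<^sup>\<beta>\<close> of the operator in divergence form.\<close>

abbreviation div_coeff :: "(real^2 \<Rightarrow> real) \<Rightarrow> 2 \<Rightarrow> 2 \<Rightarrow> real^2 \<Rightarrow> real" where
  "div_coeff \<phi> \<alpha> \<beta> \<equiv> (\<lambda>x. sqrt (metric_det \<phi> x) * inv_metric \<phi> \<alpha> \<beta> x)"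

lemma inv_metric_sym: "inv_metric \<phi> \<alpha> \<beta> x = inv_metric \<phi> \<beta> \<alpha> x"
  by (simp add: inv_metric_eq mult.commute)

context
  fixes \<phi> :: "real^2 \<Rightarrow> real"
  assumes \<phi>: "BC2 \<phi>"
begin

lemma BC1_partial: "BC1 (partial i \<phi>)"
  using \<phi> by (auto simp: BC2_def BC1_def numeral_2_eq_2)

lemma BC1_metric_det: "BC1 (metric_det \<phi>)"
proof -
  have "metric_det \<phi> = (\<lambda>x. (1 + partial 1 \<phi> x * partial 1 \<phi> x) + partial 2 \<phi> x * partial 2 \<phi> x)"
    by (auto simp: metric_det_eq power2_eq_square)
  then show ?thesis by (simp only:) (intro BC1_add BC1_mult BC1_const BC1_partial)
qed

lemma BC1_inverse_sqrt_det: "BC1 (\<lambda>x. 1 / sqrt (metric_det \<phi> x))"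
  by (rule BC1_inverse_sqrt[OF BC1_metric_det metric_det_ge_1])

lemma BC1_sqrt_det: "BC1 (\<lambda>x. sqrt (metric_det \<phi> x))"
proof -
  have "(\<lambda>x. sqrt (metric_det \<phi> x)) = (\<lambda>x. metric_det \<phi> x * (1 / sqrt (metric_det \<phi> x)))"
    using metric_det_ge_1[of \<phi>] by (auto simp: real_div_sqrt order_trans[OF zero_le_one])
  then show ?thesis by (simp only:) (intro BC1_mult BC1_metric_det BC1_inverse_sqrt_det)
qed

lemma BC1_div_coeff: "BC1 (div_coeff \<phi> \<alpha> \<beta>)"
proof -
  have "div_coeff \<phi> \<alpha> \<beta> = (\<lambda>x. sqrt (metric_det \<phi> x) * (if \<alpha> = \<beta> then 1 else 0)
      + ((-1) * partial \<alpha> \<phi> x) * (partial \<beta> \<phi> x * (1 / sqrt (metric_det \<phi> x))))"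
  proof
    fix x
    have G: "sqrt (metric_det \<phi> x) > 0" "metric_det \<phi> x = sqrt (metric_det \<phi> x) * sqrt (metric_det \<phi> x)"
      using metric_det_ge_1[of \<phi> x] by auto
    then have "sqrt (metric_det \<phi> x) * (p / metric_det \<phi> x) = p / sqrt (metric_det \<phi> x)" for p
      by (metis less_irrefl mult_divide_mult_cancel_left times_divide_eq_right)
    then show "div_coeff \<phi> \<alpha> \<beta> x = sqrt (metric_det \<phi> x) * (if \<alpha> = \<beta> then 1 else 0)
      + ((-1) * partial \<alpha> \<phi> x) * (partial \<beta> \<phi> x * (1 / sqrt (metric_det \<phi> x)))"
      by (simp add: inv_metric_eq right_diff_distrib)
  qed
  then show ?thesis
    by (simp only:) (intro BC1_add BC1_mult BC1_sqrt_det BC1_const BC1_partial BC1_inverse_sqrt_det)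
qed

lemma det_powr_regular:
  "(\<lambda>x. metric_det \<phi> x powr (1/4)) \<in> borel_measurable borel"
  "bounded (range (\<lambda>x. metric_det \<phi> x powr (1/4)))"
proof -
  have [measurable]: "metric_det \<phi> \<in> borel_measurable borel" by (rule BC1_regular[OF BC1_metric_det])
  show "(\<lambda>x. metric_det \<phi> x powr (1/4)) \<in> borel_measurable borel" by measurable
  obtain B where "\<And>x. \<bar>metric_det \<phi> x\<bar> \<le> B"
    using BC1_regular(2)[OF BC1_metric_det] unfolding bounded_iff by auto
  moreover have "\<bar>metric_det \<phi> x powr (1/4)\<bar> \<le> \<bar>metric_det \<phi> x\<bar>" for x
    using powr_mono[of "1/4" 1 "metric_det \<phi> x"] metric_det_ge_1[of \<phi> x] by simp
  ultimately have "\<bar>metric_det \<phi> x powr (1/4)\<bar> \<le> B" for x using order_trans by blast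
  then show "bounded (range (\<lambda>x. metric_det \<phi> x powr (1/4)))"
    by (intro boundedI[of _ B]) auto
qed

end

lemma bounded_linear_mult_L2:
  assumes a: "a \<in> borel_measurable borel" "bounded (range a)"
  shows "bounded_linear (mult_L2 a)"
proof -
  note [measurable] = a(1)
  obtain B where B: "\<And>x. \<bar>a x\<bar> \<le> B" using a(2) unfolding bounded_iff by auto
  have B0: "B \<ge> 0" using B[of 0] by linarith
  note r = rep_mult_AE[OF a]
  show ?thesis
  proof (rule bounded_linear_intro[where K=B])
    fix f g :: L2 and c :: real
    show "mult_L2 a (f + g) = mult_L2 a f + mult_L2 a g"
      by (rule L2_eqI)
        (use r[of "f + g"] r[of f] r[of g] rep_add_AE[of f g] rep_add_AE[of "mult_L2 a f" "mult_L2 a g"]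
          in eventually_elim, simp add: algebra_simps)
    show "mult_L2 a (c *\<^sub>R f) = c *\<^sub>R mult_L2 a f"
      by (rule L2_eqI)
        (use r[of "c *\<^sub>R f"] r[of f] rep_scaleR_AE[of c f] rep_scaleR_AE[of c "mult_L2 a f"]
          in eventually_elim, simp add: algebra_simps)
    have "(norm (mult_L2 a f))\<^sup>2 = (LINT x|lborel. rep_L2 (mult_L2 a f) x * rep_L2 (mult_L2 a f) x)"
      by (simp only: power2_norm_eq_inner inner_L2_rep)
    also have "\<dots> \<le> (LINT x|lborel. B\<^sup>2 * (rep_L2 f x * rep_L2 f x))"
    proof (rule integral_mono_AE)
      show "integrable lborel (\<lambda>x. B\<^sup>2 * (rep_L2 f x * rep_L2 f x))"
        by (intro integrable_mult_right integrable_rep_mult)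
      show "AE x in lborel. rep_L2 (mult_L2 a f) x * rep_L2 (mult_L2 a f) x \<le> B\<^sup>2 * (rep_L2 f x * rep_L2 f x)"
        using r[of f]
      proof eventually_elim
        case (elim x)
        have "(a x)\<^sup>2 \<le> B\<^sup>2" using B[of x] by (simp add: abs_le_square_iff[symmetric])
        then have "(a x)\<^sup>2 * (rep_L2 f x)\<^sup>2 \<le> B\<^sup>2 * (rep_L2 f x)\<^sup>2" by (intro mult_right_mono) auto
        then show ?case using elim by (simp add: power2_eq_square algebra_simps)
      qed
    qed (rule integrable_rep_mult)
    also have "\<dots> = (B * norm f)\<^sup>2"
      by (simp add: power_mult_distrib power2_norm_eq_inner inner_L2_rep)
    finally show "norm (mult_L2 a f) \<le> norm f * B"
      using B0 by (simp add: abs_le_square_iff[symmetric] mult.commute)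
  qed
qed

lemma inner_mult_L2:
  assumes a: "a \<in> borel_measurable borel" "bounded (range a)"
  shows "mult_L2 a f \<bullet> g = (LINT x|lborel. a x * rep_L2 f x * rep_L2 g x)"
    "mult_L2 a f \<bullet> g = f \<bullet> mult_L2 a g"
    "integrable lborel (\<lambda>x. a x * rep_L2 f x * rep_L2 g x)"
proof -
  note [measurable] = a(1)
  show 1: "mult_L2 a f \<bullet> g = (LINT x|lborel. a x * rep_L2 f x * rep_L2 g x)" for f g
    unfolding inner_L2_rep using rep_mult_AE[OF a, of f] by (intro integral_cong_AE) auto
  show "mult_L2 a f \<bullet> g = f \<bullet> mult_L2 a g"
    unfolding 1 inner_commute[of f] by (simp add: mult.commute mult.left_commute)
  show "integrable lborel (\<lambda>x. a x * rep_L2 f x * rep_L2 g x)"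
    by (intro square_integrable_mult square_integrable_bounded_mult square_integrable_rep a)
qed

section \<open>The Dirichlet form of the operator\<close>

text \<open>The form \<open>\<kappa> \<integral> \<surd>G g\<^sup>\<alpha>\<^sup>\<beta> \<partial>\<^sub>\<alpha>f \<partial>\<^sub>\<beta>g dX\<close> of \<open>L\<close> with respect to the measure \<open>\<surd>G dX\<close>, meaningful for
  \<open>f\<close> and \<open>g\<close> in \<open>W12\<close>.\<close>

definition dirichlet_form :: "real \<Rightarrow> (real^2 \<Rightarrow> real) \<Rightarrow> L2 \<Rightarrow> L2 \<Rightarrow> real" where
  "dirichlet_form \<kappa> \<phi> f g = \<kappa> * (\<Sum>\<alpha>\<in>UNIV. \<Sum>\<beta>\<in>UNIV.
     mult_L2 (div_coeff \<phi> \<alpha> \<beta>) (weak_partial \<beta> f) \<bullet> weak_partial \<alpha> g)"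

context
  fixes \<phi> :: "real^2 \<Rightarrow> real"
  assumes \<phi>: "BC2 \<phi>"
begin

lemma bounded_linear_G_quarter: "bounded_linear (G_quarter \<phi>)"
  unfolding G_quarter_def using det_powr_regular[OF \<phi>] by (rule bounded_linear_mult_L2)

text \<open>The multipliers \<open>G\<^sup>1\<^sup>/\<^sup>4\<close> of both factors and \<open>-\<kappa>/\<surd>G\<close> of the operator combine to \<open>-\<kappa>\<close>, and the
  remaining divergence is integrated by parts.\<close>

lemma inner_G_quarter_L_op:
  assumes f: "f \<in> W22" and g: "g \<in> W12"
  shows "G_quarter \<phi> (L_op \<kappa> \<phi> f) \<bullet> G_quarter \<phi> g = dirichlet_form \<kappa> \<phi> f g"
proof -
  let ?h = "\<lambda>\<alpha>. \<Sum>\<beta>\<in>UNIV. mult_L2 (div_coeff \<phi> \<alpha> \<beta>) (weak_partial \<beta> f)"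
  let ?D = "\<Sum>\<alpha>\<in>UNIV. weak_partial \<alpha> (?h \<alpha>)"
  let ?q = "\<lambda>x. metric_det \<phi> x powr (1/4)" and ?c = "\<lambda>x. - (\<kappa> / sqrt (metric_det \<phi> x))"
  have "BC1 (\<lambda>x. (- \<kappa>) * (1 / sqrt (metric_det \<phi> x)))"
    by (intro BC1_mult BC1_const BC1_inverse_sqrt_det[OF \<phi>])
  from BC1_regular[OF this] have c: "?c \<in> borel_measurable borel" "bounded (range ?c)" by simp_all
  note [measurable] = c(1) det_powr_regular(1)[OF \<phi>]
  have W: "weak_partial \<beta> f \<in> W12" for \<beta> using f by (simp add: W22_def)
  have h: "?h \<alpha> \<in> W12" for \<alpha>
    by (intro W12_sum mult_L2_W12 BC1_div_coeff \<phi> W) auto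
  have "G_quarter \<phi> (L_op \<kappa> \<phi> f) \<bullet> G_quarter \<phi> g
      = (LINT x|lborel. rep_L2 (mult_L2 ?q (mult_L2 ?c ?D)) x * rep_L2 (mult_L2 ?q g) x)"
    by (simp add: G_quarter_def L_op_def inner_L2_rep)
  also have "\<dots> = (LINT x|lborel. - \<kappa> * (rep_L2 ?D x * rep_L2 g x))"
  proof (rule integral_cong_AE)
    show "AE x in lborel. rep_L2 (mult_L2 ?q (mult_L2 ?c ?D)) x * rep_L2 (mult_L2 ?q g) x
        = - \<kappa> * (rep_L2 ?D x * rep_L2 g x)"
      using rep_mult_AE[OF det_powr_regular[OF \<phi>], of "mult_L2 ?c ?D"] rep_mult_AE[OF det_powr_regular[OF \<phi>], of g]
        rep_mult_AE[OF c, of ?D]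
    proof eventually_elim
      case (elim x)
      have G: "metric_det \<phi> x > 0" using metric_det_ge_1[of \<phi> x] by linarith
      have "?q x * ?q x = sqrt (metric_det \<phi> x)"
        using G by (simp add: powr_add[symmetric] powr_half_sqrt)
      then have "?q x * ?c x * ?q x = - \<kappa>" using G by (simp add: field_simps)
      then have "(?q x * ?c x * ?q x) * (rep_L2 ?D x * rep_L2 g x) = - \<kappa> * (rep_L2 ?D x * rep_L2 g x)"
        by simp
      then show ?case unfolding elim by (simp only: mult_ac)
    qed
  qed measurable
  also have "\<dots> = - \<kappa> * (?D \<bullet> g)" by (simp add: inner_L2_rep)
  also have "?D \<bullet> g = (\<Sum>\<alpha>\<in>UNIV. - (?h \<alpha> \<bullet> weak_partial \<alpha> g))"
    using weak_partial_parts[OF W12_has_weak_partial[OF h] W12_has_weak_partial[OF g]]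
    by (simp add: inner_sum_left[of _ UNIV])
  finally show ?thesis by (simp add: dirichlet_form_def inner_sum_left sum_negf)
qed

lemma div_coeff_regular:
  "div_coeff \<phi> \<alpha> \<beta> \<in> borel_measurable borel" "bounded (range (div_coeff \<phi> \<alpha> \<beta>))"
  using BC1_regular[OF BC1_div_coeff[OF \<phi>]] by auto

lemma dirichlet_form_sym: "dirichlet_form \<kappa> \<phi> f g = dirichlet_form \<kappa> \<phi> g f"
proof -
  have "mult_L2 (div_coeff \<phi> \<alpha> \<beta>) (weak_partial \<beta> f) \<bullet> weak_partial \<alpha> g
      = mult_L2 (div_coeff \<phi> \<beta> \<alpha>) (weak_partial \<alpha> g) \<bullet> weak_partial \<beta> f" for \<alpha> \<beta>
    using inner_mult_L2(2)[OF div_coeff_regular, of \<alpha> \<beta> "weak_partial \<beta> f" "weak_partial \<alpha> g"]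
    by (simp add: inner_commute inv_metric_sym[of _ \<alpha> \<beta>])
  then show ?thesis unfolding dirichlet_form_def
    by (simp only:) (subst sum.swap, rule refl)
qed

lemma dirichlet_form_diff_right:
  assumes "g \<in> W12" "h \<in> W12"
  shows "dirichlet_form \<kappa> \<phi> f (g - h) = dirichlet_form \<kappa> \<phi> f g - dirichlet_form \<kappa> \<phi> f h"
  by (simp add: dirichlet_form_def weak_partial_diff[OF assms] inner_diff_right sum_subtractf
      right_diff_distrib)

lemma dirichlet_form_eq:
  "dirichlet_form \<kappa> \<phi> f f = \<kappa> * (LINT x|lborel. (\<Sum>\<alpha>\<in>UNIV. \<Sum>\<beta>\<in>UNIV. inv_metric \<phi> \<alpha> \<beta> x *
        rep_L2 (weak_partial \<alpha> f) x * rep_L2 (weak_partial \<beta> f) x) * sqrt (metric_det \<phi> x))"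
proof -
  note i = inner_mult_L2(1,3)[OF div_coeff_regular]
  have "(\<Sum>\<alpha>\<in>UNIV. \<Sum>\<beta>\<in>UNIV. mult_L2 (div_coeff \<phi> \<alpha> \<beta>) (weak_partial \<beta> f) \<bullet> weak_partial \<alpha> f)
      = (LINT x|lborel. (\<Sum>\<alpha>\<in>UNIV. \<Sum>\<beta>\<in>UNIV. div_coeff \<phi> \<alpha> \<beta> x * rep_L2 (weak_partial \<beta> f) x * rep_L2 (weak_partial \<alpha> f) x))"
    by (simp add: i Bochner_Integration.integral_sum)
  also have "(\<lambda>x. \<Sum>\<alpha>\<in>UNIV. \<Sum>\<beta>\<in>UNIV. div_coeff \<phi> \<alpha> \<beta> x * rep_L2 (weak_partial \<beta> f) x * rep_L2 (weak_partial \<alpha> f) x)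
      = (\<lambda>x. (\<Sum>\<alpha>\<in>UNIV. \<Sum>\<beta>\<in>UNIV. inv_metric \<phi> \<alpha> \<beta> x *
        rep_L2 (weak_partial \<alpha> f) x * rep_L2 (weak_partial \<beta> f) x) * sqrt (metric_det \<phi> x))"
    by (simp add: sum_distrib_left mult_ac)
  finally show ?thesis by (simp add: dirichlet_form_def)
qed

lemma dirichlet_form_nonneg:
  assumes "\<kappa> \<ge> 0"
  shows "dirichlet_form \<kappa> \<phi> f f \<ge> 0"
proof -
  have "(\<Sum>\<alpha>\<in>UNIV. \<Sum>\<beta>\<in>UNIV. inv_metric \<phi> \<alpha> \<beta> x * \<xi> \<alpha> * \<xi> \<beta>) \<ge> 0" for x and \<xi> :: "2 \<Rightarrow> real"
  proof -
    let ?p = "partial 1 \<phi> x" and ?q = "partial 2 \<phi> x" and ?G = "metric_det \<phi> x"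
    have G: "?G > 0" using metric_det_ge_1[of \<phi> x] by linarith
    \<comment> \<open>Lagrange's identity, giving the Cauchy-Schwarz inequality for \<open>\<nabla>\<phi>\<close> and \<open>\<xi>\<close>\<close>
    have "(?p * \<xi> 1 + ?q * \<xi> 2)\<^sup>2 + (?q * \<xi> 1 - ?p * \<xi> 2)\<^sup>2 + (\<xi> 1)\<^sup>2 + (\<xi> 2)\<^sup>2 = ?G * ((\<xi> 1)\<^sup>2 + (\<xi> 2)\<^sup>2)"
      by (simp add: metric_det_eq power2_eq_square algebra_simps)
    moreover have "0 \<le> (?q * \<xi> 1 - ?p * \<xi> 2)\<^sup>2" "0 \<le> (\<xi> 1)\<^sup>2" "0 \<le> (\<xi> 2)\<^sup>2" by auto
    ultimately have "(?p * \<xi> 1 + ?q * \<xi> 2)\<^sup>2 \<le> ?G * ((\<xi> 1)\<^sup>2 + (\<xi> 2)\<^sup>2)" by linarith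
    then have "(?p * \<xi> 1 + ?q * \<xi> 2)\<^sup>2 / ?G \<le> (\<xi> 1)\<^sup>2 + (\<xi> 2)\<^sup>2" using G by (simp add: pos_divide_le_eq mult.commute)
    moreover have "(\<Sum>\<alpha>\<in>UNIV. \<Sum>\<beta>\<in>UNIV. inv_metric \<phi> \<alpha> \<beta> x * \<xi> \<alpha> * \<xi> \<beta>)
        = (\<xi> 1)\<^sup>2 + (\<xi> 2)\<^sup>2 - (?p * \<xi> 1 + ?q * \<xi> 2)\<^sup>2 / ?G"
      using G by (simp add: sum_2 inv_metric_eq power2_eq_square field_simps)
    ultimately show ?thesis by simp
  qed
  then show ?thesis
    unfolding dirichlet_form_eq using assms metric_det_ge_1[of \<phi>]
    by (intro mult_nonneg_nonneg integral_nonneg_AE AE_I2) (auto intro: order_trans[OF zero_le_one])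
qed

lemma dirichlet_form_le_W12_Gamma_norm:
  assumes "\<kappa> \<ge> 0"
  shows "dirichlet_form \<kappa> \<phi> f f \<le> \<kappa> * (W12_Gamma_norm \<phi> f)\<^sup>2" "W12_Gamma_norm \<phi> f \<ge> 0"
proof -
  let ?I = "(LINT x|lborel. (\<Sum>\<alpha>\<in>UNIV. \<Sum>\<beta>\<in>UNIV. inv_metric \<phi> \<alpha> \<beta> x *
        rep_L2 (weak_partial \<alpha> f) x * rep_L2 (weak_partial \<beta> f) x) * sqrt (metric_det \<phi> x))"
  have I: "?I \<ge> 0" using dirichlet_form_nonneg[of 1 f] dirichlet_form_eq[of 1 f] by simp
  then have "(W12_Gamma_norm \<phi> f)\<^sup>2 = (norm (G_quarter \<phi> f))\<^sup>2 + ?I"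
    unfolding W12_Gamma_norm_def by (intro real_sqrt_pow2) simp
  then have "?I \<le> (W12_Gamma_norm \<phi> f)\<^sup>2" by simp
  then show "dirichlet_form \<kappa> \<phi> f f \<le> \<kappa> * (W12_Gamma_norm \<phi> f)\<^sup>2"
    unfolding dirichlet_form_eq using assms by (intro mult_left_mono)
  show "W12_Gamma_norm \<phi> f \<ge> 0" using I by (simp add: W12_Gamma_norm_def)
qed

end

section \<open>The abstract energy estimate\<close>

lemma measurable_continuous_lebesgue_on:
  fixes f :: "'a::euclidean_space \<Rightarrow> 'b::topological_space"
  assumes "continuous_on S f" and S: "S \<in> sets lebesgue"
  shows "f \<in> borel_measurable (lebesgue_on S)"
proof (rule borel_measurableI)
  fix U :: "'b set" assume "open U"
  then obtain V where V: "open V" "V \<inter> S = f -` U \<inter> S"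
    using assms(1) unfolding continuous_on_open_invariant by blast
  have "V \<inter> S \<in> sets (lebesgue_on S)" 
    unfolding sets_restrict_space using V(1) by (intro image_eqI[of _ _ V]) (simp_all add: Int_commute)
  then show "f -` U \<inter> space (lebesgue_on S) \<in> sets (lebesgue_on S)"
    using S V(2) by (simp add: space_restrict_space)
qed

lemma lebesgue_on_integral_bound_exhaustion:
  fixes g :: "real \<Rightarrow> real"
  assumes c: "continuous_on S g" and g0: "\<And>t. g t \<ge> 0"
    and S: "S = (\<Union>n. {a n..b n})" and a: "decseq a" and b: "incseq b"
    and B: "\<And>n::nat. integral {a n..b n} g \<le> B"
  shows "integrable (lebesgue_on S) g" "(LINT t|lebesgue_on S. g t) \<le> B"
proof -
  have Sm: "S \<in> sets lebesgue" unfolding S by auto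
  have m: "g \<in> borel_measurable (lebesgue_on S)" by (rule measurable_continuous_lebesgue_on[OF c Sm])
  define F where "F n t = ennreal (g t) * indicator {a n..b n} t" for n t
  have ci: "continuous_on {a n..b n} g" for n
    by (rule continuous_on_subset[OF c]) (use S in auto)
  have F: "(\<integral>\<^sup>+t. F n t \<partial>lebesgue) = ennreal (integral {a n..b n} g)" for n
  proof -
    have "(g has_integral integral {a n..b n} g) {a n..b n}"
      using integrable_continuous_real[OF ci] by (rule integrable_integral)
    from nn_integral_has_integral_lebesgue'[OF _ this] g0
    show ?thesis by (simp add: F_def nn_integral_completion)
  qed
  have Fm: "F n \<in> borel_measurable lebesgue" for n
  proof -
    have "(\<lambda>t. if t \<in> {a n..b n} then g t else 0) \<in> borel_measurable lebesgue"
      by (intro borel_measurable_if_I measurable_continuous_lebesgue_on[OF ci]) auto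
    then have "(\<lambda>t. ennreal (if t \<in> {a n..b n} then g t else 0)) \<in> borel_measurable lebesgue"
      by measurable
    also have "(\<lambda>t. ennreal (if t \<in> {a n..b n} then g t else 0)) = F n"
      by (auto simp: F_def indicator_def)
    finally show ?thesis .
  qed
  have inc: "{a m..b m} \<subseteq> {a n..b n}" if "m \<le> n" for m n
    using decseqD[OF a that] incseqD[OF b that] by auto
  have Finc: "incseq F"
    unfolding incseq_def F_def le_fun_def
    using inc by (auto intro!: mult_left_mono simp: indicator_def split: if_splits) (fastforce)+
  have sup: "(SUP n. F n t) = ennreal (g t) * indicator S t" for t
  proof (rule antisym)
    show "(SUP n. F n t) \<le> ennreal (g t) * indicator S t"
      by (rule SUP_least) (auto simp: F_def S indicator_def)
    show "ennreal (g t) * indicator S t \<le> (SUP n. F n t)"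
    proof (cases "t \<in> S")
      case True
      then obtain n where "t \<in> {a n..b n}" using S by auto
      then have "ennreal (g t) * indicator S t = F n t" using True by (simp add: F_def)
      also have "\<dots> \<le> (SUP n. F n t)" by (rule SUP_upper) simp
      finally show ?thesis .
    qed simp
  qed
  have "(\<integral>\<^sup>+t. g t \<partial>lebesgue_on S) = (\<integral>\<^sup>+t. ennreal (g t) * indicator S t \<partial>lebesgue)"
    by (rule nn_integral_restrict_space) (use Sm in simp)
  also have "\<dots> = (\<integral>\<^sup>+t. (SUP n. F n t) \<partial>lebesgue)" by (simp only: sup)
  also have "\<dots> = (SUP n. \<integral>\<^sup>+t. F n t \<partial>lebesgue)"
    by (rule nn_integral_monotone_convergence_SUP[OF Finc Fm])
  also have "\<dots> \<le> ennreal B"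
    by (rule SUP_least) (simp add: F ennreal_leI[OF B])
  finally have le: "(\<integral>\<^sup>+t. g t \<partial>lebesgue_on S) \<le> ennreal B" .
  then show i: "integrable (lebesgue_on S) g"
    using m g0 by (intro integrableI_nonneg) (auto intro: le_less_trans)
  have "integral {a 0..b 0} g \<ge> 0" using g0 by (intro integral_nonneg integrable_continuous_real ci) auto
  then have B0: "B \<ge> 0" using B[of 0] by linarith
  have "ennreal (LINT t|lebesgue_on S. g t) \<le> ennreal B"
    using le nn_integral_eq_integral[OF i] g0 by simp
  then show "(LINT t|lebesgue_on S. g t) \<le> B" using B0 by simp
qed

lemma open_interval_exhaustion:
  fixes T :: real assumes "T > 0"
  obtains a b :: "nat \<Rightarrow> real" where "{0<..<T} = (\<Union>n. {a n..b n})" "decseq a" "incseq b"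
    "\<And>n. 0 < a n" "\<And>n. a n < b n" "\<And>n. b n < T"
proof -
  define a where "a n = T / real (n + 3)" for n
  define b where "b n = T - T / real (n + 3)" for n
  have l: "a \<longlonglongrightarrow> 0"
  proof -
    have "(\<lambda>n. T * (1 / real (n + 3))) \<longlonglongrightarrow> T * 0"
      by (intro tendsto_intros LIMSEQ_ignore_initial_segment[OF lim_1_over_n])
    then show ?thesis by (simp add: a_def[abs_def])
  qed
  have "t \<in> (\<Union>n. {a n..b n})" if "t \<in> {0<..<T}" for t
  proof -
    have "min t (T - t) > 0" using that by auto
    then have "\<forall>\<^sub>F n in sequentially. a n < min t (T - t)" by (rule order_tendstoD(2)[OF l])
    then obtain n where "a n < min t (T - t)" by (meson eventually_sequentially order_refl)
    then have "t \<in> {a n..b n}" by (auto simp: a_def b_def)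
    then show ?thesis by blast
  qed
  moreover have "{a n..b n} \<subseteq> {0<..<T}" for n
  proof -
    have "T / real (n + 3) > 0" using assms by simp
    then show ?thesis by (auto simp: a_def b_def)
  qed
  ultimately have S: "{0<..<T} = (\<Union>n. {a n..b n})" by blast
  have da: "decseq a" using assms by (auto simp: decseq_def a_def intro!: divide_left_mono)
  then have ib: "incseq b" by (auto simp: decseq_def incseq_def a_def b_def)
  show ?thesis
  proof (rule that[OF S da ib])
    show "0 < a n" "b n < T" for n using assms by (simp_all add: a_def b_def)
    show "a n < b n" for n
    proof -
      have "T / real (n + 3) \<le> T / 3" using assms by (intro divide_left_mono) auto
      then show ?thesis using assms unfolding a_def b_def by linarith
    qed
  qed
qed

lemma half_line_exhaustion:
  obtains a b :: "nat \<Rightarrow> real" where "{0<..} = (\<Union>n. {a n..b n})" "decseq a" "incseq b"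
    "\<And>n. 0 < a n" "\<And>n. a n < b n"
proof -
  define a where "a n = 1 / real (n + 2)" for n
  define b where "b n = real (n + 2)" for n
  have "t \<in> (\<Union>n. {a n..b n})" if "t > 0" for t
  proof -
    obtain n1 where n1: "t \<le> real n1" using real_arch_simple by blast
    obtain n2 where n2: "1 / t \<le> real n2" using real_arch_simple by blast
    have "1 / t \<le> real (n1 + n2 + 2)" using n2 by simp
    then have "a (n1 + n2) \<le> t" using that by (simp add: a_def field_simps)
    moreover have "t \<le> b (n1 + n2)" using n1 by (simp add: b_def)
    ultimately show ?thesis by (intro UN_I[of "n1 + n2"]) auto
  qed
  moreover have "{a n..b n} \<subseteq> {0<..}" for n by (auto simp: a_def intro: less_le_trans[rotated])
  ultimately have S: "{0<..} = (\<Union>n. {a n..b n})" by blast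
  have da: "decseq a" by (auto simp: decseq_def a_def intro!: divide_left_mono)
  have ib: "incseq b" by (auto simp: incseq_def b_def)
  show ?thesis
  proof (rule that[OF S da ib])
    show "0 < a n" for n by (simp add: a_def)
    have "a n < 1" "1 < b n" for n by (simp_all add: a_def b_def)
    then show "a n < b n" for n using less_trans by blast
  qed
qed

text \<open>In the application \<open>w\<close>, \<open>l\<close> and \<open>f\<close> are \<open>G\<^sup>1\<^sup>/\<^sup>4\<close> times \<open>v\<close>, \<open>Lv\<close> and \<open>F\<close>, \<open>dw\<close> is the time derivative of \<open>w\<close>,
  \<open>e\<close> is the energy \<open>a(v, v)\<close>, and \<open>e0\<close> is a bound of the initial energy. No continuity of \<open>e\<close> at 0 is
  assumed; the initial energy enters only through the convexity inequality \<open>sub\<close>.\<close>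

context
  fixes w dw l f :: "real \<Rightarrow> 'a::real_inner" and e :: "real \<Rightarrow> real" and e0 :: real
  assumes wc: "continuous_on {0..} w"
    and dw: "\<And>t. t > 0 \<Longrightarrow> (w has_vector_derivative dw t) (at t)"
    and evol: "\<And>t. t > 0 \<Longrightarrow> dw t + l t = f t"
    and dwc: "continuous_on {0<..} dw" and fc: "continuous_on {0<..} f"
    and ed: "\<And>t. t > 0 \<Longrightarrow> (e has_real_derivative 2 * (l t \<bullet> dw t)) (at t)"
    and enn: "\<And>t. t > 0 \<Longrightarrow> e t \<ge> 0" and e0: "e0 \<ge> 0"
    and sub: "\<And>t. t > 0 \<Longrightarrow> (e t - e0) / 2 \<le> l t \<bullet> (w t - w 0)"
    and fL2: "L2_time {0<..} f"
begin

lemma forcing_integrable: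
  assumes "S \<subseteq> {0<..}" "S \<in> sets lebesgue"
  shows "integrable (lebesgue_on S) (\<lambda>t. (norm (f t))\<^sup>2)"
    "(LINT t|lebesgue_on S. (norm (f t))\<^sup>2) = integral S (\<lambda>t. (norm (f t))\<^sup>2)"
proof -
  have "integrable (lebesgue_on {0<..}) (\<lambda>t. (norm (f t))\<^sup>2)" using fL2 by (simp add: L2_time_def)
  then have "set_integrable lebesgue {0<..} (\<lambda>t. (norm (f t))\<^sup>2)"
    by (simp add: integrable_restrict_space set_integrable_def)
  then have "set_integrable lebesgue S (\<lambda>t. (norm (f t))\<^sup>2)"
    by (rule set_integrable_subset) (use assms in auto)
  then show *: "integrable (lebesgue_on S) (\<lambda>t. (norm (f t))\<^sup>2)"
    using assms(2) by (simp add: integrable_restrict_space set_integrable_def)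
  show "(LINT t|lebesgue_on S. (norm (f t))\<^sup>2) = integral S (\<lambda>t. (norm (f t))\<^sup>2)"
    by (rule lebesgue_integral_eq_integral[OF * assms(2)])
qed

lemma forcing_integrable_on: "(\<lambda>t. (norm (f t))\<^sup>2) integrable_on {0..T}"
proof -
  have "(\<lambda>t. (norm (f t))\<^sup>2) integrable_on {0<..<T}"
    by (intro integrable_on_lebesgue_on forcing_integrable) auto
  then show ?thesis by (simp add: integrable_on_open_interval_real)
qed

text \<open>The squared \<open>L\<^sup>2\<close> norm of the forcing up to time \<open>T\<close>.\<close>

definition forcing_energy :: "real \<Rightarrow> real" where "forcing_energy T = integral {0..T} (\<lambda>t. (norm (f t))\<^sup>2)"

lemma forcing_energy_derivative:
  assumes "t > 0" shows "(forcing_energy has_real_derivative (norm (f t))\<^sup>2) (at t)"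
proof -
  have "continuous (at t) f" using fc assms by (simp add: continuous_on_eq_continuous_at)
  then have "continuous (at t within {0..t + 1}) (\<lambda>t. (norm (f t))\<^sup>2)"
    by (intro continuous_intros) (rule continuous_at_imp_continuous_at_within)
  from integral_has_vector_derivative_continuous_at[where S="{}", simplified, OF forcing_integrable_on _ this]
  have "(forcing_energy has_vector_derivative (norm (f t))\<^sup>2) (at t within {0..t + 1})"
    using assms unfolding forcing_energy_def by auto
  moreover have "at t within {0..t + 1} = at t" using assms by (intro at_within_interior) auto
  ultimately show ?thesis by (simp add: has_real_derivative_iff_has_vector_derivative)
qed

lemma forcing_energy_continuous: "continuous_on {0..T} forcing_energy"
  unfolding forcing_energy_def by (rule indefinite_integral_continuous_1[OF forcing_integrable_on])

lemma forcing_energy_mono: "0 \<le> s \<Longrightarrow> s \<le> t \<Longrightarrow> forcing_energy s \<le> forcing_energy t"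
  unfolding forcing_energy_def by (rule integral_subset_le) (auto intro: forcing_integrable_on)

lemma forcing_energy_0: "forcing_energy 0 = 0"
  by (simp add: forcing_energy_def)

lemma balance_derivative:
  assumes "t > 0"
  shows "((\<lambda>t. forcing_energy t - e t) has_real_derivative (norm (dw t))\<^sup>2 + (norm (l t))\<^sup>2) (at t)"
proof -
  have "(norm (f t))\<^sup>2 - 2 * (l t \<bullet> dw t) = (norm (dw t))\<^sup>2 + (norm (l t))\<^sup>2"
    unfolding evol[OF assms, symmetric]
    by (simp add: power2_norm_eq_inner inner_add_left inner_add_right inner_commute)
  then show ?thesis using DERIV_diff[OF forcing_energy_derivative[OF assms] ed[OF assms]] by simp
qed

lemma energy_mono:
  assumes "0 < s" "s \<le> t"
  shows "e t - forcing_energy t \<le> e s - forcing_energy s"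
proof -
  have "forcing_energy s - e s \<le> forcing_energy t - e t"
  proof (rule DERIV_nonneg_imp_nondecreasing[OF assms(2)])
    fix x assume "s \<le> x" "x \<le> t"
    then have "x > 0" using assms by simp
    from balance_derivative[OF this]
    show "\<exists>y. ((\<lambda>t. forcing_energy t - e t) has_real_derivative y) (at x) \<and> 0 \<le> y" by (meson add_nonneg_nonneg zero_le_power2)
  qed
  then show ?thesis by simp
qed

text \<open>Since \<open>w\<close> is merely continuous at 0, the energy cannot be evaluated there. With
  \<open>n = |w - w(0)|\<close> one has \<open>(n\<^sup>2)' \<le> 2 |f| n + e\<^sub>0 - e\<close>, and \<open>e\<close> decreases on \<open>(0, t]\<close> up to the
  contribution of \<open>f\<close>; as \<open>n\<close> vanishes at time 0, a large \<open>e(t)\<close> would make \<open>n\<^sup>2\<close> negative. The weight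
  \<open>2 - s/t\<close> absorbs the term \<open>2 |f| n\<close>.\<close>

lemma energy_bound:
  assumes t: "t > 0"
  shows "e t \<le> e0 + 5 * forcing_energy t"
proof (cases "e t \<le> e0 + forcing_energy t")
  case True
  then show ?thesis using forcing_energy_mono[of 0 t] t by (simp add: forcing_energy_0)
next
  case False
  \<comment> \<open>the excess of the energy, to be bounded by \<open>4 * forcing_energy t\<close>\<close>
  define b where "b = e t - e0 - forcing_energy t"
  have b: "b > 0" using False by (simp add: b_def)
  define n where "n s = norm (w s - w 0)" for s
  define Z where "Z s = (2 - s / t) * (n s)\<^sup>2 - 4 * t * forcing_energy s + b * s" for s
  have "Z 0 \<ge> Z t"
  proof (rule DERIV_nonpos_imp_decreasing_open[of 0 t Z])
    show "0 \<le> t" using t by simp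
    have "continuous_on {0..t} n"
      unfolding n_def by (intro continuous_intros continuous_on_subset[OF wc]) auto
    then show "continuous_on {0..t} Z"
      unfolding Z_def using t by (intro continuous_intros forcing_energy_continuous) auto
    fix s assume s: "0 < s" "s < t"
    define dn where "dn = 2 * ((w s - w 0) \<bullet> dw s)"
    have "((\<lambda>s. (w s - w 0) \<bullet> (w s - w 0)) has_derivative
        (\<lambda>h. (w s - w 0) \<bullet> (h *\<^sub>R dw s) + (h *\<^sub>R dw s) \<bullet> (w s - w 0))) (at s)"
      using dw[OF s(1)] unfolding has_vector_derivative_def
      by (auto intro!: derivative_eq_intros)
    then have dn: "((\<lambda>s. (n s)\<^sup>2) has_real_derivative dn) (at s)"
      unfolding n_def power2_norm_eq_inner has_field_derivative_def
      by (rule has_derivative_eq_rhs) (auto simp: dn_def inner_commute)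
    define c where "c = 2 - s / t"
    have c: "1 \<le> c" "c \<le> 2" using s by (auto simp: c_def field_simps)
    have DZ: "(Z has_real_derivative - (1 / t) * (n s)\<^sup>2 + c * dn - 4 * t * (norm (f s))\<^sup>2 + b) (at s)"
    proof -
      have "((\<lambda>s. 2 - s / t) has_real_derivative - (1 / t)) (at s)"
        using t by (auto intro!: derivative_eq_intros)
      from DERIV_add[OF DERIV_diff[OF DERIV_mult[OF this dn] DERIV_cmult[OF forcing_energy_derivative[OF s(1)]]] DERIV_cmult_Id]
      show ?thesis unfolding Z_def c_def by (rule DERIV_cong) simp
    qed
    have "dw s = f s - l s" using evol[OF s(1)] by (simp add: algebra_simps)
    then have "dn = 2 * ((w s - w 0) \<bullet> f s) - 2 * (l s \<bullet> (w s - w 0))"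
      by (simp add: dn_def inner_diff_right inner_commute)
    also have "\<dots> \<le> 2 * (n s * norm (f s)) - (e s - e0)"
    proof (rule diff_mono)
      show "2 * ((w s - w 0) \<bullet> f s) \<le> 2 * (n s * norm (f s))"
        using norm_cauchy_schwarz[of "w s - w 0" "f s"] by (simp add: n_def)
      show "e s - e0 \<le> 2 * (l s \<bullet> (w s - w 0))" using sub[OF s(1)] by simp
    qed
    also have "\<dots> \<le> 2 * (n s * norm (f s)) - b"
      using energy_mono[OF s(1), of t] s forcing_energy_mono[of 0 s] by (simp add: b_def forcing_energy_0)
    finally have "c * dn \<le> c * (2 * (n s * norm (f s)) - b)" using c by (intro mult_left_mono) auto
    also have "\<dots> = c * (2 * (n s * norm (f s))) - c * b" by (simp add: right_diff_distrib)
    also have "\<dots> \<le> 2 * (2 * (n s * norm (f s))) - 1 * b"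
      using c b by (intro diff_mono mult_right_mono) (auto simp: n_def)
    finally have 1: "c * dn \<le> 4 * (n s * norm (f s)) - b" by simp
    have "0 \<le> (n s - 2 * t * norm (f s))\<^sup>2 / t" using t by simp
    also have "\<dots> = (1 / t) * (n s)\<^sup>2 - 4 * (n s * norm (f s)) + 4 * t * (norm (f s))\<^sup>2"
      using t by (simp add: field_simps power2_eq_square)
    finally have "- (1 / t) * (n s)\<^sup>2 + c * dn - 4 * t * (norm (f s))\<^sup>2 + b \<le> 0" using 1 by simp
    with DZ show "\<exists>y. (Z has_real_derivative y) (at s) \<and> y \<le> 0" by blast
  qed
  moreover have "Z 0 = 0" by (simp add: Z_def n_def forcing_energy_0)
  moreover have "Z t = (n t)\<^sup>2 + t * (b - 4 * forcing_energy t)" using t by (simp add: Z_def algebra_simps)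
  ultimately have "t * (b - 4 * forcing_energy t) \<le> 0" using zero_le_power2[of "n t"] by linarith
  then have "b \<le> 4 * forcing_energy t" using t by (simp add: mult_le_0_iff)
  then show ?thesis by (simp add: b_def)
qed

lemma dissipation_bound:
  assumes "0 < s" "s < t"
  shows "integral {s..t} (\<lambda>t. (norm (dw t))\<^sup>2 + (norm (l t))\<^sup>2) \<le> e0 + 5 * forcing_energy t"
proof -
  have "((\<lambda>t. (norm (dw t))\<^sup>2 + (norm (l t))\<^sup>2) has_integral (forcing_energy t - e t) - (forcing_energy s - e s)) {s..t}"
  proof (rule fundamental_theorem_of_calculus)
    fix x assume "x \<in> {s..t}"
    then have "x > 0" using assms by auto
    from balance_derivative[OF this]
    show "((\<lambda>t. forcing_energy t - e t) has_vector_derivative (norm (dw x))\<^sup>2 + (norm (l x))\<^sup>2) (at x within {s..t})"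
      by (simp add: has_real_derivative_iff_has_vector_derivative has_vector_derivative_at_within)
  qed (use assms in simp)
  then have "integral {s..t} (\<lambda>t. (norm (dw t))\<^sup>2 + (norm (l t))\<^sup>2) = (forcing_energy t - e t) - (forcing_energy s - e s)"
    by (rule integral_unique)
  also have "\<dots> \<le> e0 + 5 * forcing_energy t"
    using energy_bound[OF assms(1)] enn[of t] forcing_energy_mono[of s t] assms by simp
  finally show ?thesis .
qed

text \<open>The intervals \<open>(0, T)\<close> and \<open>(0, \<infinity>)\<close> are both treated through an exhaustion by compact
  intervals.\<close>

lemma energy_estimate_exhaustion:
  fixes a b :: "nat \<Rightarrow> real"
  assumes S: "S = (\<Union>n. {a n..b n})" "decseq a" "incseq b" "\<And>n. 0 < a n" "\<And>n. a n < b n"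
    and Sb: "\<And>n. {0<..<b n} \<subseteq> S"
  shows "L2_time S dw \<and> L2_time S l \<and>
    L2_time_norm S dw + L2_time_norm S l \<le> 2 * sqrt e0 + 6 * L2_time_norm S f"
proof -
  have S0: "S \<subseteq> {0<..}" using S(1,4) less_le_trans by fastforce
  have Sm: "S \<in> sets lebesgue" unfolding S by auto
  have lc: "continuous_on S l"
  proof -
    have "continuous_on S (\<lambda>t. f t - dw t)"
      by (intro continuous_intros continuous_on_subset[OF fc] continuous_on_subset[OF dwc] S0)
    moreover have "f t - dw t = l t" if "t \<in> S" for t
      using evol[of t] that S0 by (auto simp: algebra_simps)
    ultimately show ?thesis by (simp cong: continuous_on_cong)
  qed
  have dc: "continuous_on S dw" by (rule continuous_on_subset[OF dwc S0])
  define N where "N = (LINT t|lebesgue_on S. (norm (f t))\<^sup>2)"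
  have N: "forcing_energy (b n) \<le> N" for n
  proof -
    have "forcing_energy (b n) = integral {0<..<b n} (\<lambda>t. (norm (f t))\<^sup>2)"
      by (simp add: forcing_energy_def integral_open_interval_real)
    also have "\<dots> \<le> integral S (\<lambda>t. (norm (f t))\<^sup>2)"
      by (intro integral_subset_le Sb integrable_on_lebesgue_on forcing_integrable S0 Sm) auto
    also have "\<dots> = N" unfolding N_def by (rule forcing_integrable(2)[symmetric, OF S0 Sm])
    finally show ?thesis .
  qed
  have N0: "N \<ge> 0" by (simp add: N_def)
  let ?g = "\<lambda>t. (norm (dw t))\<^sup>2 + (norm (l t))\<^sup>2"
  have gc: "continuous_on S ?g" by (intro continuous_intros dc lc)
  have B: "integral {a n..b n} ?g \<le> e0 + 5 * N" for n
    using dissipation_bound[OF S(4,5), of n] N[of n] by linarith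
  note G = lebesgue_on_integral_bound_exhaustion[OF gc _ S(1-3) B]
  have gi: "integrable (lebesgue_on S) ?g" and gB: "(LINT t|lebesgue_on S. ?g t) \<le> e0 + 5 * N"
    using G by auto
  have m: "dw \<in> borel_measurable (lebesgue_on S)" "l \<in> borel_measurable (lebesgue_on S)"
    by (rule measurable_continuous_lebesgue_on[OF _ Sm], fact dc lc)+
  have m': "(\<lambda>t. (norm (dw t))\<^sup>2) \<in> borel_measurable (lebesgue_on S)"
    "(\<lambda>t. (norm (l t))\<^sup>2) \<in> borel_measurable (lebesgue_on S)"
    by (intro measurable_continuous_lebesgue_on Sm continuous_intros dc lc)+
  have i: "integrable (lebesgue_on S) (\<lambda>t. (norm (dw t))\<^sup>2)" "integrable (lebesgue_on S) (\<lambda>t. (norm (l t))\<^sup>2)"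
    by (rule Bochner_Integration.integrable_bound[OF gi]; use m' in simp)+
  define P where "P = (LINT t|lebesgue_on S. (norm (dw t))\<^sup>2)"
  define R where "R = (LINT t|lebesgue_on S. (norm (l t))\<^sup>2)"
  have PR: "P \<ge> 0" "R \<ge> 0" "P + R \<le> e0 + 5 * N"
    using gB i by (simp_all add: P_def R_def)
  have sq: "sqrt (e0 + 5 * N) \<le> sqrt e0 + 3 * sqrt N"
  proof -
    have "sqrt (e0 + 5 * N) \<le> sqrt (e0 + 9 * N)" using N0 by simp
    also have "\<dots> \<le> sqrt e0 + sqrt (9 * N)" using e0 N0 by (intro sqrt_add_le_add_sqrt) auto
    also have "sqrt (9 * N) = 3 * sqrt N"
      using real_sqrt_abs[of 3] by (simp add: real_sqrt_mult)
    finally show ?thesis .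
  qed
  have "sqrt P \<le> sqrt (e0 + 5 * N)" "sqrt R \<le> sqrt (e0 + 5 * N)" using PR by simp_all
  then have "sqrt P + sqrt R \<le> 2 * sqrt e0 + 6 * sqrt N" using sq by linarith
  then show ?thesis
    using m i by (simp add: L2_time_def L2_time_norm_def P_def R_def N_def)
qed

lemma energy_estimate:
  shows "T > 0 \<Longrightarrow> L2_time {0<..<T} dw \<and> L2_time {0<..<T} l \<and>
      L2_time_norm {0<..<T} dw + L2_time_norm {0<..<T} l
        \<le> 2 * sqrt e0 + 6 * L2_time_norm {0<..<T} f"
    and "L2_time {0<..} dw \<and> L2_time {0<..} l \<and>
      L2_time_norm {0<..} dw + L2_time_norm {0<..} l \<le> 2 * sqrt e0 + 6 * L2_time_norm {0<..} f"
proof -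
  assume "T > 0"
  then obtain a b :: "nat \<Rightarrow> real"
    where ab: "{0<..<T} = (\<Union>n. {a n..b n})" "decseq a" "incseq b"
    "\<And>n. 0 < a n" "\<And>n. a n < b n" "\<And>n. b n < T" by (rule open_interval_exhaustion) blast
  have "{0<..<b n} \<subseteq> {0<..<T}" for n using ab(6)[of n] by auto
  then show "L2_time {0<..<T} dw \<and> L2_time {0<..<T} l \<and>
      L2_time_norm {0<..<T} dw + L2_time_norm {0<..<T} l
        \<le> 2 * sqrt e0 + 6 * L2_time_norm {0<..<T} f"
    by (rule energy_estimate_exhaustion[OF ab(1-5)])
next
  obtain a b :: "nat \<Rightarrow> real"
    where ab: "{0<..} = (\<Union>n. {a n..b n})" "decseq a" "incseq b"
    "\<And>n. 0 < a n" "\<And>n. a n < b n" by (rule half_line_exhaustion) blast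
  have "{0<..<b n} \<subseteq> {0<..}" for n by auto
  then show "L2_time {0<..} dw \<and> L2_time {0<..} l \<and>
      L2_time_norm {0<..} dw + L2_time_norm {0<..} l \<le> 2 * sqrt e0 + 6 * L2_time_norm {0<..} f"
    by (rule energy_estimate_exhaustion[OF ab])
qed

end

section \<open>Space-time representatives\<close>

text \<open>Step functions in time have obvious representatives. If they converge fast enough, uniformly in
  time, then at each time their spatial representatives converge almost everywhere.\<close>

lemma L2_space_time_continuous:
  assumes vc: "continuous_on {0..} v"
  shows "L2_space_time {0<..<T} v"
proof -
  have c: "continuous_on {0..T} v" by (rule continuous_on_subset[OF vc]) auto
  have "\<exists>m::nat. m > 0 \<and> (\<forall>s\<in>{0..T}. \<forall>t\<in>{0..T}. \<bar>s - t\<bar> < 2 / real m \<longrightarrow> norm (v s - v t) < (1/2) ^ n)" for n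
  proof -
    have "uniformly_continuous_on {0..T} v" by (rule compact_uniformly_continuous[OF c]) simp
    then obtain d where d: "d > 0"
      "\<And>s t. s \<in> {0..T} \<Longrightarrow> t \<in> {0..T} \<Longrightarrow> dist s t < d \<Longrightarrow> dist (v s) (v t) < (1/2) ^ n"
      unfolding uniformly_continuous_on_def by (metis zero_less_divide_1_iff zero_less_numeral zero_less_power)
    obtain m :: nat where m: "2 / d < real m" using reals_Archimedean2 by blast
    then have "real m > 0" using d(1) by (smt (verit) divide_pos_pos)
    moreover from this have "2 / real m < d" using m d(1) by (simp add: field_simps)
    ultimately show ?thesis using d(2) by (intro exI[of _ m]) (auto simp: dist_norm)
  qed
  then obtain m :: "nat \<Rightarrow> nat" where m: "\<And>n. m n > 0"
    "\<And>n s t. s \<in> {0..T} \<Longrightarrow> t \<in> {0..T} \<Longrightarrow> \<bar>s - t\<bar> < 2 / real (m n) \<Longrightarrow> norm (v s - v t) < (1/2) ^ n"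
    by metis
  define \<tau> where "\<tau> n t = real_of_int \<lfloor>real (m n) * t\<rfloor> / real (m n)" for n t
  have \<tau>: "\<tau> n t \<in> {0..T}" "\<bar>\<tau> n t - t\<bar> < 2 / real (m n)" if "t \<in> {0<..<T}" for n t
  proof -
    have M: "real (m n) > 0" using m(1) by simp
    have "real_of_int \<lfloor>real (m n) * t\<rfloor> \<le> real (m n) * t" "real (m n) * t - 1 < real_of_int \<lfloor>real (m n) * t\<rfloor>"
      by linarith+
    then have 1: "\<tau> n t \<le> t" "t - 1 / real (m n) < \<tau> n t"
      using M by (simp_all add: \<tau>_def divide_simps mult.commute)
    moreover have "\<tau> n t \<ge> 0" using that by (simp add: \<tau>_def)
    moreover have "1 / real (m n) < 2 / real (m n)" using M by (simp add: divide_strict_right_mono)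
    ultimately show "\<tau> n t \<in> {0..T}" "\<bar>\<tau> n t - t\<bar> < 2 / real (m n)" using that by auto
  qed
  define u where "u n z = rep_L2 (v (\<tau> n (snd z))) (fst z)" for n and z :: "(real^2) \<times> real"
  have um [measurable]: "u n \<in> borel_measurable (borel \<Otimes>\<^sub>M borel)" for n
  proof -
    have "(\<lambda>z. (\<lambda>k::int. \<lambda>z. rep_L2 (v (real_of_int k / real (m n))) (fst z)) \<lfloor>real (m n) * snd z\<rfloor> z)
        \<in> borel_measurable (borel \<Otimes>\<^sub>M borel)"
      by (rule measurable_compose_countable) measurable
    then show ?thesis by (simp add: u_def[abs_def] \<tau>_def)
  qed
  \<comment> \<open>where the sequence diverges, the value of \<open>lim\<close> is irrelevant\<close>
  define U where "U z = lim (\<lambda>n. u n z)" for z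
  have Um: "U \<in> borel_measurable (borel \<Otimes>\<^sub>M borel)"
    unfolding U_def by (rule borel_measurable_lim_metric) (rule um)
  then have Ub: "U \<in> borel_measurable borel" by (simp add: borel_prod)
  have lim: "AE x in lborel. rep_L2 (v t) x = U (x, t)" if t: "t \<in> {0<..<T}" for t
  proof -
    define d where "d n x = rep_L2 (v (\<tau> n t)) x - rep_L2 (v t) x" for n x
    have [measurable]: "d n \<in> borel_measurable borel" for n unfolding d_def by measurable
    have dn: "(\<integral>\<^sup>+x. ennreal ((d n x)\<^sup>2) \<partial>lborel) \<le> ennreal ((1/4) ^ n)" for n
    proof -
      let ?g = "v (\<tau> n t) - v t"
      have "(\<integral>\<^sup>+x. ennreal ((d n x)\<^sup>2) \<partial>lborel) = (\<integral>\<^sup>+x. ennreal (rep_L2 ?g x * rep_L2 ?g x) \<partial>lborel)"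
        using rep_diff_AE[of "v (\<tau> n t)" "v t"]
        by (intro nn_integral_cong_AE) (auto simp: d_def power2_eq_square)
      also have "\<dots> = ennreal ((norm ?g)\<^sup>2)"
        using nn_integral_eq_integral[OF integrable_rep_mult[of ?g ?g]]
        by (simp add: power2_norm_eq_inner inner_L2_rep)
      also have "norm ?g \<le> (1/2) ^ n" using m(2)[OF \<tau>(1)[OF t] _ \<tau>(2)[OF t]] t by (simp add: less_imp_le)
      then have "(norm ?g)\<^sup>2 \<le> ((1/2) ^ n)\<^sup>2" by (intro power_mono) auto
      then have "ennreal ((norm ?g)\<^sup>2) \<le> ennreal ((1/4) ^ n)"
        by (intro ennreal_leI) (simp add: power2_eq_square power_mult_distrib[symmetric])
      finally show ?thesis .
    qed
    have "(\<integral>\<^sup>+x. (\<Sum>n. ennreal ((d n x)\<^sup>2)) \<partial>lborel) = (\<Sum>n. \<integral>\<^sup>+x. ennreal ((d n x)\<^sup>2) \<partial>lborel)"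
      by (rule nn_integral_suminf) measurable
    also have "\<dots> \<le> (\<Sum>n. ennreal ((1/4) ^ n))" by (intro suminf_le dn) auto
    also have "\<dots> = ennreal (\<Sum>n. (1/4) ^ n)" by (rule suminf_ennreal2) (auto simp: summable_geometric)
    finally have "(\<integral>\<^sup>+x. (\<Sum>n. ennreal ((d n x)\<^sup>2)) \<partial>lborel) \<noteq> \<infinity>"
      by (metis ennreal_neq_top infinity_ennreal_def neq_top_trans)
    then have "AE x in lborel. (\<Sum>n. ennreal ((d n x)\<^sup>2)) \<noteq> \<infinity>"
      by (intro nn_integral_noteq_infinite) measurable
    then show ?thesis
    proof eventually_elim
      case (elim x)
      then have "summable (\<lambda>n. (d n x)\<^sup>2)" by (intro summable_suminf_not_top) auto
      then have "(\<lambda>n. (d n x)\<^sup>2) \<longlonglongrightarrow> 0" by (rule summable_LIMSEQ_zero)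
      then have "(\<lambda>n. sqrt ((d n x)\<^sup>2)) \<longlonglongrightarrow> sqrt 0" by (intro tendsto_intros)
      then have "(\<lambda>n. d n x) \<longlonglongrightarrow> 0" by (simp add: tendsto_rabs_zero_iff)
      then have "(\<lambda>n. d n x + rep_L2 (v t) x) \<longlonglongrightarrow> 0 + rep_L2 (v t) x" by (intro tendsto_intros)
      then have "(\<lambda>n. u n (x, t)) \<longlonglongrightarrow> rep_L2 (v t) x" by (simp add: u_def d_def)
      then show ?case by (simp add: U_def limI)
    qed
  qed
  obtain K where K: "\<And>t. t \<in> {0<..<T} \<Longrightarrow> norm (v t) \<le> K"
  proof -
    have "compact (v ` {0..T})" by (intro compact_continuous_image c) simp
    from compact_imp_bounded[OF this] obtain K where "\<And>t. t \<in> {0..T} \<Longrightarrow> norm (v t) \<le> K"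
      unfolding bounded_iff by blast
    then show ?thesis using that[of K] by auto
  qed
  have "integrable (lborel \<Otimes>\<^sub>M lborel) (\<lambda>z. indicator (UNIV \<times> {0<..<T}) z *\<^sub>R (U z)\<^sup>2)"
  proof (rule integrableI_nonneg)
    have Um' [measurable]: "U \<in> borel_measurable (lborel \<Otimes>\<^sub>M lborel)" using Um by simp
    have [measurable]: "UNIV \<times> {0<..<T} \<in> sets (lborel \<Otimes>\<^sub>M lborel :: ((real^2) \<times> real) measure)"
      by (intro pair_measureI) auto
    show m': "(\<lambda>z. indicator (UNIV \<times> {0<..<T}) z *\<^sub>R (U z)\<^sup>2) \<in> borel_measurable (lborel \<Otimes>\<^sub>M lborel)"
      by measurable
    show "AE z in lborel \<Otimes>\<^sub>M lborel. 0 \<le> indicator (UNIV \<times> {0<..<T}) z *\<^sub>R (U z)\<^sup>2" by simp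
    let ?F = "\<lambda>z. ennreal (indicator (UNIV \<times> {0<..<T}) z *\<^sub>R (U z)\<^sup>2)"
    have "(\<integral>\<^sup>+z. ?F z \<partial>(lborel \<Otimes>\<^sub>M lborel)) = (\<integral>\<^sup>+t. \<integral>\<^sup>+x. ?F (x, t) \<partial>lborel \<partial>lborel)"
      by (rule lborel_pair.nn_integral_snd[symmetric]) (use m' in measurable)
    also have "\<dots> \<le> (\<integral>\<^sup>+t. ennreal (K\<^sup>2) * indicator {0<..<T} t \<partial>lborel)"
    proof (rule nn_integral_mono)
      fix t
      show "(\<integral>\<^sup>+x. ?F (x, t) \<partial>lborel) \<le> ennreal (K\<^sup>2) * indicator {0<..<T} t"
      proof (cases "t \<in> {0<..<T}")
        case True
        have "(\<integral>\<^sup>+x. ?F (x, t) \<partial>lborel) = (\<integral>\<^sup>+x. ennreal (rep_L2 (v t) x * rep_L2 (v t) x) \<partial>lborel)"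
          using lim[OF True] True by (intro nn_integral_cong_AE) (auto simp: power2_eq_square)
        also have "\<dots> = ennreal ((norm (v t))\<^sup>2)"
          using nn_integral_eq_integral[OF integrable_rep_mult[of "v t" "v t"]]
          by (simp add: power2_norm_eq_inner inner_L2_rep)
        also have "\<dots> \<le> ennreal (K\<^sup>2)" using K[OF True] by (intro ennreal_leI power_mono) auto
        finally show ?thesis using True by simp
      qed simp
    qed
    also have "\<dots> = ennreal (K\<^sup>2) * emeasure lborel {0<..<T}" by (rule nn_integral_cmult_indicator) simp
    also have "\<dots> < \<infinity>" by (cases "0 \<le> T") (simp_all add: ennreal_mult_less_top)
    finally show "(\<integral>\<^sup>+z. ?F z \<partial>(lborel \<Otimes>\<^sub>M lborel)) < \<infinity>" .
  qed
  then have "set_integrable lborel (UNIV \<times> {0<..<T}) (\<lambda>z. (U z)\<^sup>2)"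
    by (simp add: set_integrable_def lborel_prod)
  moreover have "AE t in lebesgue_on {0<..<T}. AE x in lborel. rep_L2 (v t) x = U (x, t)"
    by (intro AE_I2 lim) simp
  ultimately show ?thesis unfolding L2_space_time_def using Ub by blast
qed

section \<open>The estimates\<close>

lemma has_vector_derivative_quotient:
  assumes "(w has_vector_derivative D) (at t)"
  shows "((\<lambda>s. (w s - w t) /\<^sub>R (s - t)) \<longlongrightarrow> D) (at t)"
proof (rule LIM_zero_cancel, rule tendsto_norm_zero_cancel)
  have "((\<lambda>s. norm ((w s - w t) - (s - t) *\<^sub>R D) / norm (s - t)) \<longlongrightarrow> 0) (at t)"
    using assms by (simp add: has_vector_derivative_def has_derivative_iff_norm)
  moreover have "\<forall>\<^sub>F s in at t. norm ((w s - w t) - (s - t) *\<^sub>R D) / norm (s - t)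
      = norm ((w s - w t) /\<^sub>R (s - t) - D)"
    unfolding eventually_at_filter
  proof (intro always_eventually allI impI)
    fix s assume "s \<noteq> t"
    then have "(w s - w t) /\<^sub>R (s - t) - D = ((w s - w t) - (s - t) *\<^sub>R D) /\<^sub>R (s - t)"
      by (simp add: scaleR_diff_right)
    then show "norm ((w s - w t) - (s - t) *\<^sub>R D) / norm (s - t) = norm ((w s - w t) /\<^sub>R (s - t) - D)"
      by (simp add: divide_inverse mult.commute)
  qed
  ultimately show "((\<lambda>s. norm ((w s - w t) /\<^sub>R (s - t) - D)) \<longlongrightarrow> 0) (at t)"
    by (rule Lim_transform_eventually)
qed

lemma Holder_loc_continuous:
  assumes F: "Holder_loc \<eta> F" and \<eta>: "\<eta> > 0"
  shows "continuous_on {0<..} F"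
proof (rule continuous_at_imp_continuous_on, rule ballI)
  fix t :: real assume "t \<in> {0<..}"
  then have t: "t > 0" by simp
  have "\<exists>C. \<forall>r\<in>{t/2..2*t}. \<forall>s\<in>{t/2..2*t}. norm (F r - F s) \<le> C * \<bar>r - s\<bar> powr \<eta>"
    by (rule F[unfolded Holder_loc_def, rule_format]) (use t in auto)
  then obtain C where C: "\<And>r s. r \<in> {t/2..2*t} \<Longrightarrow> s \<in> {t/2..2*t} \<Longrightarrow> norm (F r - F s) \<le> C * \<bar>r - s\<bar> powr \<eta>"
    by blast
  have lim: "((\<lambda>s. C * \<bar>s - t\<bar> powr \<eta>) \<longlongrightarrow> C * 0) (at t)"
  proof (rule tendsto_mult_left)
    have "((\<lambda>s. \<bar>s - t\<bar>) \<longlongrightarrow> \<bar>t - t\<bar>) (at t)" by (intro tendsto_intros)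
    then show "((\<lambda>s. \<bar>s - t\<bar> powr \<eta>) \<longlongrightarrow> 0) (at t)"
      using tendsto_zero_powrI[of "\<lambda>s. \<bar>s - t\<bar>" "at t" "\<lambda>_. \<eta>" \<eta>] \<eta> by simp
  qed
  have bound: "\<forall>\<^sub>F s in at t. norm (F s - F t) \<le> C * \<bar>s - t\<bar> powr \<eta>"
  proof -
    have "\<forall>\<^sub>F s in at t. s \<in> {t/2<..<2*t}"
      by (rule eventually_at_in_open') (use t in auto)
    then show ?thesis by eventually_elim (use C t in auto)
  qed
  have "((\<lambda>s. F s - F t) \<longlongrightarrow> 0) (at t)"
    by (rule Lim_null_comparison[OF bound lim[unfolded mult_zero_right]])
  then show "isCont F t" unfolding isCont_def by (rule LIM_zero_cancel)
qed

context
  fixes \<kappa> :: real and \<phi> :: "real^2 \<Rightarrow> real" and v0 :: L2 and F v :: "real \<Rightarrow> L2"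
  assumes \<kappa>: "\<kappa> > 0" and \<phi>: "BC2 \<phi>" and v0: "v0 \<in> W12" and FL2: "L2_time {0<..} F"
    and Fc: "continuous_on {0<..} F" and sol: "strong_solution \<kappa> \<phi> v0 F v"
begin

interpretation Gq: bounded_linear "G_quarter \<phi>"
  by (rule bounded_linear_G_quarter[OF \<phi>])

lemma strong_solution_energy_estimate:
  fixes dv Lv GF :: "real \<Rightarrow> L2"
  defines "dv \<equiv> \<lambda>t. G_quarter \<phi> (vector_derivative v (at t))"
    and "Lv \<equiv> \<lambda>t. G_quarter \<phi> (L_op \<kappa> \<phi> (v t))" and "GF \<equiv> \<lambda>t. G_quarter \<phi> (F t)"
  shows "T > 0 \<Longrightarrow> L2_time {0<..<T} dv \<and> L2_time {0<..<T} Lv \<and>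
      L2_time_norm {0<..<T} dv + L2_time_norm {0<..<T} Lv
        \<le> 2 * sqrt (\<kappa> * (W12_Gamma_norm \<phi> v0)\<^sup>2) + 6 * L2_time_norm {0<..<T} GF" (is "_ \<Longrightarrow> ?A T")
    and "L2_time {0<..} dv \<and> L2_time {0<..} Lv \<and>
      L2_time_norm {0<..} dv + L2_time_norm {0<..} Lv
        \<le> 2 * sqrt (\<kappa> * (W12_Gamma_norm \<phi> v0)\<^sup>2) + 6 * L2_time_norm {0<..} GF" (is ?B)
proof -
  note S = sol[unfolded strong_solution_def]
  let ?a = "dirichlet_form \<kappa> \<phi>"
  define w where "w t = G_quarter \<phi> (v t)" for t
  define e where "e t = ?a (v t) (v t)" for t
  define e0 where "e0 = \<kappa> * (W12_Gamma_norm \<phi> v0)\<^sup>2"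
  have W22: "v t \<in> W22" and W12: "v t \<in> W12" if "t > 0" for t using S that by (auto simp: W22_def)
  have gc: "continuous_on S (\<lambda>t. G_quarter \<phi> (h t))" if "continuous_on S h" for S and h :: "real \<Rightarrow> L2"
    using that by (rule Gq.continuous_on)
  have wc: "continuous_on {0..} w" unfolding w_def using S by (intro gc) simp
  have w0: "w 0 = G_quarter \<phi> v0" using S by (simp add: w_def)
  have dw: "(w has_vector_derivative dv t) (at t)" if "t > 0" for t
  proof -
    have "v differentiable (at t)" using S that by simp
    then show ?thesis unfolding w_def dv_def
      by (intro Gq.has_vector_derivative) (simp add: vector_derivative_works)
  qed
  have evol: "dv t + Lv t = GF t" if "t > 0" for t
    using S that by (simp add: dv_def Lv_def GF_def Gq.add[symmetric])
  have dvc: "continuous_on {0<..} dv" unfolding dv_def using S by (intro gc) simp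
  have GFc: "continuous_on {0<..} GF" unfolding GF_def using Fc by (rule gc)
  have Lvc: "continuous_on {0<..} Lv"
  proof -
    have "continuous_on {0<..} (\<lambda>t. GF t - dv t)" by (intro continuous_intros GFc dvc)
    moreover have "GF t - dv t = Lv t" if "t \<in> {0<..}" for t
      using evol[of t] that by (simp add: algebra_simps)
    ultimately show ?thesis by (rule continuous_on_eq)
  qed
  have pair: "Lv t \<bullet> G_quarter \<phi> g = ?a (v t) g" if "t > 0" "g \<in> W12" for t g
    unfolding Lv_def by (rule inner_G_quarter_L_op[OF \<phi> W22[OF that(1)] that(2)])
  have ed: "(e has_real_derivative 2 * (Lv t \<bullet> dv t)) (at t)" if t: "t > 0" for t
  proof -
    \<comment> \<open>the mixed terms cancel by symmetry of the form\<close>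
    have diff: "e s - e t = (Lv s + Lv t) \<bullet> (w s - w t)" if s: "s > 0" for s
    proof -
      have "(Lv s + Lv t) \<bullet> (w s - w t) = (Lv s + Lv t) \<bullet> G_quarter \<phi> (v s - v t)"
        by (simp add: w_def Gq.diff)
      also have "\<dots> = ?a (v s) (v s - v t) + ?a (v t) (v s - v t)"
        using s t W12 by (simp add: inner_add_left pair W12_diff)
      also have "\<dots> = e s - e t"
        using s t W12 dirichlet_form_sym[OF \<phi>, of \<kappa> "v s" "v t"]
        by (simp add: e_def dirichlet_form_diff_right[OF \<phi>])
      finally show ?thesis by simp
    qed
    have "((\<lambda>s. (w s - w t) /\<^sub>R (s - t)) \<longlongrightarrow> dv t) (at t)"
      by (rule has_vector_derivative_quotient[OF dw[OF t]])
    moreover have "(Lv \<longlongrightarrow> Lv t) (at t)"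
      using Lvc t by (simp add: continuous_on_eq_continuous_at isCont_def)
    ultimately have "((\<lambda>s. (Lv s + Lv t) \<bullet> ((w s - w t) /\<^sub>R (s - t))) \<longlongrightarrow> (Lv t + Lv t) \<bullet> dv t) (at t)"
      by (intro tendsto_intros)
    moreover have "\<forall>\<^sub>F s in at t. (Lv s + Lv t) \<bullet> ((w s - w t) /\<^sub>R (s - t)) = (e s - e t) / (s - t)"
    proof -
      have "\<forall>\<^sub>F s in at t. s \<in> {0<..}" by (rule eventually_at_in_open') (use t in auto)
      then show ?thesis by eventually_elim (simp add: diff divide_inverse mult.commute)
    qed
    ultimately have "((\<lambda>s. (e s - e t) / (s - t)) \<longlongrightarrow> (Lv t + Lv t) \<bullet> dv t) (at t)"
      by (rule Lim_transform_eventually)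
    then show ?thesis by (simp add: has_field_derivative_iff inner_add_left)
  qed
  have enn: "e t \<ge> 0" for t unfolding e_def using \<kappa> by (intro dirichlet_form_nonneg[OF \<phi>]) simp
  have e0: "e0 \<ge> 0" using \<kappa> by (simp add: e0_def)
  have sub: "(e t - e0) / 2 \<le> Lv t \<bullet> (w t - w 0)" if t: "t > 0" for t
  proof -
    have "Lv t \<bullet> (w t - w 0) = Lv t \<bullet> G_quarter \<phi> (v t - v0)" unfolding w0 by (simp add: w_def Gq.diff)
    also have "\<dots> = ?a (v t) (v t - v0)" using W12[OF t] v0 by (intro pair[OF t] W12_diff)
    also have "\<dots> = e t - ?a (v t) v0"
      using W12[OF t] v0 by (simp add: e_def dirichlet_form_diff_right[OF \<phi>])
    finally have 1: "Lv t \<bullet> (w t - w 0) = e t - ?a (v t) v0" .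
    have "0 \<le> ?a (v t - v0) (v t - v0)" using \<kappa> by (intro dirichlet_form_nonneg[OF \<phi>]) simp
    also have "\<dots> = ?a (v t - v0) (v t) - ?a (v t - v0) v0"
      by (rule dirichlet_form_diff_right[OF \<phi> W12[OF t] v0])
    also have "\<dots> = ?a (v t) (v t - v0) - ?a v0 (v t - v0)"
      by (simp add: dirichlet_form_sym[OF \<phi>, of \<kappa> "v t - v0"])
    also have "\<dots> = e t - 2 * ?a (v t) v0 + ?a v0 v0"
      using dirichlet_form_sym[OF \<phi>, of \<kappa> v0 "v t"]
      by (simp add: e_def dirichlet_form_diff_right[OF \<phi> W12[OF t] v0])
    finally have "2 * ?a (v t) v0 \<le> e t + ?a v0 v0" by simp
    moreover have "?a v0 v0 \<le> e0"
      unfolding e0_def using \<kappa> by (intro dirichlet_form_le_W12_Gamma_norm[OF \<phi>]) simp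
    ultimately show ?thesis unfolding 1 by simp
  qed
  have GFL2: "L2_time {0<..} GF"
  proof -
    obtain K where K: "\<And>h. norm (G_quarter \<phi> h) \<le> norm h * K" "K > 0" using Gq.pos_bounded by blast
    have m: "(\<lambda>t. (norm (GF t))\<^sup>2) \<in> borel_measurable (lebesgue_on {0<..})"
      by (intro measurable_continuous_lebesgue_on continuous_intros GFc) simp
    have "integrable (lebesgue_on {0<..}) (\<lambda>t. (norm (GF t))\<^sup>2)"
    proof (rule Bochner_Integration.integrable_bound)
      show "integrable (lebesgue_on {0<..}) (\<lambda>t. (norm (F t))\<^sup>2 * K\<^sup>2)"
        using FL2 by (simp add: L2_time_def)
      show "AE t in lebesgue_on {0<..}. norm ((norm (GF t))\<^sup>2) \<le> norm ((norm (F t))\<^sup>2 * K\<^sup>2)"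
        using power_mono[OF K(1), of _ 2] by (simp add: GF_def power_mult_distrib)
    qed (rule m)
    then show ?thesis
      using measurable_continuous_lebesgue_on[OF GFc] by (simp add: L2_time_def)
  qed
  note E = energy_estimate[OF wc dw evol dvc GFc ed enn e0 sub GFL2]
  show "T > 0 \<Longrightarrow> ?A T" using E(1)[of T] by (simp add: e0_def)
  show ?B using E(2) by (simp add: e0_def)
qed

end

theorem theorem2p6:
  fixes Cstar :: "real \<Rightarrow> real"
  assumes "\<And>\<kappa>. \<kappa> > 0 \<Longrightarrow> Cstar \<kappa> > 0 \<and> maximal_regularity_constant \<kappa> (Cstar \<kappa>)"
  shows "\<exists>C1 C2 :: real \<Rightarrow> real \<Rightarrow> real.
    (\<forall>\<kappa> M. \<kappa> > 0 \<and> M \<ge> 0 \<longrightarrow> C1 \<kappa> M > 0 \<and> C2 \<kappa> M > 0) \<and>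
    (\<forall>\<kappa> \<phi> v0 F \<eta> v.
      \<kappa> > 0 \<and> BC2 \<phi> \<and> v0 \<in> W12 \<and>
      L2_time {0<..} F \<and> 0 < \<eta> \<and> \<eta> < 1 \<and> Holder_loc \<eta> F \<and>
      gradient_sup_norm \<phi> \<le> 1 / 4 \<and>
      gradient_sup_norm \<phi> \<le> 1 / (4 * sqrt (Cstar \<kappa>)) \<and>
      strong_solution \<kappa> \<phi> v0 F v \<longrightarrow>
      (let M = hessian_sup_norm \<phi>;
           dv = (\<lambda>t. G_quarter \<phi> (vector_derivative v (at t)));
           Lv = (\<lambda>t. G_quarter \<phi> (L_op \<kappa> \<phi> (v t)));
           GF = (\<lambda>t. G_quarter \<phi> (F t))
       in
        (\<forall>T>0. L2_time {0<..<T} dv \<and> L2_time {0<..<T} Lv \<and>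
           L2_time_norm {0<..<T} dv + L2_time_norm {0<..<T} Lv
             \<le> C1 \<kappa> M * W12_Gamma_norm \<phi> v0
               + C1 \<kappa> M * (1 + sqrt T) * L2_time_norm {0<..<T} GF) \<and>
        (\<forall>Q :: real \<Rightarrow> L2^3.
           (\<forall>i. L2_time_W12 {0<..} (\<lambda>t. Q t $ i)) \<and>
           (AE t in lebesgue_on {0<..}. F t = surface_div \<phi> (Q t)) \<and>
           (AE t in lebesgue_on {0<..}.
              dot_L2 (\<lambda>x. cross3 (tangent \<phi> 1 x) (tangent \<phi> 2 x)) (Q t) = 0) \<longrightarrow>
           L2_time {0<..} dv \<and> L2_time {0<..} Lv \<and>
           L2_time_norm {0<..} dv + L2_time_norm {0<..} Lv
             \<le> C2 \<kappa> M * (W12_Gamma_norm \<phi> v0 + L2_time_norm {0<..} GF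
               + L2_time_norm {0<..} (\<lambda>t. \<chi> i. G_quarter \<phi> (Q t $ i)))) \<and>
        ((\<forall>t>0. F t = 0) \<longrightarrow>
           L2_time {0<..} dv \<and> L2_time {0<..} Lv \<and>
           L2_time_norm {0<..} dv + L2_time_norm {0<..} Lv
             \<le> C2 \<kappa> M * W12_Gamma_norm \<phi> v0) \<and>
        (L2_space_time {0<..} F \<longrightarrow> (\<forall>T>0. L2_space_time {0<..<T} v))))"
proof -
  \<comment> \<open>6 is the factor of the forcing in the energy estimate, and \<open>2 * sqrt \<kappa>\<close> that of the initial norm\<close>
  define C :: "real \<Rightarrow> real \<Rightarrow> real" where "C \<kappa> M = 6 + 2 * sqrt \<kappa>" for \<kappa> M
  show ?thesis
  proof (intro exI[of _ C] conjI allI impI; (elim conjE)?)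
    show "C \<kappa> M > 0" "C \<kappa> M > 0" if "\<kappa> > 0" for \<kappa> M
      using that by (simp_all add: C_def add_pos_pos)
  next
    fix \<kappa> :: real and \<phi> v0 F \<eta> v
    assume *: "\<kappa> > 0" "BC2 \<phi>" "v0 \<in> W12" "L2_time {0<..} F" "0 < \<eta>" "Holder_loc \<eta> F"
      "strong_solution \<kappa> \<phi> v0 F v"
    define M where "M = hessian_sup_norm \<phi>"
    define dv where "dv = (\<lambda>t. G_quarter \<phi> (vector_derivative v (at t)))"
    define Lv where "Lv = (\<lambda>t. G_quarter \<phi> (L_op \<kappa> \<phi> (v t)))"
    define GF where "GF = (\<lambda>t. G_quarter \<phi> (F t))"
    define W where "W = W12_Gamma_norm \<phi> v0"
    note est = strong_solution_energy_estimate[OF *(1-4) Holder_loc_continuous[OF *(6,5)] *(7),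
        folded dv_def Lv_def GF_def W_def]
    have W: "W \<ge> 0" unfolding W_def by (rule dirichlet_form_le_W12_Gamma_norm(2)[OF *(2), of 1]) simp
    have N: "L2_time_norm S h \<ge> 0" for S and h :: "real \<Rightarrow> 'b::real_normed_vector"
      by (simp add: L2_time_norm_def)
    have s: "2 * sqrt (\<kappa> * W\<^sup>2) \<le> C \<kappa> M * W"
      using W *(1) by (simp add: C_def real_sqrt_mult distrib_right)
    have C6: "C \<kappa> M \<ge> 6" using *(1) by (simp add: C_def)
    have 1: "L2_time {0<..<T} dv \<and> L2_time {0<..<T} Lv \<and>
           L2_time_norm {0<..<T} dv + L2_time_norm {0<..<T} Lv
             \<le> C \<kappa> M * W + C \<kappa> M * (1 + sqrt T) * L2_time_norm {0<..<T} GF" if T: "T > 0" for T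
    proof -
      have "6 * 1 \<le> C \<kappa> M * (1 + sqrt T)" using C6 T by (intro mult_mono) auto
      then have "6 * L2_time_norm {0<..<T} GF \<le> C \<kappa> M * (1 + sqrt T) * L2_time_norm {0<..<T} GF"
        by (intro mult_right_mono N) simp
      then show ?thesis using est(1)[OF T] s by linarith
    qed
    have 2: "L2_time {0<..} dv \<and> L2_time {0<..} Lv \<and>
           L2_time_norm {0<..} dv + L2_time_norm {0<..} Lv
             \<le> C \<kappa> M * (W + L2_time_norm {0<..} GF + L2_time_norm {0<..} q)" for q :: "real \<Rightarrow> L2^3"
    proof -
      have "6 * L2_time_norm {0<..} GF \<le> C \<kappa> M * L2_time_norm {0<..} GF"
        using C6 by (intro mult_right_mono N)
      moreover have "0 \<le> C \<kappa> M * L2_time_norm {0<..} q" using C6 N by (intro mult_nonneg_nonneg) auto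
      ultimately show ?thesis using est(2) s unfolding distrib_left by linarith
    qed
    have 3: "L2_time {0<..} dv \<and> L2_time {0<..} Lv \<and>
           L2_time_norm {0<..} dv + L2_time_norm {0<..} Lv \<le> C \<kappa> M * W" if F0: "\<forall>t>0. F t = 0"
    proof -
      have "G_quarter \<phi> 0 = 0" by (rule linear_0[OF bounded_linear.linear[OF bounded_linear_G_quarter[OF *(2)]]])
      then have "(LINT t|lebesgue_on {0<..}. (norm (GF t))\<^sup>2) = (LINT t|lebesgue_on {(0::real)<..}. 0)"
        using F0 by (intro Bochner_Integration.integral_cong) (auto simp: GF_def)
      then have "L2_time_norm {0<..} GF = 0" by (simp add: L2_time_norm_def)
      then show ?thesis using est(2) s by simp
    qed
    have 4: "L2_space_time {0<..<T} v" for T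
      using *(7) by (intro L2_space_time_continuous) (simp add: strong_solution_def)
    show "let M = hessian_sup_norm \<phi>;
           dv = (\<lambda>t. G_quarter \<phi> (vector_derivative v (at t)));
           Lv = (\<lambda>t. G_quarter \<phi> (L_op \<kappa> \<phi> (v t)));
           GF = (\<lambda>t. G_quarter \<phi> (F t))
       in
        (\<forall>T>0. L2_time {0<..<T} dv \<and> L2_time {0<..<T} Lv \<and>
           L2_time_norm {0<..<T} dv + L2_time_norm {0<..<T} Lv
             \<le> C \<kappa> M * W12_Gamma_norm \<phi> v0
               + C \<kappa> M * (1 + sqrt T) * L2_time_norm {0<..<T} GF) \<and>
        (\<forall>Q :: real \<Rightarrow> L2^3.
           (\<forall>i. L2_time_W12 {0<..} (\<lambda>t. Q t $ i)) \<and>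
           (AE t in lebesgue_on {0<..}. F t = surface_div \<phi> (Q t)) \<and>
           (AE t in lebesgue_on {0<..}.
              dot_L2 (\<lambda>x. cross3 (tangent \<phi> 1 x) (tangent \<phi> 2 x)) (Q t) = 0) \<longrightarrow>
           L2_time {0<..} dv \<and> L2_time {0<..} Lv \<and>
           L2_time_norm {0<..} dv + L2_time_norm {0<..} Lv
             \<le> C \<kappa> M * (W12_Gamma_norm \<phi> v0 + L2_time_norm {0<..} GF
               + L2_time_norm {0<..} (\<lambda>t. \<chi> i. G_quarter \<phi> (Q t $ i)))) \<and>
        ((\<forall>t>0. F t = 0) \<longrightarrow>
           L2_time {0<..} dv \<and> L2_time {0<..} Lv \<and>
           L2_time_norm {0<..} dv + L2_time_norm {0<..} Lv
             \<le> C \<kappa> M * W12_Gamma_norm \<phi> v0) \<and>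
        (L2_space_time {0<..} F \<longrightarrow> (\<forall>T>0. L2_space_time {0<..<T} v))"
      unfolding Let_def M_def[symmetric] dv_def[symmetric] Lv_def[symmetric] GF_def[symmetric] W_def[symmetric]
      using 1 2 3 4 by blast
  qed
qed

end
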